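(* Let $p\in(0,1)$ be fixed and, for $n\in\mathbb{N}$, let $\mathbf{C}_{n,p}$ be the number of connected components (clusters) of the random cluster graph $\mathbf{CG}_{n,p}$. (i) If $p>1/2$, then $\lim_{n\to\infty}\mathbb{P}(\mathbf{C}_{n,p}=1)=1$; put differently, $\mathbf{CG}_{n,p}=K_n$ with high probability, where $K_n$ is the complete graph on $n$ vertices. (ii) If $p=1/2$, then $\dfrac{\mathbf{C}_{n,p}-\mathbb{E}\mathbf{C}_{n,p}}{\sqrt{\operatorname{Var}(\mathbf{C}_{n,p})}}$ converges in distribution to the standard Gaussian $\mathcal{N}(0,1)$ as $n\to\infty$. Moreover, $\mathbb{E}\mathbf{C}_{n,p}\sim \dfrac{n}{\log n}$ and $\operatorname{Var}(\mathbf{C}_{n,p})\sim\dfrac{n}{(\log n)^2}$. (iii) If $p<1/2$, then $\dfrac{\mathbf{C}_{n,p}-\mathbb{E}\mathbf{C}_{n,p}}{\sqrt{\operatorname{Var}(\mathbf{C}_{n,p})}}$ converges in distribution to $\mathcal{N}(0,1)$ as $n\to\infty$. Moreover, $$\mathbb{E}\mathbf{C}_{n,p}\sim\sqrt{\frac{\log(1-p)-\log p}{2}}\,\frac{n}{\sqrt{\log n}}\quad\text{and}\quad \operatorname{Var}(\mathbf{C}_{n,p})=\Theta\left(\frac{n}{(\log n)^{3/2}}\right).$$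
   Context: A cluster graph is a simple undirected graph on the labelled vertex set $\{1,\dots,n\}$ every connected component of which is a complete graph. For $p\in(0,1)$, the random cluster graph $\mathbf{CG}_{n,p}$ is the Erdős–Rényi random graph on $n$ vertices with edge probability $p$ (each of the $\binom n2$ edges present independently with probability $p$), conditioned on the event that it is a cluster graph. All asymptotics are as $n\to\infty$ with $p$ fixed; $f\sim g$ means $f/g\to1$, and $f=\Theta(g)$ means $f/g$ is eventually bounded above and bounded below away from $0$. "With high probability" means with probability tending to $1$. *)

theory Defs
  imports
    "HOL-Probability.Probability"
    "HOL-Library.Landau_Symbols"
begin

text \<open>A simple graph on the vertex set $\{1,\dots,n\}$ is represented by its edge set,
  a subset of \<open>complete_graph_edges n\<close>.\<close>

definition complete_graph_edges :: "nat \<Rightarrow> nat set set" where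
  "complete_graph_edges n = {e. e \<subseteq> {1..n} \<and> card e = 2}"

definition adj_rel :: "'a set set \<Rightarrow> ('a \<times> 'a) set" where
  "adj_rel E = {(u, v). u \<noteq> v \<and> {u, v} \<in> E}"

text \<open>Connected components as vertex sets; isolated vertices form singleton components.\<close>

definition graph_components :: "nat \<Rightarrow> nat set set \<Rightarrow> nat set set" where
  "graph_components n E = {1..n} // Restr ((adj_rel E)\<^sup>*) {1..n}"

definition cluster_graph :: "nat \<Rightarrow> nat set set \<Rightarrow> bool" where
  "cluster_graph n E \<longleftrightarrow>
     E \<subseteq> complete_graph_edges n \<and>
     (\<forall>K \<in> graph_components n E. \<forall>u \<in> K. \<forall>v \<in> K. u \<noteq> v \<longrightarrow> {u, v} \<in> E)"

definition erdos_renyi :: "nat \<Rightarrow> real \<Rightarrow> nat set set pmf" where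
  "erdos_renyi n p =
     map_pmf (\<lambda>x. {e \<in> complete_graph_edges n. x e})
       (Pi_pmf (complete_graph_edges n) False (\<lambda>_. bernoulli_pmf p))"

text \<open>For $0 < p < 1$ the conditioning event has positive probability
  (lemma \<open>cluster_graph_possible\<close> below), so that \<open>cond_pmf\<close> is meaningful.\<close>

definition random_cluster_graph :: "nat \<Rightarrow> real \<Rightarrow> nat set set pmf" where
  "random_cluster_graph n p = cond_pmf (erdos_renyi n p) {E. cluster_graph n E}"

definition num_clusters :: "nat \<Rightarrow> nat set set \<Rightarrow> real" where
  "num_clusters n E = real (card (graph_components n E))"

definition mean_clusters :: "nat \<Rightarrow> real \<Rightarrow> real" where
  "mean_clusters n p = measure_pmf.expectation (random_cluster_graph n p) (num_clusters n)"

definition var_clusters :: "nat \<Rightarrow> real \<Rightarrow> real" where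
  "var_clusters n p = measure_pmf.variance (random_cluster_graph n p) (num_clusters n)"

text \<open>The law of the standardised number of clusters. Where the variance vanishes
  (which happens for $n \le 1$) it is the point mass at 0, as \<open>x / 0 = 0\<close>.\<close>

definition standardised_clusters :: "nat \<Rightarrow> real \<Rightarrow> real measure" where
  "standardised_clusters n p =
     distr (measure_pmf (random_cluster_graph n p)) borel
       (\<lambda>E. (num_clusters n E - mean_clusters n p) / sqrt (var_clusters n p))"

lemma finite_complete_graph_edges: "finite (complete_graph_edges n)"
  unfolding complete_graph_edges_def by (rule finite_subset[of _ "Pow {1..n}"]) auto

lemma cluster_graph_empty: "cluster_graph n {}"
proof -
  have "adj_rel ({} :: nat set set) = {}"
    by (auto simp: adj_rel_def)
  then show ?thesis
    by (auto simp: cluster_graph_def graph_components_def quotient_def)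
qed

lemma cluster_graph_possible:
  assumes "0 < p" "p < 1"
  shows "set_pmf (erdos_renyi n p) \<inter> {E. cluster_graph n E} \<noteq> {}"
proof -
  have "(\<lambda>_. False) \<in> set_pmf (Pi_pmf (complete_graph_edges n) False (\<lambda>_. bernoulli_pmf p))"
    using assms by (subst set_Pi_pmf) (auto simp: finite_complete_graph_edges PiE_dflt_def set_pmf_bernoulli)
  then have "{} \<in> set_pmf (erdos_renyi n p)"
    unfolding erdos_renyi_def set_map_pmf by force
  then show ?thesis
    using cluster_graph_empty by blast
qed

end

theory Submission
  imports Defs "HOL-Complex_Analysis.Complex_Analysis" "HOL-Real_Asymp.Real_Asymp"
begin

text \<open>
  A cluster graph is a set partition, and with \<open>r = p / (1 - p)\<close> the partition \<open>P\<close> has probability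
  proportional to the product of \<open>r ^ (card B choose 2)\<close> over its blocks \<open>B\<close>. For \<open>r > 1\<close> the recursion that
  splits off the block of one element shows that the single block carries almost all the weight.

  For \<open>r \<le> 1\<close> let \<open>W(z)\<close> be the exponential generating function of \<open>r ^ (k choose 2)\<close>, \<open>k \<ge> 1\<close>. The
  moment generating function of the number of clusters at \<open>s\<close> is a quotient of coefficients of \<open>exp (y W(z))\<close>,
  with \<open>y = exp s\<close> in the numerator and \<open>y = 1\<close> in the denominator. Choose \<open>x\<close> with \<open>x W'(x) = n\<close> and write
  both coefficients as Cauchy integrals over circles about 0. With \<open>p\<^sub>k = r ^ (k choose 2) x ^ k / k!\<close> the
  integrand is the joint transform of the pair (number of blocks, total size) when blocks of size \<open>k\<close> occur
  as independent Poisson variables of mean \<open>p\<^sub>k\<close>. Shifting the contour by a (complex) multiple of \<open>s\<close>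
  replaces the number of blocks by its residual after linear regression on the total size, so that the
  quadratic part of the exponent is diagonal. Since \<open>W(x)\<close> exceeds every power of \<open>x\<close>, crude bounds that
  lose powers of \<open>x\<close> suffice for dominated convergence, and the normalised moment generating function
  tends to \<open>exp (s\<^sup>2 / 2)\<close> for every complex \<open>s\<close>. This yields the limit law by Levy's theorem, and mean
  and variance by Cauchy's formula on the unit circle. It remains to express \<open>W(x)\<close> and the residual
  variance through \<open>n\<close>: explicitly for \<open>r = 1\<close>, and through the mode of the nearly Gaussian weights \<open>p\<^sub>k\<close>
  for \<open>r < 1\<close>.
\<close>

section \<open>Cluster graphs and set partitions\<close>

text \<open>The number of blocks and the total size are strongly correlated, so conditioning on the
  size leaves a variance far below \<open>W(x)\<close>, and division by its root threatens every
  error bound. A lower bound that loses a power of \<open>x\<close> is enough. The residual variance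
  is \<open>W\<close> times the variance of a block size under the law \<open>p_k / W\<close>,
  divided by its second moment; so it suffices that two adjacent sizes, the mode and its successor,
  each carry weight at least \<open>W / x^2\<close>. The same two sizes rule out periodicity of the
  integrand away from angle 0. The saddle point \<open>x\<close> is that of \<open>s = 0\<close> for
  all \<open>s\<close>: the regression shift replaces a saddle point moving with \<open>s\<close>,
  and its factor combines with the centring so that the normalised variable is the number of blocks
  minus \<open>W\<close>, over the residual standard deviation. Complex \<open>s\<close> serve
  twice: imaginary values give the characteristic function, values on the unit circle the moments,
  so convergence of mean and variance needs no separate uniform integrability argument. For
  \<open>r > 1\<close> the series \<open>W\<close> has radius of convergence 0, hence the separate
  treatment.\<close>

definition partition_sum :: "(nat \<Rightarrow> 'c::comm_semiring_1) \<Rightarrow> 'a set \<Rightarrow> 'c" where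
  "partition_sum f A = (\<Sum>P | partition_on A P. \<Prod>B\<in>P. f (card B))"

text \<open>A partition of \<open>insert a A\<close> corresponds to a pair: the companions
  \<open>D\<close> of \<open>a\<close> in its block, and the partition \<open>Q\<close> that the
  remaining blocks form on \<open>A - D\<close>.\<close>

lemma partition_sum_insert:
  assumes A: "finite A" and a: "a \<notin> A"
  shows "partition_sum f (insert a A) = (\<Sum>D\<in>Pow A. f (Suc (card D)) * partition_sum f (A - D))"
proof -
  let ?g = "\<lambda>(D, Q). insert (insert a D) Q"
  let ?b = "\<lambda>P. THE B. B \<in> P \<and> a \<in> B"
  let ?S = "Sigma (Pow A) (\<lambda>D. {Q. partition_on (A - D) Q})"
  have block: "?b P \<in> P \<and> a \<in> ?b P" if "partition_on (insert a A) P" for P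
  proof -
    have "\<exists>!B. B \<in> P \<and> a \<in> B"
      using that by (auto simp: partition_on_def disjoint_def)
    then show ?thesis by (rule theI')
  qed
  have uniq: "B = B'" if "partition_on (insert a A) P" "B \<in> P" "B' \<in> P" "x \<in> B" "x \<in> B'" for P B B' x
    using that by (auto simp: partition_on_def disjoint_def)
  have part: "partition_on (insert a A) (insert (insert a D) Q)"
    if "D \<subseteq> A" "partition_on (A - D) Q" for D Q
  proof -
    have "\<Union>Q = A - D" using that by (auto simp: partition_on_def)
    then have "disjnt (insert a D) (\<Union>Q)" using a by (auto simp: disjnt_def)
    moreover have "insert a A - insert a D = A - D" using a by auto
    ultimately show ?thesis using that by (subst partition_on_insert) auto
  qed
  have notin: "insert a D \<notin> Q" if "D \<subseteq> A" "partition_on (A - D) Q" for D Q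
    using that a by (auto simp: partition_on_def)
  have finQ: "finite Q" if "partition_on (A - D) Q" for D Q
    using that A finite_elements by blast
  have "partition_sum f (insert a A) = (\<Sum>P | partition_on (insert a A) P. \<Prod>B\<in>P. f (card B))"
    by (simp add: partition_sum_def)
  also have "\<dots> = (\<Sum>(D,Q)\<in>?S. f (Suc (card D)) * (\<Prod>B\<in>Q. f (card B)))"
  proof (rule sum.reindex_bij_witness[where i = ?g and j = "\<lambda>P. (?b P - {a}, P - {?b P})"], goal_cases)
    case (1 P)
    then show ?case using block[of P] by (auto simp: insert_absorb)
  next
    case (2 P)
    then have P: "partition_on (insert a A) P" by simp
    note b = block[OF P]
    have sub: "?b P - {a} \<subseteq> A" using b P by (auto simp: partition_on_def)
    have "partition_on (A - (?b P - {a})) (P - {?b P})"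
    proof (rule partition_onI)
      show "\<Union>(P - {?b P}) = A - (?b P - {a})"
      proof (intro equalityI subsetI)
        fix x assume "x \<in> \<Union>(P - {?b P})"
        then obtain B where B: "B \<in> P" "B \<noteq> ?b P" "x \<in> B" by auto
        then have "x \<notin> ?b P" using uniq[OF P, of B "?b P" x] b by auto
        moreover have "x \<in> insert a A" using P B by (auto simp: partition_on_def)
        ultimately show "x \<in> A - (?b P - {a})" using b by auto
      next
        fix x assume x: "x \<in> A - (?b P - {a})"
        then have "x \<in> \<Union>P" using P by (auto simp: partition_on_def)
        then obtain B where "B \<in> P" "x \<in> B" by auto
        moreover have "x \<noteq> a" using x a by auto
        ultimately show "x \<in> \<Union>(P - {?b P})" using x by auto
      qed
      show "{} \<notin> P - {?b P}" using P by (auto simp: partition_on_def)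
      show "disjnt p q" if "p \<in> P - {?b P}" "q \<in> P - {?b P}" "p \<noteq> q" for p q
        using that uniq[OF P] by (auto simp: disjnt_def)
    qed
    then show ?case using sub by simp
  next
    case (3 DQ)
    then obtain D Q where DQ: "DQ = (D, Q)" "D \<subseteq> A" "partition_on (A - D) Q" by auto
    have b: "?b (insert (insert a D) Q) = insert a D"
      using uniq[OF part[OF DQ(2,3)], of "?b (insert (insert a D) Q)" "insert a D" a]
        block[OF part[OF DQ(2,3)]] by simp
    have "a \<notin> D" using a DQ(2) by auto
    then show ?case using notin[OF DQ(2,3)] unfolding DQ(1) case_prod_conv b by simp
  next
    case (4 DQ)
    then show ?case using part by auto
  next
    case (5 P)
    then have P: "partition_on (insert a A) P" by simp
    have "finite P" using P A finite_elements by blast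
    moreover have "finite (?b P)" using block[OF P] P A
      by (metis finite_insert Sup_upper finite_subset partition_on_def)
    moreover have "Suc (card (?b P - {a})) = card (?b P)"
      using block[OF P] calculation by (intro card_Suc_Diff1) auto
    ultimately show ?case
      using block[OF P] by (simp add: prod.remove[of P "?b P"] mult.commute)
  qed
  also have "\<dots> = (\<Sum>D\<in>Pow A. f (Suc (card D)) * partition_sum f (A - D))"
    using A by (subst sum.Sigma[symmetric])
      (auto simp: partition_sum_def sum_distrib_left finitely_many_partition_on)
  finally show ?thesis .
qed

lemma sum_Pow_card:
  fixes g :: "nat \<Rightarrow> 'c::comm_semiring_1"
  assumes "finite A"
  shows "(\<Sum>D\<in>Pow A. g (card D)) = (\<Sum>k\<le>card A. of_nat (card A choose k) * g k)"
proof -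
  have "(\<Sum>D\<in>Pow A. g (card D)) = (\<Sum>k\<le>card A. \<Sum>D\<in>{D \<in> Pow A. card D = k}. g (card D))"
    using assms by (intro sum.group[symmetric]) (auto intro: card_mono)
  also have "\<dots> = (\<Sum>k\<le>card A. of_nat (card A choose k) * g k)"
    using assms by (intro sum.cong refl) (simp add: n_subsets[symmetric] Collect_conj_eq)
  finally show ?thesis .
qed

text \<open>Splitting off the block of one element determines the sums by recursion on the
  cardinality, so every sequence satisfying that recursion agrees with them. It is applied to
  \<open>cluster_poly\<close>, an analytic object, and to \<open>cluster_total\<close>, defined by
  the recursion itself.\<close>

lemma partition_sum_card:
  fixes f z :: "nat \<Rightarrow> 'c::comm_semiring_1"
  assumes z0: "z 0 = 1"
    and zSuc: "\<And>n. z (Suc n) = (\<Sum>k\<le>n. of_nat (n choose k) * (f (Suc k) * z (n - k)))"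
  shows "finite A \<Longrightarrow> partition_sum f A = z (card A)"
proof (induction "card A" arbitrary: A rule: less_induct)
  case less
  show ?case
  proof (cases "A = {}")
    case True
    then show ?thesis by (simp add: partition_sum_def partition_on_empty z0)
  next
    case False
    then obtain a A' where A: "A = insert a A'" "a \<notin> A'" by (meson Set.set_insert all_not_in_conv)
    have fin: "finite A'" using A less.prems by auto
    have "partition_sum f A = (\<Sum>D\<in>Pow A'. f (Suc (card D)) * partition_sum f (A' - D))"
      unfolding A(1) by (rule partition_sum_insert[OF fin A(2)])
    also have "\<dots> = (\<Sum>D\<in>Pow A'. f (Suc (card D)) * z (card A' - card D))"
    proof (intro sum.cong refl)
      fix D assume D: "D \<in> Pow A'"
      then have "card (A' - D) = card A' - card D"
        using fin by (auto simp: card_Diff_subset finite_subset)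
      moreover have "card (A' - D) < card A"
        using A fin card_mono[of A' "A' - D"] by auto
      ultimately show "f (Suc (card D)) * partition_sum f (A' - D) = f (Suc (card D)) * z (card A' - card D)"
        using less.hyps[of "A' - D"] fin by simp
    qed
    also have "\<dots> = (\<Sum>k\<le>card A'. of_nat (card A' choose k) * (f (Suc k) * z (card A' - k)))"
      by (rule sum_Pow_card[OF fin])
    also have "\<dots> = z (card A)"
      using A fin zSuc[of "card A'"] by simp
    finally show ?thesis .
  qed
qed

text \<open>The edges of the disjoint union of complete graphs on the blocks of \<open>P\<close>;
  this inverts \<open>graph_components n\<close> on cluster graphs.\<close>

definition cliques :: "'a set set \<Rightarrow> 'a set set" where
  "cliques P = {e. card e = 2 \<and> (\<exists>B\<in>P. e \<subseteq> B)}"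

lemma equiv_graph_components: "equiv {1..n} (Restr ((adj_rel E)\<^sup>*) {1..n})"
proof (rule equivI)
  have "sym (adj_rel E)" by (auto simp: sym_def adj_rel_def insert_commute)
  then have "sym ((adj_rel E)\<^sup>*)" by (rule sym_rtrancl)
  then show "sym (Restr ((adj_rel E)\<^sup>*) {1..n})" by (auto simp: sym_def)
  show "trans (Restr ((adj_rel E)\<^sup>*) {1..n})"
    using trans_rtrancl[of "adj_rel E"] unfolding trans_def by blast
qed (auto simp: refl_on_def)

lemma partition_on_graph_components: "partition_on {1..n} (graph_components n E)"
  unfolding graph_components_def by (rule partition_on_quotient[OF equiv_graph_components])

lemma cliques_graph_components:
  assumes E: "cluster_graph n E"
  shows "cliques (graph_components n E) = E"
proof (intro equalityI subsetI)
  fix e assume "e \<in> cliques (graph_components n E)"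
  then obtain B where B: "card e = 2" "B \<in> graph_components n E" "e \<subseteq> B" by (auto simp: cliques_def)
  then obtain u v where "e = {u, v}" "u \<noteq> v" by (auto simp: card_2_iff)
  then show "e \<in> E" using B E by (auto simp: cluster_graph_def)
next
  fix e assume e: "e \<in> E"
  then have "e \<subseteq> {1..n}" "card e = 2" using E by (auto simp: cluster_graph_def complete_graph_edges_def)
  then obtain u v where uv: "e = {u, v}" "u \<noteq> v" "u \<in> {1..n}" "v \<in> {1..n}" by (auto simp: card_2_iff)
  then have "(u, v) \<in> Restr ((adj_rel E)\<^sup>*) {1..n}" using e by (auto simp: adj_rel_def)
  then have "e \<subseteq> Restr ((adj_rel E)\<^sup>*) {1..n} `` {u}" using uv by auto
  moreover have "Restr ((adj_rel E)\<^sup>*) {1..n} `` {u} \<in> graph_components n E"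
    using uv unfolding graph_components_def by (intro quotientI)
  ultimately show "e \<in> cliques (graph_components n E)"
    using \<open>card e = 2\<close> by (auto simp: cliques_def)
qed

text \<open>Lying in a common block is already transitive, so paths along cliques reach nothing
  beyond the block they start in.\<close>

lemma graph_components_cliques:
  assumes P: "partition_on {1..n} P"
  shows "graph_components n (cliques P) = P"
proof -
  let ?R = "{(x, y). \<exists>p\<in>P. x \<in> p \<and> y \<in> p}"
  have eq: "equiv {1..n} ?R" by (rule equiv_partition_on[OF P])
  have adj: "adj_rel (cliques P) \<subseteq> ?R" by (auto simp: adj_rel_def cliques_def)
  have "(x, y) \<in> ?R" if "(x, y) \<in> (adj_rel (cliques P))\<^sup>*" "x \<in> {1..n}" for x y
    using that(1)
  proof (induction rule: rtrancl_induct)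
    case base
    then show ?case using eq that(2) by (auto simp: equiv_def refl_on_def)
  next
    case (step y z)
    then show ?case using adj eq by (meson equivE subsetD transE)
  qed
  note fw = this
  have bw: "(x, y) \<in> Restr ((adj_rel (cliques P))\<^sup>*) {1..n}" if xy: "(x, y) \<in> ?R" for x y
  proof (cases "x = y")
    case False
    then have "(x, y) \<in> adj_rel (cliques P)" using xy by (auto simp: adj_rel_def cliques_def)
    then show ?thesis using xy P by (auto simp: partition_on_def)
  next
    case True
    then show ?thesis using xy P by (auto simp: partition_on_def)
  qed
  have "Restr ((adj_rel (cliques P))\<^sup>*) {1..n} = ?R"
  proof (intro equalityI subrelI)
    fix x y assume "(x, y) \<in> Restr ((adj_rel (cliques P))\<^sup>*) {1..n}"
    then show "(x, y) \<in> ?R" by (intro fw) simp_all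
  qed (rule bw)
  then show ?thesis unfolding graph_components_def using partition_on_eq_quotient[OF P] by simp
qed

lemma cluster_graph_cliques:
  assumes P: "partition_on {1..n} P"
  shows "cluster_graph n (cliques P)"
  unfolding cluster_graph_def graph_components_cliques[OF P]
proof (intro conjI ballI impI)
  have "\<Union>P = {1..n}" using P by (simp add: partition_on_def)
  then show "cliques P \<subseteq> complete_graph_edges n"
    unfolding complete_graph_edges_def cliques_def by blast
  show "{u, v} \<in> cliques P" if "B \<in> P" "u \<in> B" "v \<in> B" "u \<noteq> v" for B u v
    unfolding cliques_def using that by (intro CollectI conjI bexI[of _ B]) auto
qed

lemma card_cliques:
  assumes A: "finite A" and P: "partition_on A P"
  shows "card (cliques P) = (\<Sum>B\<in>P. card B choose 2)"
proof -
  have finB: "finite B" if "B \<in> P" for B using that P A by (auto simp: partition_on_def intro: finite_subset)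
  have "cliques P = (\<Union>B\<in>P. {e. e \<subseteq> B \<and> card e = 2})" by (auto simp: cliques_def)
  also have "card \<dots> = (\<Sum>B\<in>P. card {e. e \<subseteq> B \<and> card e = 2})"
  proof (rule card_UN_disjoint)
    show "finite P" using A P finite_elements by blast
    show "\<forall>B\<in>P. finite {e. e \<subseteq> B \<and> card e = 2}"
      using finB by auto
    show "\<forall>i\<in>P. \<forall>j\<in>P. i \<noteq> j \<longrightarrow> {e. e \<subseteq> i \<and> card e = 2} \<inter> {e. e \<subseteq> j \<and> card e = 2} = {}"
    proof (intro ballI impI)
      fix i j assume "i \<in> P" "j \<in> P" "i \<noteq> j"
      then have "i \<inter> j = {}" using P by (auto simp: partition_on_def disjoint_def)
      then have "card e \<noteq> 2" if "e \<subseteq> i" "e \<subseteq> j" for e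
        using that by (metis Int_subset_iff card.empty subset_empty zero_neq_numeral)
      then show "{e. e \<subseteq> i \<and> card e = 2} \<inter> {e. e \<subseteq> j \<and> card e = 2} = {}" by blast
    qed
  qed
  also have "\<dots> = (\<Sum>B\<in>P. card B choose 2)"
    using finB by (intro sum.cong refl) (simp add: n_subsets)
  finally show ?thesis .
qed

lemma prod_graph_components:
  assumes "cluster_graph n E"
  shows "(\<Prod>B\<in>graph_components n E. r ^ (card B choose 2)) = r ^ card E"
  using card_cliques[OF _ partition_on_graph_components[of n E]]
  by (simp add: cliques_graph_components[OF assms] power_sum[symmetric])

section \<open>The law of the random cluster graph\<close>

text \<open>One factor \<open>1 - p\<close> for every possible edge is common to all graphs and
  cancels on conditioning; an edge that is present contributes the odds
  \<open>p / (1 - p)\<close>.\<close>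

lemma pmf_erdos_renyi:
  assumes p: "0 < p" "p < 1" and E: "E \<subseteq> complete_graph_edges n"
  shows "pmf (erdos_renyi n p) E = (1 - p) ^ card (complete_graph_edges n) * (p / (1 - p)) ^ card E"
proof -
  let ?K = "complete_graph_edges n"
  let ?M = "Pi_pmf ?K False (\<lambda>_. bernoulli_pmf p)"
  let ?f = "\<lambda>x. {e \<in> ?K. x e}"
  have fin: "finite ?K" by (rule finite_complete_graph_edges)
  have supp: "set_pmf ?M \<subseteq> {x. \<forall>e. e \<notin> ?K \<longrightarrow> x e = False}" by (rule set_Pi_pmf_subset[OF fin])
  \<comment> \<open>Configurations in the support are \<open>False\<close> outside
    \<open>?K\<close>, so the edge set determines them.\<close>
  have inj: "inj_on ?f (set_pmf ?M)"
  proof (rule inj_onI, rule ext)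
    fix x y e assume "x \<in> set_pmf ?M" "y \<in> set_pmf ?M" "?f x = ?f y"
    then show "x e = y e" using supp by (cases "e \<in> ?K") auto
  qed
  let ?x = "\<lambda>e. e \<in> E"
  have x: "?x \<in> set_pmf ?M"
    using p E by (subst set_Pi_pmf) (auto simp: fin PiE_dflt_def set_pmf_bernoulli)
  have Ex: "?f ?x = E" using E by auto
  have "pmf (erdos_renyi n p) E = pmf ?M ?x"
    unfolding erdos_renyi_def using pmf_map_inj[OF inj x] Ex by simp
  also have "\<dots> = (\<Prod>e\<in>?K. pmf (bernoulli_pmf p) (e \<in> E))"
    using fin E by (subst pmf_Pi) auto
  also have "\<dots> = (\<Prod>e\<in>?K. (1 - p) * (if e \<in> E then p / (1 - p) else 1))"
    using p by (intro prod.cong) auto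
  also have "\<dots> = (1 - p) ^ card ?K * (\<Prod>e\<in>?K. if e \<in> E then p / (1 - p) else 1)"
    by (simp add: prod.distrib)
  also have "(\<Prod>e\<in>?K. if e \<in> E then p / (1 - p) else 1) = (\<Prod>e\<in>E. p / (1 - p))"
    using E fin by (subst prod.inter_restrict[symmetric]) (auto simp: Int_absorb1)
  finally show ?thesis by simp
qed

lemma prob_cluster_graph:
  assumes p: "0 < p" "p < 1"
  shows "measure_pmf.prob (erdos_renyi n p) {E. cluster_graph n E} =
    (1 - p) ^ card (complete_graph_edges n) * partition_sum (\<lambda>k. (p / (1 - p)) ^ (k choose 2)) {1..n}"
    and "cluster_graph n E \<Longrightarrow> pmf (random_cluster_graph n p) E =
      (p / (1 - p)) ^ card E / partition_sum (\<lambda>k. (p / (1 - p)) ^ (k choose 2)) {1..n}"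
proof -
  let ?K = "complete_graph_edges n"
  let ?r = "p / (1 - p)"
  let ?w = "\<lambda>k. ?r ^ (k choose 2)"
  have "{E. cluster_graph n E} \<subseteq> Pow ?K" by (auto simp: cluster_graph_def)
  then have fin: "finite {E. cluster_graph n E}"
    using finite_complete_graph_edges finite_subset by blast
  have "measure_pmf.prob (erdos_renyi n p) {E. cluster_graph n E} =
      (\<Sum>E | cluster_graph n E. pmf (erdos_renyi n p) E)"
    by (rule measure_measure_pmf_finite[OF fin])
  also have "\<dots> = (\<Sum>E | cluster_graph n E. (1 - p) ^ card ?K * ?r ^ card E)"
    using p by (intro sum.cong refl pmf_erdos_renyi) (auto simp: cluster_graph_def)
  also have "\<dots> = (\<Sum>P | partition_on {1..n} P. (1 - p) ^ card ?K * (\<Prod>B\<in>P. ?w (card B)))"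
    by (rule sum.reindex_bij_witness[where i = cliques and j = "graph_components n"])
      (auto simp: cliques_graph_components graph_components_cliques cluster_graph_cliques
        partition_on_graph_components prod_graph_components simp del: One_nat_def)
  finally show 1: "measure_pmf.prob (erdos_renyi n p) {E. cluster_graph n E} =
    (1 - p) ^ card ?K * partition_sum ?w {1..n}"
    by (simp add: partition_sum_def sum_distrib_left)
  show "pmf (random_cluster_graph n p) E = ?r ^ card E / partition_sum ?w {1..n}" if "cluster_graph n E"
    unfolding random_cluster_graph_def
    using p that by (subst pmf_cond[OF cluster_graph_possible[OF p]])
      (auto simp: 1 pmf_erdos_renyi cluster_graph_def)
qed

lemma set_random_cluster_graph:
  assumes "0 < p" "p < 1"
  shows "set_pmf (random_cluster_graph n p) \<subseteq> {E. cluster_graph n E}" 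
  unfolding random_cluster_graph_def by (subst set_cond_pmf[OF cluster_graph_possible[OF assms]]) auto

lemma finite_cluster_graphs: "finite {E. cluster_graph n E}"
  by (rule finite_subset[of _ "Pow (complete_graph_edges n)"])
    (auto simp: cluster_graph_def finite_complete_graph_edges)

lemma expectation_random_cluster_graph:
  fixes h :: "real \<Rightarrow> 'b::{banach, second_countable_topology}"
  assumes p: "0 < p" "p < 1"
  shows "measure_pmf.expectation (random_cluster_graph n p) (\<lambda>E. h (num_clusters n E)) =
    (\<Sum>P | partition_on {1..n} P. (\<Prod>B\<in>P. (p / (1 - p)) ^ (card B choose 2)) *\<^sub>R h (card P))
      /\<^sub>R partition_sum (\<lambda>k. (p / (1 - p)) ^ (k choose 2)) {1..n}"
proof -
  let ?r = "p / (1 - p)"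
  let ?Z = "partition_sum (\<lambda>k. ?r ^ (k choose 2)) {1..n}"
  have "measure_pmf.expectation (random_cluster_graph n p) (\<lambda>E. h (num_clusters n E)) =
      (\<Sum>E | cluster_graph n E. pmf (random_cluster_graph n p) E *\<^sub>R h (num_clusters n E))"
    using set_random_cluster_graph[OF p] finite_cluster_graphs
    by (intro integral_measure_pmf) auto
  also have "\<dots> = (\<Sum>E | cluster_graph n E. (?r ^ card E / ?Z) *\<^sub>R h (num_clusters n E))"
    by (intro sum.cong refl) (simp add: prob_cluster_graph(2)[OF p])
  also have "\<dots> = (\<Sum>P | partition_on {1..n} P. ((\<Prod>B\<in>P. ?r ^ (card B choose 2)) / ?Z) *\<^sub>R h (card P))"
    by (rule sum.reindex_bij_witness[where i = cliques and j = "graph_components n"])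
      (auto simp: cliques_graph_components graph_components_cliques cluster_graph_cliques
        num_clusters_def partition_on_graph_components prod_graph_components simp del: One_nat_def)
  finally show ?thesis by (simp add: scaleR_sum_right divide_inverse mult.commute)
qed

section \<open>Block weights and the saddle point integral\<close>

text \<open>Cauchy's formula on the unit circle. As \<open>circlepath\<close> runs over
  \<open>{0..2*pi}\<close>, the formula is applied to \<open>f (- z)\<close> and translated by
  \<open>pi\<close>; this yields an interval centred at angle 0, where the integrands to be
  estimated are concentrated.\<close>

lemma fourier_coefficient:
  fixes f :: "complex \<Rightarrow> complex"
  assumes f: "f holomorphic_on UNIV"
  shows "((\<lambda>t. f (cis t) * cis (- (real n * t))) has_integral (2 * pi / fact n * (deriv ^^ n) f 0)) {-pi..pi}"
proof -
  define g where "g = (\<lambda>z. f (-1 * z))"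
  have g: "g holomorphic_on UNIV"
    unfolding g_def
    by (rule holomorphic_on_compose_gen[OF _ f, of "\<lambda>z. -1 * z" UNIV, unfolded o_def])
      (auto intro!: holomorphic_intros)
  have gf: "(deriv ^^ n) g 0 = (-1)^n * (deriv ^^ n) f 0"
    unfolding g_def using higher_deriv_compose_linear[OF f, of UNIV 0 "-1" n] by simp
  have "((\<lambda>u. g u / (u - 0) ^ Suc n) has_contour_integral (2 * pi * \<i> / fact n * (deriv ^^ n) g 0)) (circlepath 0 1)"
    by (rule Cauchy_has_contour_integral_higher_derivative_circlepath)
      (use g in \<open>auto intro: holomorphic_on_imp_continuous_on holomorphic_on_subset\<close>)
  then have "((\<lambda>t. g (cis t) / cis t ^ Suc n * \<i> * cis t) has_integral (2 * pi * \<i> / fact n * (deriv ^^ n) g 0)) {0..2*pi}"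
    unfolding circlepath_def by (subst (asm) has_contour_integral_part_circlepath_iff) auto
  from has_integral_mult_right[OF this, of "-\<i>"]
  have "((\<lambda>t. -\<i> * (g (cis t) / cis t ^ Suc n * \<i> * cis t)) has_integral (2 * pi / fact n * (deriv ^^ n) g 0)) {0..2*pi}"
    by (simp add: mult.assoc) (simp add: mult_ac)
  then have "((\<lambda>t. g (cis t) * cis (- (real n * t))) has_integral (2 * pi / fact n * (deriv ^^ n) g 0)) {0..2*pi}"
    by (rule has_integral_eq[rotated])
      (simp add: field_simps cis_inverse[symmetric] Complex.DeMoivre del: cis_inverse)
  then have "((\<lambda>t. g (cis (t + pi)) * cis (- (real n * (t + pi)))) has_integral (2 * pi / fact n * (deriv ^^ n) g 0)) {0-pi..2*pi-pi}"
    by (subst (asm) has_integral_shift_real_ivl_iff[where c = pi])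
  moreover have "cis (- (real n * (t + pi))) = (-1)^n * cis (- (real n * t))" for t
  proof -
    have "cis (- (real n * (t + pi))) = cis (- (real n * t)) * cis (real n * (- pi))"
      by (simp add: cis_mult algebra_simps)
    also have "cis (real n * (- pi)) = (-1)^n"
      by (simp only: Complex.DeMoivre[symmetric]) (simp add: complex_eq_iff cis.code)
    finally show ?thesis by simp
  qed
  ultimately have "((\<lambda>t. (-1)^n * (f (cis t) * cis (- (real n * t)))) has_integral (2 * pi / fact n * (deriv ^^ n) g 0)) {-pi..pi}"
    by (simp add: g_def mult_ac cis_mult[symmetric])
  from has_integral_mult_right[OF this, of "(-1)^n"]
  show ?thesis by (cases "even n") (simp_all add: gf)
qed

definition block_weight :: "real \<Rightarrow> real \<Rightarrow> nat \<Rightarrow> real" where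
  "block_weight r x k = (if k = 0 then 0 else r ^ (k choose 2) * x ^ k / fact k)"

text \<open>For \<open>j = 0, 1, 2\<close> these are \<open>W(x)\<close>, \<open>x W'(x)\<close> and
  the result of applying \<open>x d/dx\<close> twice to \<open>W\<close>: in the Poisson model the
  mean number of blocks, the mean total size and the variance of the total size.\<close>

definition block_moment :: "real \<Rightarrow> nat \<Rightarrow> real \<Rightarrow> real" where
  "block_moment r j x = (\<Sum>k. real k ^ j * block_weight r x k)"

definition block_gf :: "real \<Rightarrow> complex fps" where
  "block_gf r = Abs_fps (\<lambda>k. of_real (block_weight r 1 k))"

text \<open>\<open>n!\<close> times the coefficient of \<open>z ^ n\<close> in
  \<open>exp (y W(z))\<close>, a polynomial in \<open>y\<close> (the Touchard polynomial when
  \<open>r = 1\<close>). As an iterated derivative at 0 it is open both to the product rule and to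
  Cauchy's formula.\<close>

definition cluster_poly :: "real \<Rightarrow> nat \<Rightarrow> complex \<Rightarrow> complex" where
  "cluster_poly r n y = (deriv ^^ n) (\<lambda>z. exp (y * eval_fps (block_gf r) z)) 0"

lemma block_weight_scale: "block_weight r (c * x) k = c ^ k * block_weight r x k"
  by (simp add: block_weight_def power_mult_distrib)

lemma block_weight_one: "block_weight r x k = block_weight r 1 k * x ^ k"
  using block_weight_scale[of r x 1 k] by simp

lemma exp_minus_of_real: "exp (- complex_of_real a) = of_real (exp (- a))"
  by (simp flip: exp_of_real)

text \<open>A single term of the exponential series; it trades powers for exponentials in several
  estimates below.\<close>

lemma power_le_fact_exp:
  assumes "0 \<le> (x::real)" shows "x ^ n \<le> fact n * exp x"
proof -
  have "(\<Sum>k\<in>{n}. x ^ k /\<^sub>R fact k) \<le> (\<Sum>k. x ^ k /\<^sub>R fact k)"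
    using assms by (intro sum_le_suminf summable_exp_generic) auto
  then show ?thesis by (simp add: exp_def field_simps)
qed

locale cluster_weights =
  fixes r :: real
  assumes r: "0 < r" "r \<le> 1"
begin

lemma block_weight_nonneg: "0 \<le> x \<Longrightarrow> 0 \<le> block_weight r x k"
  using r by (simp add: block_weight_def)

lemma block_weight_pos: "0 < x \<Longrightarrow> 0 < k \<Longrightarrow> 0 < block_weight r x k"
  using r by (simp add: block_weight_def)

lemma block_weight_le: "0 \<le> x \<Longrightarrow> block_weight r x k \<le> x ^ k / fact k"
proof -
  assume x: "0 \<le> x"
  have "r ^ (k choose 2) * (x ^ k / fact k) \<le> 1 * (x ^ k / fact k)"
    using r x by (intro mult_right_mono power_le_one) auto
  then show ?thesis using x by (simp add: block_weight_def)
qed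

lemma block_weight_mono: "0 \<le> x \<Longrightarrow> x \<le> y \<Longrightarrow> block_weight r x k \<le> block_weight r y k"
  using r by (auto simp: block_weight_def intro!: divide_right_mono mult_left_mono power_mono)

lemma summable_block_weight: "0 \<le> x \<Longrightarrow> summable (block_weight r x)"
proof -
  assume x: "0 \<le> x"
  have "summable (\<lambda>k. x ^ k / fact k)"
    using summable_exp[of x] by (simp add: field_simps)
  then show ?thesis
    by (rule summable_comparison_test'[where N = 0]) (use x block_weight_le block_weight_nonneg in auto)
qed

lemma summable_block_moment: "0 \<le> x \<Longrightarrow> summable (\<lambda>k. real k ^ j * block_weight r x k)"
proof -
  assume x: "0 \<le> x"
  have "summable (\<lambda>k. fact j * block_weight r (exp 1 * x) k)"
    using x by (intro summable_mult summable_block_weight) auto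
  then show ?thesis
  proof (rule summable_comparison_test'[where N = 0])
    fix k :: nat
    have "real k ^ j * block_weight r x k \<le> fact j * exp (real k) * block_weight r x k"
      using x by (intro mult_right_mono power_le_fact_exp block_weight_nonneg) auto
    then show "norm (real k ^ j * block_weight r x k) \<le> fact j * block_weight r (exp 1 * x) k"
      using x block_weight_nonneg[of x k]
      by (simp add: block_weight_scale exp_of_nat_mult[symmetric] mult.assoc)
  qed
qed

lemma fps_conv_radius_block_gf: "fps_conv_radius (block_gf r) = \<infinity>"
proof -
  have "summable (\<lambda>n. fps_nth (block_gf r) n * z ^ n)" for z
  proof (rule summable_norm_cancel)
    have "norm (fps_nth (block_gf r) n * z ^ n) = block_weight r (norm z) n" for n
      using block_weight_nonneg[of 1 n] block_weight_one[of r "norm z" n]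
      by (simp add: block_gf_def norm_mult norm_power)
    then show "summable (\<lambda>n. norm (fps_nth (block_gf r) n * z ^ n))"
      using summable_block_weight[of "norm z"] by simp
  qed
  then show ?thesis
    unfolding fps_conv_radius_def by (rule conv_radius_inftyI'')
qed

lemma holomorphic_block_gf: "eval_fps (block_gf r) holomorphic_on UNIV"
  by (rule holomorphic_on_eval_fps) (simp add: fps_conv_radius_block_gf)

lemma sums_block_gf: "(\<lambda>k. of_real (block_weight r 1 k) * z ^ k) sums eval_fps (block_gf r) z"
  using sums_eval_fps[of z "block_gf r"] by (simp add: fps_conv_radius_block_gf) (simp add: block_gf_def)

lemma higher_deriv_block_gf:
  "(deriv ^^ k) (eval_fps (block_gf r)) 0 = (if k = 0 then 0 else of_real (r ^ (k choose 2)))"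
proof -
  have "eval_fps (block_gf r) has_fps_expansion block_gf r"
    by (rule eval_fps_has_fps_expansion) (simp add: fps_conv_radius_block_gf)
  from fps_nth_fps_expansion[OF this, of k] show ?thesis
    by (simp add: block_gf_def block_weight_def field_simps split: if_splits)
qed

lemma cluster_poly_0: "cluster_poly r 0 y = 1"
  using higher_deriv_block_gf[of 0] by (simp add: cluster_poly_def)

text \<open>Leibniz's rule for \<open>f' = (y W') f\<close>, where \<open>f = exp (y W)\<close>; the
  \<open>k\<close>-th derivative of \<open>W'\<close> at 0 is \<open>r ^ (Suc k choose 2)\<close>.
  The outcome is the recursion required by \<open>partition_sum_card\<close>.\<close>

lemma cluster_poly_Suc:
  "cluster_poly r (Suc n) y =
    (\<Sum>k\<le>n. of_nat (n choose k) * (y * of_real (r ^ (Suc k choose 2)) * cluster_poly r (n - k) y))"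
proof -
  let ?W = "eval_fps (block_gf r)"
  let ?f = "\<lambda>z. exp (y * ?W z)"
  have f: "?f holomorphic_on UNIV" by (intro holomorphic_intros holomorphic_block_gf)
  have dW: "deriv ?W holomorphic_on UNIV" by (rule holomorphic_deriv[OF holomorphic_block_gf]) simp
  have d: "deriv ?f = (\<lambda>z. (y * deriv ?W z) * ?f z)"
  proof
    fix z
    have "(?W has_field_derivative deriv ?W z) (at z)"
      using holomorphic_block_gf by (auto intro: holomorphic_derivI[of _ UNIV])
    then have "((\<lambda>z. y * ?W z) has_field_derivative y * deriv ?W z) (at z)"
      by (rule DERIV_cmult)
    from DERIV_chain2[OF DERIV_exp this] show "deriv ?f z = (y * deriv ?W z) * ?f z"
      by (intro DERIV_imp_deriv) (simp add: mult.commute)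
  qed
  have "cluster_poly r (Suc n) y = (deriv ^^ n) (\<lambda>z. (y * deriv ?W z) * ?f z) 0"
    unfolding cluster_poly_def by (simp only: funpow_Suc_right o_def d)
  also have "\<dots> = (\<Sum>i=0..n. of_nat (n choose i) * (deriv ^^ i) (\<lambda>z. y * deriv ?W z) 0 * (deriv ^^ (n-i)) ?f 0)"
    by (rule higher_deriv_mult[of _ UNIV]) (intro holomorphic_intros dW f | simp)+
  also have "\<dots> = (\<Sum>k\<le>n. of_nat (n choose k) * (y * of_real (r ^ (Suc k choose 2)) * cluster_poly r (n - k) y))"
  proof (intro sum.cong)
    fix i
    have "(deriv ^^ i) (\<lambda>z. y * deriv ?W z) 0 = y * (deriv ^^ i) (deriv ?W) 0"
      by (rule higher_deriv_cmult[of _ UNIV]) (use dW in auto)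
    also have "(deriv ^^ i) (deriv ?W) 0 = of_real (r ^ (Suc i choose 2))"
      using higher_deriv_block_gf[of "Suc i"] by (simp only: funpow_Suc_right o_def) simp
    finally show "of_nat (n choose i) * (deriv ^^ i) (\<lambda>z. y * deriv ?W z) 0 * (deriv ^^ (n-i)) ?f 0 =
      of_nat (n choose i) * (y * of_real (r ^ (Suc i choose 2)) * cluster_poly r (n - i) y)"
      by (simp add: cluster_poly_def)
  qed auto
  finally show ?thesis .
qed

text \<open>The variance of the number of blocks when the sizes are conditioned to sum to their mean: the
  residual variance of a Poisson count after linear regression on the total size.\<close>

definition block_var :: "real \<Rightarrow> real" where
  "block_var x = block_moment r 0 x - (block_moment r 1 x)\<^sup>2 / block_moment r 2 x"

definition block_score :: "real \<Rightarrow> nat \<Rightarrow> real" where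
  "block_score x k = (1 - block_moment r 1 x / block_moment r 2 x * real k) / sqrt (block_var x)"

text \<open>The standardised residual carried by a block of size \<open>k\<close> is \<open>block_score x k\<close>; in the Poisson model it
  is uncorrelated with the total size, hence the absence of a mixed term in \<open>sums_saddle_arg_sq\<close> below.\<close>

definition saddle_arg :: "real \<Rightarrow> complex \<Rightarrow> real \<Rightarrow> nat \<Rightarrow> complex" where
  "saddle_arg x s \<theta> k = s * of_real (block_score x k) + \<i> * of_real (\<theta> * real k)"

text \<open>Logarithm of the transform of the centred Poisson counts: \<open>- 1\<close> is the
  Poisson normalisation and \<open>- saddle_arg\<close> the centring of each count at its mean
  \<open>block_weight r x k\<close>.\<close>

definition saddle_phase :: "real \<Rightarrow> complex \<Rightarrow> real \<Rightarrow> complex" where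
  "saddle_phase x s \<theta> =
    (\<Sum>k. of_real (block_weight r x k) * (exp (saddle_arg x s \<theta> k) - 1 - saddle_arg x s \<theta> k))"

lemma sums_block_moment: "0 \<le> x \<Longrightarrow> (\<lambda>k. real k ^ j * block_weight r x k) sums block_moment r j x"
  unfolding block_moment_def using summable_block_moment by (rule summable_sums)

lemma block_moment_pos: "0 < x \<Longrightarrow> 0 < block_moment r j x"
  unfolding block_moment_def
  by (rule suminf_pos2[of _ 1]) (auto intro!: summable_block_moment mult_nonneg_nonneg
     block_weight_nonneg mult_pos_pos block_weight_pos)

context
  fixes x :: real and s :: complex
  assumes x: "0 < x" and V: "0 < block_var x"
begin

text \<open>The part of \<open>saddle_arg\<close> free of \<open>k\<close> becomes the prefactor,
  which is the marking variable \<open>y\<close> of the blocks; the part linear in \<open>k\<close>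
  becomes a factor of the argument of \<open>W\<close>. This factor is the contour shift.\<close>

lemma sums_exp_saddle_arg:
  "(\<lambda>k. of_real (block_weight r x k) * exp (saddle_arg x s \<theta> k)) sums
    (exp (s / of_real (sqrt (block_var x))) * eval_fps (block_gf r)
      (of_real x * exp (- (s * of_real (block_moment r 1 x / block_moment r 2 x / sqrt (block_var x)))) * cis \<theta>))"
proof -
  let ?c = "of_real x * exp (- (s * of_real (block_moment r 1 x / block_moment r 2 x / sqrt (block_var x)))) * cis \<theta>"
  have "of_real (block_weight r x k) * exp (saddle_arg x s \<theta> k) =
      exp (s / of_real (sqrt (block_var x))) * (of_real (block_weight r 1 k) * ?c ^ k)" for k
  proof -
    let ?b = "block_moment r 1 x / block_moment r 2 x / sqrt (block_var x)"
    have "saddle_arg x s \<theta> k = s / of_real (sqrt (block_var x)) + of_nat k * (- (s * of_real ?b)) + of_nat k * (\<i> * of_real \<theta>)"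
      using V by (simp add: saddle_arg_def block_score_def field_simps)
    then have "exp (saddle_arg x s \<theta> k) =
      exp (s / of_real (sqrt (block_var x))) * exp (- (s * of_real ?b)) ^ k * cis \<theta> ^ k"
      by (simp only: exp_add exp_of_nat_mult cis_conv_exp)
    then show ?thesis
      by (subst block_weight_one) (simp add: power_mult_distrib mult_ac)
  qed
  then show ?thesis using sums_mult[OF sums_block_gf] by simp
qed

lemma sums_saddle_arg:
  "(\<lambda>k. of_real (block_weight r x k) * saddle_arg x s \<theta> k) sums
    (s * of_real (sqrt (block_var x)) + \<i> * of_real (\<theta> * block_moment r 1 x))"
proof -
  let ?b = "block_moment r 1 x / block_moment r 2 x"
  have "(\<lambda>k. (real k ^ 0 * block_weight r x k - ?b * (real k ^ 1 * block_weight r x k)) / sqrt (block_var x))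
      sums ((block_moment r 0 x - ?b * block_moment r 1 x) / sqrt (block_var x))"
    using x by (intro sums_divide sums_diff sums_mult sums_block_moment) auto
  also have "block_moment r 0 x - ?b * block_moment r 1 x = block_var x"
    by (simp add: block_var_def power2_eq_square)
  also have "block_var x / sqrt (block_var x) = sqrt (block_var x)"
    using V by (simp add: real_div_sqrt)
  finally have 1: "(\<lambda>k. block_weight r x k * block_score x k) sums sqrt (block_var x)"
    by (simp add: block_score_def algebra_simps)
  have 2: "(\<lambda>k. \<theta> * (real k ^ 1 * block_weight r x k)) sums (\<theta> * block_moment r 1 x)"
    using x by (intro sums_mult sums_block_moment) auto
  have "(\<lambda>k. s * of_real (block_weight r x k * block_score x k) + \<i> * of_real (\<theta> * (real k ^ 1 * block_weight r x k)))
      sums (s * of_real (sqrt (block_var x)) + \<i> * of_real (\<theta> * block_moment r 1 x))"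
    by (intro sums_add sums_mult) (use 1 2 in \<open>simp_all only: sums_of_real\<close>)
  then show ?thesis by (simp add: saddle_arg_def algebra_simps)
qed

text \<open>Put \<open>\<sigma> = sqrt (block_var x)\<close> and let \<open>b\<close> be the shift
  per unit of \<open>s\<close>. The definition of \<open>block_var\<close> then says
  \<open>W / \<sigma> = n b + \<sigma>\<close>, so the shift factor \<open>exp (- n s b)\<close> and
  the centring \<open>exp (- s \<sigma>)\<close> merge into \<open>exp (- s W / \<sigma>)\<close>.
  The remaining prefactor does not involve \<open>s\<close>.\<close>

lemma exp_saddle_phase_has_integral:
  assumes n: "block_moment r 1 x = real n"
  shows "((\<lambda>\<theta>. exp (saddle_phase x s \<theta>)) has_integral
    of_real (2 * pi / fact n * x ^ n * exp (- block_moment r 0 x)) *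
    (exp (- (s * of_real (block_moment r 0 x / sqrt (block_var x)))) *
     cluster_poly r n (exp (s / of_real (sqrt (block_var x)))))) {-pi..pi}"
proof -
  define y where "y = exp (s / of_real (sqrt (block_var x)))"
  define b where "b = block_moment r 1 x / block_moment r 2 x / sqrt (block_var x)"
  define c where "c = of_real x * exp (- (s * of_real b))"
  define A where "A = exp (- of_real (block_moment r 0 x) - s * of_real (sqrt (block_var x)))"
  let ?W = "eval_fps (block_gf r)"
  let ?f = "\<lambda>z. exp (y * ?W z)"
  have f: "?f holomorphic_on UNIV" by (intro holomorphic_intros holomorphic_block_gf)
  have g: "(\<lambda>z. ?f (c * z)) holomorphic_on UNIV"
    by (rule holomorphic_on_compose_gen[OF _ f, of "\<lambda>z. c * z" UNIV, unfolded o_def])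
      (auto intro!: holomorphic_intros)
  have dg: "(deriv ^^ n) (\<lambda>z. ?f (c * z)) 0 = c ^ n * cluster_poly r n y"
    using higher_deriv_compose_linear[OF f, of UNIV 0 c n] by (simp add: cluster_poly_def)
  have phase: "exp (saddle_phase x s \<theta>) = A * (?f (c * cis \<theta>) * cis (- (real n * \<theta>)))" for \<theta>
  proof -
    have W: "(\<lambda>k. of_real (block_weight r x k)) sums complex_of_real (block_moment r 0 x)"
      unfolding sums_of_real_iff using sums_block_moment[of x 0] x by simp
    have "(\<lambda>k. of_real (block_weight r x k) * (exp (saddle_arg x s \<theta> k) - 1 - saddle_arg x s \<theta> k))
       sums (y * ?W (c * cis \<theta>) - of_real (block_moment r 0 x)
        - (s * of_real (sqrt (block_var x)) + \<i> * of_real (\<theta> * block_moment r 1 x)))"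
      using sums_diff[OF sums_diff[OF sums_exp_saddle_arg W] sums_saddle_arg, of \<theta> \<theta>]
      by (simp add: algebra_simps y_def c_def b_def)
    then have "saddle_phase x s \<theta> = y * ?W (c * cis \<theta>) - of_real (block_moment r 0 x)
        - (s * of_real (sqrt (block_var x)) + \<i> * of_real (\<theta> * block_moment r 1 x))"
      unfolding saddle_phase_def by (simp add: sums_unique[symmetric])
    also have "\<dots> = (- of_real (block_moment r 0 x) - s * of_real (sqrt (block_var x)))
        + (y * ?W (c * cis \<theta>) + \<i> * of_real (- (real n * \<theta>)))"
      by (simp add: n algebra_simps del: One_nat_def)
    finally show ?thesis by (simp only: exp_add A_def cis_conv_exp mult.assoc)
  qed
  have "A * c ^ n = of_real (x ^ n * exp (- block_moment r 0 x)) * exp (- (s * of_real (block_moment r 0 x / sqrt (block_var x))))"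
  proof -
    have V': "block_var x / sqrt (block_var x) = sqrt (block_var x)"
      using V by (simp add: real_div_sqrt)
    have "block_moment r 0 x / sqrt (block_var x) = real n * b + sqrt (block_var x)"
    proof -
      have "real n * b + sqrt (block_var x) =
          (block_moment r 1 x)\<^sup>2 / block_moment r 2 x / sqrt (block_var x) + block_var x / sqrt (block_var x)"
        unfolding V' b_def n[symmetric] by (simp add: power2_eq_square)
      also have "\<dots> = block_moment r 0 x / sqrt (block_var x)"
        unfolding add_divide_distrib[symmetric] by (simp add: block_var_def)
      finally show ?thesis by simp
    qed
    then have e: "- of_real (block_moment r 0 x) - s * of_real (sqrt (block_var x)) + of_nat n * (- (s * of_real b))
      = of_real (- block_moment r 0 x) + - (s * complex_of_real (block_moment r 0 x / sqrt (block_var x)))"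
      by (simp add: algebra_simps)
    have "A * c ^ n = of_real (x ^ n) * exp (- of_real (block_moment r 0 x) - s * of_real (sqrt (block_var x)) + of_nat n * (- (s * of_real b)))"
      unfolding A_def c_def exp_add exp_of_nat_mult power_mult_distrib by simp
    then show ?thesis unfolding e exp_add by (simp add: exp_minus_of_real)
  qed
  note Ac = this
  have "A * (2 * pi / fact n * (c ^ n * cluster_poly r n y)) =
      2 * pi / fact n * (A * c ^ n) * cluster_poly r n y"
    by (simp add: mult_ac)
  also have "\<dots> = of_real (2 * pi / fact n * x ^ n * exp (- block_moment r 0 x)) *
    (exp (- (s * of_real (block_moment r 0 x / sqrt (block_var x)))) * cluster_poly r n y)"
    unfolding Ac by simp
  finally have eq: "A * (2 * pi / fact n * (deriv ^^ n) (\<lambda>z. ?f (c * z)) 0) = \<dots>"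
    unfolding dg .
  show ?thesis
    using has_integral_mult_right[OF fourier_coefficient[OF g, of n], of A]
    unfolding phase eq unfolding y_def .
qed

end

section \<open>Growth of the total mass and the tilted mass\<close>

lemma block_moment_0: "0 \<le> x \<Longrightarrow> block_weight r x sums block_moment r 0 x"
  using sums_block_moment[of x 0] by simp

text \<open>Expanding \<open>(x + h) ^ k\<close> and lowering \<open>k choose 2\<close> to
  \<open>i choose 2\<close> in the exponent of \<open>r \<le> 1\<close> bounds the series termwise
  by the Cauchy product of the series for \<open>x\<close> with that of \<open>exp h\<close>. The
  summand 1 supplies the missing term at \<open>k = 0\<close>.\<close>

lemma block_moment_0_growth:
  assumes x: "0 \<le> x" and h: "0 \<le> h"
  shows "1 + block_moment r 0 (x + h) \<le> exp h * (1 + block_moment r 0 x)"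
proof -
  define a where "a = (\<lambda>y k. r ^ (k choose 2) * y ^ k / fact k)"
  define b where "b = (\<lambda>k. h ^ k / fact k)"
  have a: "a y sums (1 + block_moment r 0 y)" if "0 \<le> y" for y
  proof -
    have "(\<lambda>k. (if k = 0 then 1 else 0) + block_weight r y k) sums (1 + block_moment r 0 y)"
      by (intro sums_add block_moment_0 that) (use sums_If_finite_set[of "{0}" "\<lambda>_. 1::real"] in \<open>simp add: eq_commute\<close>)
    also have "(\<lambda>k. (if k = 0 then 1 else 0) + block_weight r y k) = a y"
      by (auto simp: a_def block_weight_def numeral_2_eq_2)
    finally show ?thesis .
  qed
  have b: "b sums exp h"
    using exp_converges[of h] by (simp add: b_def field_simps)
  have pos: "0 \<le> a x k" "0 \<le> b k" for k using x h r by (auto simp: a_def b_def)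
  have prod: "(\<lambda>k. \<Sum>i\<le>k. a x i * b (k - i)) sums ((1 + block_moment r 0 x) * exp h)"
    using Cauchy_product_sums[of "a x" b] pos a[OF x] b by (auto simp: sums_iff)
  have "a (x + h) k \<le> (\<Sum>i\<le>k. a x i * b (k - i))" for k
  proof -
    have "a (x + h) k = (\<Sum>i\<le>k. r ^ (k choose 2) * ((x ^ i / fact i) * b (k - i)))"
      unfolding a_def b_def binomial_ring
      by (simp add: sum_distrib_left sum_divide_distrib binomial_fact)
    also have "\<dots> \<le> (\<Sum>i\<le>k. r ^ (i choose 2) * ((x ^ i / fact i) * b (k - i)))"
      using r x pos by (intro sum_mono mult_right_mono power_decreasing binomial_right_mono) auto
    finally show ?thesis by (simp add: a_def mult.assoc)
  qed
  then have "1 + block_moment r 0 (x + h) \<le> (1 + block_moment r 0 x) * exp h"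
    by (rule sums_le[OF _ a prod]) (use x h in auto)
  then show ?thesis by (simp add: mult.commute)
qed

text \<open>As \<open>(k / x) ^ j \<le> j! exp (k / x)\<close>, the exponentially tilted total mass bounds all moments at once, with
  room for a further factor \<open>exp (k / x)\<close>.\<close>

definition block_tilt :: "real \<Rightarrow> real" where
  "block_tilt x = block_moment r 0 (exp (2 / x) * x)"

lemma sums_block_tilt: "0 < x \<Longrightarrow> (\<lambda>k. exp (2 * real k / x) * block_weight r x k) sums block_tilt x"
proof -
  assume x: "0 < x"
  have "block_weight r (exp (2 / x) * x) = (\<lambda>k. exp (2 * real k / x) * block_weight r x k)"
    by (simp only: fun_eq_iff block_weight_scale exp_of_nat_mult[symmetric]) (simp add: mult.commute)
  then show ?thesis using block_moment_0[of "exp (2/x) * x"] x by (simp add: block_tilt_def)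
qed

text \<open>Multiplying the argument by \<open>exp (2 / x)\<close> moves it by at most 4, so the
  tilt costs only a constant factor.\<close>

lemma block_tilt_le:
  assumes x: "2 \<le> x"
  shows "block_tilt x \<le> exp 4 * (1 + block_moment r 0 x)"
proof -
  have "exp (2 / x) \<le> 1 + 2 / x + (2 / x)\<^sup>2"
    using x by (intro exp_bound) auto
  also have "(2 / x)\<^sup>2 \<le> 2 / x * 1"
    unfolding power2_eq_square using x by (intro mult_left_mono) auto
  finally have "exp (2 / x) * x \<le> (1 + 4 / x) * x"
    using x by (intro mult_right_mono) auto
  also have "\<dots> = x + 4" using x by (simp add: field_simps)
  finally have le: "exp (2 / x) * x \<le> x + 4" .
  have "block_tilt x \<le> block_moment r 0 (x + 4)"
    unfolding block_tilt_def using le x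
    by (intro sums_le[OF _ block_moment_0 block_moment_0] block_weight_mono) auto
  then show ?thesis using block_moment_0_growth[of x 4] x by simp
qed

lemma power_exp_weight_le:
  assumes x: "0 < x"
  shows "real k ^ j * exp (real k / x) * block_weight r x k \<le> fact j * x ^ j * (exp (2 * real k / x) * block_weight r x k)"
proof -
  have "(real k / x) ^ j \<le> fact j * exp (real k / x)" using x by (intro power_le_fact_exp) auto
  then have "real k ^ j \<le> fact j * x ^ j * exp (real k / x)"
    using x by (simp add: power_divide field_simps)
  then have "real k ^ j * (exp (real k / x) * block_weight r x k) \<le>
      fact j * x ^ j * exp (real k / x) * (exp (real k / x) * block_weight r x k)"
    using x by (intro mult_right_mono mult_nonneg_nonneg block_weight_nonneg) auto
  also have "\<dots> = fact j * x ^ j * (exp (real k / x + real k / x) * block_weight r x k)"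
    by (simp only: exp_add mult_ac)
  finally show ?thesis by (simp add: mult.assoc)
qed

lemma block_moment_le_tilt:
  assumes x: "0 < x"
  shows "block_moment r j x \<le> fact j * x ^ j * block_tilt x"
proof (rule sums_le[OF _ sums_block_moment sums_mult[OF sums_block_tilt]])
  fix k
  have "real k ^ j * block_weight r x k \<le> real k ^ j * exp (real k / x) * block_weight r x k"
    using x by (intro mult_right_mono block_weight_nonneg) (auto simp: mult_le_cancel_left1)
  also note power_exp_weight_le[OF x]
  finally show "real k ^ j * block_weight r x k \<le> fact j * x ^ j * (exp (2 * real k / x) * block_weight r x k)" .
qed (use x in auto)

lemma block_weight_le_moment_0: "0 \<le> x \<Longrightarrow> block_weight r x k \<le> block_moment r 0 x"
  using sum_le_suminf[of "block_weight r x" "{k}"] block_moment_0[of x] block_weight_nonneg[of x]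
  by (auto simp: sums_iff)

text \<open>The term \<open>k = N + 1\<close> alone is a positive constant times
  \<open>x ^ (N + 1)\<close>.\<close>

lemma eventually_power_le_block_moment_0: "\<forall>\<^sub>F x in at_top. x ^ N \<le> block_moment r 0 x"
proof -
  define c where "c = r ^ (Suc N choose 2) / fact (Suc N)"
  have c: "0 < c" using r by (simp add: c_def)
  have "\<forall>\<^sub>F x in at_top. max 1 (1 / c) \<le> (x::real)" by (rule eventually_ge_at_top)
  then show ?thesis
  proof eventually_elim
    case (elim x)
    then have "x ^ N * 1 \<le> x ^ N * (c * x)"
      using c by (intro mult_left_mono) (auto simp: field_simps)
    also have "\<dots> = block_weight r x (Suc N)" by (simp add: c_def block_weight_def)
    also have "\<dots> \<le> block_moment r 0 x" using elim by (intro block_weight_le_moment_0) auto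
    finally show ?case by simp
  qed
qed

section \<open>The mode of the block weights\<close>

text \<open>\<open>r ^ k * x / (k + 1)\<close> is the ratio of the weights at \<open>k + 1\<close>
  and \<open>k\<close>, which decreases in \<open>k\<close>; the mode is the first size at which the
  weights stop increasing. Size 0 is excluded because its weight is set to 0 and the ratio formula
  fails there.\<close>

definition block_mode :: "real \<Rightarrow> nat" where
  "block_mode x = (LEAST k. 1 \<le> k \<and> r ^ k * x \<le> real k + 1)"

lemma block_weight_Suc:
  "1 \<le> k \<Longrightarrow> block_weight r x (Suc k) = block_weight r x k * (r ^ k * x / (real k + 1))"
  by (simp add: block_weight_def power_add numeral_2_eq_2 field_simps)

context
  fixes x :: real
  assumes x: "2 < r * x"
begin

lemma mode_x_pos: "2 < x"
proof -
  have "0 < x" using x r by (metis less_trans not_less_iff_gr_or_eq zero_less_mult_pos zero_less_numeral)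
  then show ?thesis using x r mult_right_mono[of r 1 x] by linarith
qed

text \<open>At size 1 the ratio of consecutive weights is \<open>r * x / 2 > 1\<close>, which puts
  the mode at 2 or later; since the ratio at \<open>j\<close> is at most \<open>x / (j + 1)\<close>,
  the mode does not exceed \<open>x\<close>.\<close>

lemma block_mode:
  shows "2 \<le> block_mode x" "real (block_mode x) \<le> x"
    "r ^ block_mode x * x \<le> real (block_mode x) + 1"
    "1 \<le> j \<Longrightarrow> j < block_mode x \<Longrightarrow> real j + 1 < r ^ j * x"
proof -
  let ?P = "\<lambda>k. 1 \<le> k \<and> r ^ k * x \<le> real k + 1"
  obtain n :: nat where n: "x \<le> real n" using real_arch_simple by blast
  have "r ^ n * x \<le> 1 * x" using r mode_x_pos by (intro mult_right_mono power_le_one) auto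
  then have "r ^ n * x \<le> real n + 1" using n by linarith
  then have "?P n" using n mode_x_pos by auto
  then have P: "?P (block_mode x)" unfolding block_mode_def by (rule LeastI)
  then show "r ^ block_mode x * x \<le> real (block_mode x) + 1" by simp
  show less: "real j + 1 < r ^ j * x" if "1 \<le> j" "j < block_mode x" for j
    using not_less_Least[of j ?P] that unfolding block_mode_def by auto
  have "block_mode x \<noteq> 1" using P x by auto
  then show 2: "2 \<le> block_mode x" using P by linarith
  define j where "j = block_mode x - 1"
  have j: "1 \<le> j" "block_mode x = Suc j" using 2 by (auto simp: j_def)
  have "real j + 1 < r ^ j * x" using less[of j] j by simp
  also have "\<dots> \<le> 1 * x" using r mode_x_pos by (intro mult_right_mono power_le_one) auto
  finally show "real (block_mode x) \<le> x" using j by simp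
qed

text \<open>The ratio at \<open>block_mode x + j\<close> is at most \<open>r ^ j\<close>, since it
  picks up \<open>r ^ j\<close> against the ratio at the mode, which is at most 1. The exponents
  \<open>0 + 1 + ... + (j - 1)\<close> add up to \<open>j choose 2\<close>.\<close>

lemma block_weight_mode_add:
  "block_weight r x (block_mode x + j) \<le> r ^ (j choose 2) * block_weight r x (block_mode x)"
proof (induction j)
  case (Suc j)
  let ?k = "block_mode x"
  have "r ^ (?k + j) * x / (real (?k + j) + 1) \<le> r ^ j * 1"
  proof -
    have "r ^ (?k + j) * x = r ^ j * (r ^ ?k * x)" by (simp add: power_add)
    also have "\<dots> \<le> r ^ j * (real (?k + j) + 1)"
      using r block_mode(3) by (intro mult_left_mono) auto
    finally show ?thesis by (simp add: divide_le_eq)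
  qed
  then have "block_weight r x (?k + Suc j) \<le> (r ^ (j choose 2) * block_weight r x ?k) * (r ^ j * 1)"
    using block_mode(1) Suc.IH r mode_x_pos block_weight_nonneg[of x]
    by (subst add_Suc_right, subst block_weight_Suc, simp, intro mult_mono mult_nonneg_nonneg) auto
  then show ?case by (simp add: power_add numeral_2_eq_2 mult_ac)
qed (simp add: numeral_2_eq_2)

text \<open>Mirror image of the decay above the mode: the ratio at the predecessor of the mode
  exceeds 1, and going \<open>j\<close> further down multiplies it by at least
  \<open>r ^ (- j)\<close>.\<close>

lemma block_weight_mode_diff:
  "j < block_mode x \<Longrightarrow> block_weight r x (block_mode x - j) \<le> r ^ (j choose 2) * block_weight r x (block_mode x)"
proof (induction j)
  case (Suc j)
  let ?k = "block_mode x"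
  define i where "i = ?k - Suc j"
  have i: "1 \<le> i" "?k - j = Suc i" "?k = Suc (i + j)" using Suc.prems by (auto simp: i_def)
  have "real i + 1 \<le> r ^ j * (r ^ i * x)"
  proof -
    have "real (i + j) + 1 < r ^ (i + j) * x" using i by (intro block_mode(4)) auto
    then show ?thesis by (simp add: power_add mult_ac)
  qed
  have "block_weight r x i * (real i + 1) \<le> block_weight r x i * (r ^ j * (r ^ i * x))"
    using \<open>real i + 1 \<le> _\<close> mode_x_pos by (intro mult_left_mono block_weight_nonneg) auto
  also have "\<dots> = r ^ j * block_weight r x (Suc i) * (real i + 1)"
    using i by (simp add: block_weight_Suc)
  finally have "block_weight r x i \<le> r ^ j * block_weight r x (?k - j)"
    unfolding i(2) by (rule mult_right_le_imp_le) simp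
  also have "\<dots> \<le> r ^ j * (r ^ (j choose 2) * block_weight r x ?k)"
    using Suc r by (intro mult_left_mono) auto
  finally show ?case by (simp add: i_def power_add numeral_2_eq_2 mult_ac)
qed (simp add: numeral_2_eq_2)

lemma block_weight_le_mode: "block_weight r x j \<le> block_weight r x (block_mode x)"
proof (cases "j = 0")
  case True
  then show ?thesis using block_weight_nonneg[of x "block_mode x"] mode_x_pos by (simp add: block_weight_def)
next
  case False
  have *: "r ^ m * block_weight r x (block_mode x) \<le> block_weight r x (block_mode x)" for m
    using mult_right_mono[of "r ^ m" 1 "block_weight r x (block_mode x)"] r mode_x_pos
      block_weight_nonneg[of x "block_mode x"] by (simp add: power_le_one)
  show ?thesis
  proof (cases "j \<le> block_mode x")
    case True
    then show ?thesis using False block_weight_mode_diff[of "block_mode x - j"] * order_trans by fastforce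
  next
    case False
    then show ?thesis using block_weight_mode_add[of "j - block_mode x"] * order_trans by fastforce
  qed
qed

text \<open>The ratio just before the mode exceeds 1, and one step lowers it by the factor
  \<open>r * (i + 1) / (i + 2)\<close>, at least \<open>r / 2\<close>. This provides the second of
  two adjacent heavy sizes.\<close>

lemma block_weight_Suc_mode:
  "r / 2 * block_weight r x (block_mode x) \<le> block_weight r x (Suc (block_mode x))"
proof -
  let ?k = "block_mode x"
  obtain i where i: "?k = Suc i" "1 \<le> i" using block_mode(1) by (cases "block_mode x") auto
  have "real i + 1 < r ^ i * x" using i by (intro block_mode(4)) auto
  then have "r * (real i + 1) \<le> r ^ ?k * x" using r by (simp add: i mult.assoc)
  moreover have "r / 2 * (real ?k + 1) \<le> r * (real i + 1)" using r by (simp add: i field_simps)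
  ultimately have "r / 2 \<le> r ^ ?k * x / (real ?k + 1)" by (simp add: le_divide_eq)
  then have "block_weight r x ?k * (r / 2) \<le> block_weight r x ?k * (r ^ ?k * x / (real ?k + 1))"
    using mode_x_pos by (intro mult_left_mono block_weight_nonneg) auto
  then show ?thesis using i by (simp add: block_weight_Suc mult.commute)
qed

text \<open>Sizes up to \<open>3 x\<close> have at most the modal weight each. Beyond, the tilt
  \<open>exp (2 k / x)\<close> is at least \<open>exp 6\<close>, while the tilted mass is at most
  \<open>2 exp 4\<close> times \<open>W\<close>; so these sizes carry at most
  \<open>2 exp (-2) W\<close>, less than half.\<close>

lemma block_moment_0_le_mode:
  assumes W: "1 \<le> block_moment r 0 x"
  shows "block_moment r 0 x \<le> 8 * x * block_weight r x (block_mode x)"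
proof -
  let ?p = "block_weight r x" and ?k = "block_mode x"
  define K where "K = nat \<lceil>3 * x\<rceil>"
  have K: "3 * x \<le> real K" "real K \<le> 3 * x + 1" using mode_x_pos unfolding K_def by linarith+
  have "block_moment r 0 x \<le> (\<Sum>j\<le>K. ?p ?k) + exp (-6) * block_tilt x"
  proof (rule sums_le[OF _ block_moment_0 sums_add[OF _ sums_mult[OF sums_block_tilt]]])
    show "(\<lambda>j. if j \<in> {..K} then ?p ?k else 0) sums (\<Sum>j\<le>K. ?p ?k)"
      by (rule sums_If_finite_set) simp
    show "?p j \<le> (if j \<in> {..K} then ?p ?k else 0) + exp (-6) * (exp (2 * real j / x) * ?p j)" for j
    proof (cases "j \<le> K")
      case True
      then show ?thesis using block_weight_le_mode[of j] block_weight_nonneg[of x] mode_x_pos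
        by (simp add: add_increasing2)
    next
      case False
      then have "3 * x \<le> real j" using K by simp
      then have "1 \<le> exp (-6) * exp (2 * real j / x)"
        using mode_x_pos by (simp add: exp_add[symmetric] field_simps)
      then have "1 * ?p j \<le> exp (-6) * exp (2 * real j / x) * ?p j"
        using mode_x_pos by (intro mult_right_mono block_weight_nonneg) auto
      then show ?thesis using False by (simp add: mult.assoc)
    qed
  qed (use mode_x_pos in auto)
  also have "exp (-6) * block_tilt x \<le> exp (-6) * (exp 4 * (2 * block_moment r 0 x))"
    using block_tilt_le[of x] mode_x_pos W by (intro mult_left_mono) (auto intro: order_trans)
  also have "\<dots> = 2 * exp (-2) * block_moment r 0 x"
    by (simp add: mult.assoc[symmetric] exp_add[symmetric])
  also have "\<dots> \<le> 1/2 * block_moment r 0 x"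
  proof -
    have "(2::real) \<le> exp 1" using exp_ge_add_one_self[of 1] by simp
    then have "2\<^sup>2 \<le> (exp 1 :: real)\<^sup>2" by (intro power_mono) auto
    then have "(4::real) \<le> exp 2" by (simp add: power2_eq_square exp_add[symmetric])
    then show ?thesis using W by (intro mult_right_mono) (auto simp: exp_minus field_simps)
  qed
  finally have "block_moment r 0 x \<le> 2 * (real K + 1) * ?p ?k" by (simp add: algebra_simps)
  also have "\<dots> \<le> 8 * x * ?p ?k"
    using K mode_x_pos by (intro mult_right_mono block_weight_nonneg) auto
  finally show ?thesis .
qed

end

lemma block_moment_var:
  assumes x: "0 < x"
  shows "(\<lambda>j. (real j - c)\<^sup>2 * block_weight r x j) sums
    (block_moment r 2 x - 2 * c * block_moment r 1 x + c\<^sup>2 * block_moment r 0 x)"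
proof -
  have "(\<lambda>j. real j ^ 2 * block_weight r x j - 2 * c * (real j ^ 1 * block_weight r x j) + c\<^sup>2 * (real j ^ 0 * block_weight r x j))
    sums (block_moment r 2 x - 2 * c * block_moment r 1 x + c\<^sup>2 * block_moment r 0 x)"
    using x by (intro sums_add sums_diff sums_mult sums_block_moment) auto
  then show ?thesis by (simp add: power2_eq_square algebra_simps)
qed


section \<open>Estimates at the saddle point\<close>

text \<open>The constants and the exponent 40 are chosen generously, not optimally.\<close>

definition saddle_large :: "real \<Rightarrow> bool" where
  "saddle_large x \<longleftrightarrow> 5000 \<le> x \<and> 16 / r \<le> x \<and> x ^ 40 \<le> block_moment r 0 x"

lemma eventually_saddle_large: "eventually saddle_large at_top"
  unfolding saddle_large_def
  by (intro eventually_conj eventually_ge_at_top eventually_power_le_block_moment_0)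

context
  fixes x :: real
  assumes large: "saddle_large x"
begin

lemma large_x: "5000 \<le> x" and large_r: "2 < r * x"
  and large_W: "x ^ 40 \<le> block_moment r 0 x" "1 \<le> block_moment r 0 x"
proof -
  show 1: "5000 \<le> x" and 2: "x ^ 40 \<le> block_moment r 0 x" using large by (auto simp: saddle_large_def)
  have "16 \<le> r * x" using large r by (simp add: saddle_large_def field_simps)
  then show "2 < r * x" by simp
  have "1 \<le> x ^ 40" using 1 by (intro one_le_power) auto
  with 2 show "1 \<le> block_moment r 0 x" by simp
qed

lemma large_tilt: "block_tilt x \<le> 162 * block_moment r 0 x"
proof -
  have "exp (1::real) ^ 4 \<le> 3 ^ 4" by (intro power_mono exp_le) auto
  then have "exp (4::real) \<le> 81" by (simp add: exp_of_nat_mult[symmetric])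
  have "block_tilt x \<le> exp 4 * (1 + block_moment r 0 x)" using large_x by (intro block_tilt_le) auto
  also have "\<dots> \<le> 81 * (2 * block_moment r 0 x)"
    using \<open>exp 4 \<le> 81\<close> large_W by (intro mult_mono) auto
  finally show ?thesis by simp
qed

lemma large_moment_2: "block_moment r 2 x \<le> 324 * x\<^sup>2 * block_moment r 0 x"
proof -
  have "block_moment r 2 x \<le> fact 2 * x\<^sup>2 * block_tilt x" using large_x by (intro block_moment_le_tilt) auto
  also have "\<dots> \<le> fact 2 * x\<^sup>2 * (162 * block_moment r 0 x)" by (intro mult_left_mono large_tilt) auto
  finally show ?thesis by (simp add: fact_numeral)
qed

lemma moment_0_le_moment_1: "block_moment r 0 x \<le> block_moment r 1 x"
  and moment_1_le_moment_2: "block_moment r 1 x \<le> block_moment r 2 x"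
proof -
  have x: "0 \<le> x" using large_x by auto
  have *: "real k \<le> real k ^ 2" for k by (cases k) (auto simp: power2_eq_square)
  show "block_moment r 1 x \<le> block_moment r 2 x"
    using * by (intro sums_le[OF _ sums_block_moment sums_block_moment] mult_right_mono block_weight_nonneg)
      (use x in auto)
  have "real k ^ 0 * block_weight r x k \<le> real k ^ 1 * block_weight r x k" for k
  proof (cases "k = 0")
    case False
    then show ?thesis using block_weight_nonneg[OF x, of k] mult_right_mono[of 1 "real k" "block_weight r x k"] by simp
  qed (simp add: block_weight_def)
  then show "block_moment r 0 x \<le> block_moment r 1 x"
    by (intro sums_le[OF _ sums_block_moment sums_block_moment]) (use x in auto)
qed

text \<open>A second factor \<open>x\<close> absorbs the constant 8 and, for the successor of the
  mode, also \<open>2 / r\<close>.\<close>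

lemma large_mode:
  "block_moment r 0 x / x\<^sup>2 \<le> block_weight r x (block_mode x)"
  "block_moment r 0 x / x\<^sup>2 \<le> block_weight r x (Suc (block_mode x))"
proof -
  let ?p = "block_weight r x (block_mode x)"
  have W: "block_moment r 0 x \<le> 8 * x * ?p" by (rule block_moment_0_le_mode[OF large_r large_W(2)])
  have p: "0 \<le> ?p" using large_x by (intro block_weight_nonneg) auto
  have "8 * x * ?p \<le> x\<^sup>2 * ?p"
    using large_x p unfolding power2_eq_square by (intro mult_right_mono) auto
  with W show "block_moment r 0 x / x\<^sup>2 \<le> ?p"
    using large_x by (simp add: divide_le_eq mult.commute)
  have "16 \<le> r * x" using large r by (simp add: saddle_large_def field_simps)
  then have "8 * x * ?p \<le> (r * x) / 2 * x * ?p"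
    using large_x p by (intro mult_right_mono) auto
  also have "\<dots> = x\<^sup>2 * (r / 2 * ?p)" by (simp add: power2_eq_square)
  also have "\<dots> \<le> x\<^sup>2 * block_weight r x (Suc (block_mode x))"
    by (intro mult_left_mono block_weight_Suc_mode large_r) auto
  finally show "block_moment r 0 x / x\<^sup>2 \<le> block_weight r x (Suc (block_mode x))"
    using large_x W by (simp add: divide_le_eq mult.commute)
qed

text \<open>The bracket is \<open>W\<close> times the variance of a block size drawn with
  probability proportional to \<open>block_weight r x\<close>. A lower bound for that variance thus
  bounds \<open>block_var\<close> from below.\<close>

lemma block_var_eq:
  "block_var x = (block_moment r 0 x * (block_moment r 2 x - (block_moment r 1 x)\<^sup>2 / block_moment r 0 x))
    / block_moment r 2 x"
  using block_moment_pos[of x 0] block_moment_pos[of x 2] large_x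
  by (simp add: block_var_def field_simps)

text \<open>Two adjacent integers cannot both be close to the mean \<open>m\<close>: their squared
  distances to it add up to at least 1/2. The bound \<open>c\<close> is instantiated by
  \<open>W / x^2\<close> and, when \<open>r < 1\<close>, by a constant multiple of
  \<open>W\<close>.\<close>

lemma variance_ge:
  assumes c: "c \<le> block_weight r x (block_mode x)" "c \<le> block_weight r x (Suc (block_mode x))" "0 \<le> c"
  shows "c / 2 \<le> block_moment r 2 x - (block_moment r 1 x)\<^sup>2 / block_moment r 0 x"
proof -
  let ?k = "block_mode x" and ?p = "block_weight r x"
  define m where "m = block_moment r 1 x / block_moment r 0 x"
  have x: "0 < x" and W: "0 < block_moment r 0 x" using large_x large_W by auto
  have "c / 2 \<le> c * ((real ?k - m)\<^sup>2 + (real (Suc ?k) - m)\<^sup>2)"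
  proof -
    have "0 \<le> (2 * (real ?k - m) + 1)\<^sup>2" by simp
    then have "1 / 2 \<le> (real ?k - m)\<^sup>2 + (real (Suc ?k) - m)\<^sup>2"
      by (simp add: power2_eq_square algebra_simps)
    from mult_left_mono[OF this c(3)] show ?thesis by simp
  qed
  also have "\<dots> \<le> (real ?k - m)\<^sup>2 * ?p ?k + (real (Suc ?k) - m)\<^sup>2 * ?p (Suc ?k)"
  proof -
    have "c * q \<le> q * b" if "0 \<le> q" "c \<le> b" for q b
      using mult_left_mono[OF that(2,1)] by (simp add: mult.commute)
    then show ?thesis unfolding distrib_left using c by (intro add_mono) auto
  qed
  also have "\<dots> = (\<Sum>j\<in>{?k, Suc ?k}. (real j - m)\<^sup>2 * ?p j)" by simp
  also have "\<dots> \<le> (\<Sum>j. (real j - m)\<^sup>2 * ?p j)"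
    using x by (intro sum_le_suminf sums_summable[OF block_moment_var[OF x]])
      (auto intro!: mult_nonneg_nonneg block_weight_nonneg)
  also have "\<dots> = block_moment r 2 x - 2 * m * block_moment r 1 x + m\<^sup>2 * block_moment r 0 x"
    using block_moment_var[OF x] by (rule sums_unique[symmetric])
  also have "\<dots> = block_moment r 2 x - (block_moment r 1 x)\<^sup>2 / block_moment r 0 x"
    using W by (simp add: m_def power2_eq_square)
  finally show ?thesis .
qed

text \<open>Relative to \<open>W\<close>, the size variance is at least \<open>1 / (2 x^2)\<close>
  and the second moment at most \<open>324 x^2\<close>; the fifth power of \<open>x\<close> absorbs
  the constant 648.\<close>

lemma large_block_var: "block_moment r 0 x / x ^ 5 \<le> block_var x"
proof -
  let ?W = "block_moment r 0 x" and ?B = "block_moment r 2 x"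
  have x: "0 < x" and W: "0 < ?W" and B: "0 < ?B"
    using large_x large_W block_moment_pos[of x 2] by auto
  have "?W / x ^ 5 * ?B \<le> ?W / x ^ 5 * (324 * x\<^sup>2 * ?W)"
    using x W by (intro mult_left_mono large_moment_2) auto
  also have "\<dots> = 648 * (?W * (?W / x\<^sup>2 / 2)) / x"
    using x by (simp add: field_simps power2_eq_square eval_nat_numeral)
  also have "\<dots> \<le> ?W * (?W / x\<^sup>2 / 2)"
  proof -
    have "648 * (?W * (?W / x\<^sup>2 / 2)) \<le> x * (?W * (?W / x\<^sup>2 / 2))"
      using large_x W by (intro mult_right_mono) auto
    then show ?thesis using x by (simp add: divide_le_eq mult.commute)
  qed
  also have "\<dots> \<le> ?W * (?B - (block_moment r 1 x)\<^sup>2 / ?W)"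
    using W by (intro mult_left_mono variance_ge large_mode) auto
  finally show ?thesis using B by (simp add: block_var_eq pos_le_divide_eq)
qed

lemma large_sigma: "x ^ 17 \<le> sqrt (block_var x)" and large_V_pos: "0 < block_var x"
proof -
  have x: "5000 \<le> x" by (rule large_x)
  have "x ^ 34 \<le> x ^ 35" using x by (intro power_increasing) auto
  also have "\<dots> = x ^ 40 / x ^ 5" using x by (simp add: power_diff[symmetric])
  also have "\<dots> \<le> block_moment r 0 x / x ^ 5"
    using x large_W by (intro divide_right_mono) auto
  also note large_block_var
  finally have *: "(x ^ 17)\<^sup>2 \<le> block_var x" by (simp add: power_mult[symmetric])
  then show "x ^ 17 \<le> sqrt (block_var x)" by (rule real_le_rsqrt)
  show "0 < block_var x" using * x by (smt (verit) zero_less_power)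
qed

text \<open>The regression coefficient lies between 0 and 1 because
  \<open>block_moment r 1 x \<le> block_moment r 2 x\<close>.\<close>

lemma abs_block_score_le: "1 \<le> k \<Longrightarrow> \<bar>block_score x k\<bar> \<le> real k / sqrt (block_var x)"
proof -
  assume k: "1 \<le> k"
  define b where "b = block_moment r 1 x / block_moment r 2 x"
  have x: "0 < x" using large_x by auto
  have b: "0 \<le> b" "b \<le> 1"
    using block_moment_pos[OF x, of 1] block_moment_pos[OF x, of 2] moment_1_le_moment_2
    by (auto simp: b_def)
  have "0 \<le> b * real k" "b * real k \<le> 1 * real k" using b by (auto intro!: mult_nonneg_nonneg mult_left_le_one_le)
  moreover have "1 \<le> real k" using k by simp
  ultimately have "\<bar>1 - b * real k\<bar> \<le> real k" unfolding abs_le_iff by linarith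
  then show ?thesis
    unfolding block_score_def b_def[symmetric] abs_divide using large_V_pos by (simp add: divide_right_mono)
qed

lemma sums_saddle_arg_sq:
  "(\<lambda>k. of_real (block_weight r x k) * (saddle_arg x s \<theta> k)\<^sup>2) sums (s\<^sup>2 - of_real (\<theta>\<^sup>2 * block_moment r 2 x))"
proof -
  let ?p = "block_weight r x"
  define b where "b = block_moment r 1 x / block_moment r 2 x"
  define V where "V = block_var x"
  have x: "0 \<le> x" and x': "0 < x" using large_x by auto
  have V: "0 < V" using large_V_pos by (simp add: V_def)
  have B: "0 < block_moment r 2 x" by (rule block_moment_pos[OF x'])
  have a: "block_score x k = (1 - b * real k) / sqrt V" for k by (simp add: block_score_def b_def V_def)
  note m = sums_block_moment[OF x]
  have "(\<lambda>k. (real k ^ 0 * ?p k - 2 * b * (real k ^ 1 * ?p k) + b\<^sup>2 * (real k ^ 2 * ?p k)) / V) sums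
      ((block_moment r 0 x - 2 * b * block_moment r 1 x + b\<^sup>2 * block_moment r 2 x) / V)"
    by (intro sums_divide sums_add sums_diff sums_mult m)
  also have "(block_moment r 0 x - 2 * b * block_moment r 1 x + b\<^sup>2 * block_moment r 2 x) = V"
    using B by (simp add: b_def V_def block_var_def power2_eq_square)
  finally have 1: "(\<lambda>k. ?p k * (block_score x k)\<^sup>2) sums 1"
    using V by (simp add: a power_divide power2_eq_square algebra_simps)
  have "(\<lambda>k. (real k ^ 1 * ?p k - b * (real k ^ 2 * ?p k)) / sqrt V) sums
      ((block_moment r 1 x - b * block_moment r 2 x) / sqrt V)"
    by (intro sums_divide sums_diff sums_mult m)
  then have 2: "(\<lambda>k. ?p k * (block_score x k * real k)) sums 0"
    using B by (simp add: a b_def power2_eq_square algebra_simps)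
  have 3: "(\<lambda>k. \<theta>\<^sup>2 * (real k ^ 2 * ?p k)) sums (\<theta>\<^sup>2 * block_moment r 2 x)"
    by (intro sums_mult m)
  have "(\<lambda>k. s\<^sup>2 * of_real (?p k * (block_score x k)\<^sup>2) + 2 * s * \<i> * of_real \<theta> * of_real (?p k * (block_score x k * real k))
      - of_real (\<theta>\<^sup>2 * (real k ^ 2 * ?p k))) sums (s\<^sup>2 * of_real 1 + 2 * s * \<i> * of_real \<theta> * of_real 0 - of_real (\<theta>\<^sup>2 * block_moment r 2 x))"
    by (intro sums_add sums_diff sums_mult) (use 1 2 3 in \<open>simp_all only: sums_of_real_iff\<close>)
  moreover have "s\<^sup>2 * of_real (?p k * (block_score x k)\<^sup>2) + 2 * s * \<i> * of_real \<theta> * of_real (?p k * (block_score x k * real k))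
      - of_real (\<theta>\<^sup>2 * (real k ^ 2 * ?p k)) = of_real (?p k) * (saddle_arg x s \<theta> k)\<^sup>2" for k
  proof -
    have eq: "(s * of_real (block_score x k) + \<i> * of_real (\<theta> * real k))\<^sup>2 =
      s\<^sup>2 * of_real ((block_score x k)\<^sup>2) + 2 * s * \<i> * of_real \<theta> * of_real (block_score x k * real k) - of_real (\<theta>\<^sup>2 * real k ^ 2)"
      by (simp add: power2_sum power_mult_distrib algebra_simps)
    show ?thesis unfolding saddle_arg_def eq by (simp add: algebra_simps)
  qed
  ultimately show ?thesis by simp
qed

lemma sums_saddle_phase:
  "(\<lambda>k. of_real (block_weight r x k) * (exp (saddle_arg x s \<theta> k) - 1 - saddle_arg x s \<theta> k)) sums saddle_phase x s \<theta>"
proof -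
  have x: "0 < x" using large_x by auto
  have W: "(\<lambda>k. of_real (block_weight r x k)) sums complex_of_real (block_moment r 0 x)"
    unfolding sums_of_real_iff using block_moment_0[of x] x by simp
  have "summable (\<lambda>k. of_real (block_weight r x k) * (exp (saddle_arg x s \<theta> k) - 1 - saddle_arg x s \<theta> k))"
    using sums_diff[OF sums_diff[OF sums_exp_saddle_arg[OF x large_V_pos] W] sums_saddle_arg[OF x large_V_pos], of s \<theta> s \<theta>]
    by (simp add: algebra_simps sums_iff)
  then show ?thesis unfolding saddle_phase_def by (rule summable_sums)
qed

text \<open>Third order Taylor expansion under the sum. Apart from the cube of the argument, the
  remainder of \<open>exp\<close> depends on its real part alone, and the bound on \<open>s\<close>
  keeps this below \<open>k / x\<close>, which is the room left in \<open>block_tilt\<close>; hence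
  no restriction on \<open>\<theta>\<close>.\<close>

lemma saddle_phase_taylor:
  assumes s: "norm s \<le> sqrt (block_var x) / x"
  shows "norm (saddle_phase x s \<theta> - (s\<^sup>2 - of_real (\<theta>\<^sup>2 * block_moment r 2 x)) / 2) \<le>
    x ^ 4 * block_moment r 0 x * ((norm s / sqrt (block_var x)) ^ 3 + \<bar>\<theta>\<bar> ^ 3)"
proof -
  let ?p = "block_weight r x" and ?z = "saddle_arg x s \<theta>"
  define \<sigma> where "\<sigma> = sqrt (block_var x)"
  define c where "c = norm s / \<sigma> + \<bar>\<theta>\<bar>"
  have x: "0 < x" using large_x by auto
  have \<sigma>: "0 < \<sigma>" using large_V_pos by (simp add: \<sigma>_def)
  have c: "0 \<le> c" using \<sigma> by (simp add: c_def)
  let ?f = "\<lambda>k. of_real (?p k) * (exp (?z k) - 1 - ?z k - (?z k)\<^sup>2 / 2)"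
  have f: "?f sums (saddle_phase x s \<theta> - (s\<^sup>2 - of_real (\<theta>\<^sup>2 * block_moment r 2 x)) / 2)"
    using sums_diff[OF sums_saddle_phase sums_divide[OF sums_saddle_arg_sq, of _ _ 2], of s \<theta> s \<theta>]
    by (simp add: algebra_simps)
  let ?g = "\<lambda>k. c ^ 3 / 2 * (6 * x ^ 3 * (exp (2 * real k / x) * ?p k))"
  have g: "?g sums (c ^ 3 / 2 * (6 * x ^ 3 * block_tilt x))"
    by (intro sums_mult sums_block_tilt x)
  have le: "norm (?f k) \<le> ?g k" for k
  proof (cases "k = 0")
    case True
    then show ?thesis using c x by (simp add: block_weight_def)
  next
    case False
    then have a: "\<bar>block_score x k\<bar> \<le> real k / \<sigma>" using abs_block_score_le[of k] by (simp add: \<sigma>_def)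
    have "norm s * \<bar>block_score x k\<bar> \<le> norm s * (real k / \<sigma>)" by (intro mult_left_mono a) auto
    then have sa: "norm (s * of_real (block_score x k)) \<le> norm s / \<sigma> * real k" by (simp add: norm_mult)
    have nz: "norm (?z k) \<le> c * real k"
    proof -
      have "norm (?z k) \<le> norm (s * of_real (block_score x k)) + norm (\<i> * complex_of_real (\<theta> * real k))"
        unfolding saddle_arg_def by (rule norm_triangle_ineq)
      also have "norm (\<i> * complex_of_real (\<theta> * real k)) = \<bar>\<theta>\<bar> * real k"
        by (simp add: norm_mult abs_mult)
      finally show ?thesis using sa by (simp add: c_def distrib_right)
    qed
    have "\<bar>Re (?z k)\<bar> = \<bar>Re (s * of_real (block_score x k))\<bar>" by (simp add: saddle_arg_def)
    also have "\<dots> \<le> norm s / \<sigma> * real k" using abs_Re_le_cmod sa by (rule order_trans)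
    also have "\<dots> \<le> (1 / x) * real k"
      using s \<sigma> x by (intro mult_right_mono) (auto simp: \<sigma>_def[symmetric] field_simps)
    finally have re: "\<bar>Re (?z k)\<bar> \<le> real k / x" by simp
    have "norm (exp (?z k) - 1 - ?z k - (?z k)\<^sup>2 / 2) = norm (exp (?z k) - (\<Sum>i\<le>2. ?z k ^ i / fact i))"
      by (simp add: eval_nat_numeral algebra_simps)
    also have "\<dots> \<le> exp \<bar>Re (?z k)\<bar> * norm (?z k) ^ Suc 2 / fact 2" by (rule Taylor_exp)
    also have "\<dots> \<le> exp (real k / x) * (c * real k) ^ Suc 2 / fact 2"
      using re nz by (intro divide_right_mono mult_mono power_mono) auto
    also have "\<dots> = c ^ 3 / 2 * (real k ^ 3 * exp (real k / x))"
      by (simp add: power_mult_distrib eval_nat_numeral)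
    finally have "?p k * norm (exp (?z k) - 1 - ?z k - (?z k)\<^sup>2 / 2) \<le> ?p k * (c ^ 3 / 2 * (real k ^ 3 * exp (real k / x)))"
      using x by (intro mult_left_mono block_weight_nonneg) auto
    then have "norm (?f k) \<le> ?p k * (c ^ 3 / 2 * (real k ^ 3 * exp (real k / x)))"
      using block_weight_nonneg[of x k] x by (simp only: norm_mult norm_of_real abs_of_nonneg)
    also have "\<dots> = c ^ 3 / 2 * (real k ^ 3 * exp (real k / x) * ?p k)" by (simp add: mult_ac)
    also have "\<dots> \<le> c ^ 3 / 2 * (fact 3 * x ^ 3 * (exp (2 * real k / x) * ?p k))"
      using c by (intro mult_left_mono power_exp_weight_le x) auto
    finally show ?thesis by (simp add: fact_numeral)
  qed
  have "norm (saddle_phase x s \<theta> - (s\<^sup>2 - of_real (\<theta>\<^sup>2 * block_moment r 2 x)) / 2) \<le> c ^ 3 / 2 * (6 * x ^ 3 * block_tilt x)"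
    using norm_suminf_le[of ?f ?g, OF le] f g by (simp add: sums_iff)
  also have "\<dots> \<le> c ^ 3 / 2 * (6 * x ^ 3 * (162 * block_moment r 0 x))"
    using c x by (intro mult_left_mono large_tilt) auto
  also have "\<dots> = 486 * x ^ 3 * block_moment r 0 x * c ^ 3" by simp
  also have "\<dots> \<le> 486 * x ^ 3 * block_moment r 0 x * (4 * ((norm s / \<sigma>) ^ 3 + \<bar>\<theta>\<bar> ^ 3))"
  proof -
    have "(u + v) ^ 3 \<le> 4 * (u ^ 3 + v ^ 3)" if "0 \<le> u" "0 \<le> v" for u v :: real
    proof -
      have "4 * (u ^ 3 + v ^ 3) - (u + v) ^ 3 = 3 * ((u + v) * (u - v)\<^sup>2)"
        by (simp add: eval_nat_numeral algebra_simps)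
      also have "\<dots> \<ge> 0" using that by (intro mult_nonneg_nonneg) auto
      finally show ?thesis by simp
    qed
    then show ?thesis unfolding c_def using \<sigma> x large_W by (intro mult_left_mono mult_nonneg_nonneg) auto
  qed
  also have "\<dots> = 1944 * x ^ 3 * (block_moment r 0 x * ((norm s / \<sigma>) ^ 3 + \<bar>\<theta>\<bar> ^ 3))" by simp
  also have "\<dots> \<le> x * x ^ 3 * (block_moment r 0 x * ((norm s / \<sigma>) ^ 3 + \<bar>\<theta>\<bar> ^ 3))"
    using large_x large_W \<sigma> by (intro mult_right_mono mult_nonneg_nonneg add_nonneg_nonneg) auto
  also have "\<dots> = x ^ 4 * block_moment r 0 x * ((norm s / \<sigma>) ^ 3 + \<bar>\<theta>\<bar> ^ 3)"
    by (simp add: eval_nat_numeral)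
  finally show ?thesis by (simp add: \<sigma>_def)
qed

end
end

section \<open>Trigonometric inequalities for the phases\<close>

lemma sin_ge_half: "0 \<le> y \<Longrightarrow> y \<le> 1 \<Longrightarrow> y / 2 \<le> sin (y::real)"
proof -
  assume y: "0 \<le> y" "y \<le> 1"
  show ?thesis
  proof (cases "y = 0")
    case False
    have "\<exists>z. 0 < z \<and> z < y \<and> sin y - sin 0 = (y - 0) * cos z"
      using False y by (intro MVT2) (auto intro!: derivative_eq_intros)
    then obtain z where z: "0 < z" "z < y" "sin y = y * cos z" by auto
    have "cos (pi / 3) \<le> cos z"
      using z y pi_gt3 by (intro cos_monotone_0_pi_le) auto
    then have "y * (1 / 2) \<le> y * cos z" using y by (intro mult_left_mono) (auto simp: cos_60)
    then show ?thesis using z by simp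
  qed simp
qed

lemma one_minus_cos_ge:
  assumes "0 \<le> \<delta>" "\<delta> \<le> 1" "\<delta> \<le> \<bar>\<theta>\<bar>" "\<bar>\<theta>\<bar> \<le> pi"
  shows "\<delta>\<^sup>2 / 8 \<le> 1 - cos (\<theta>::real)"
proof -
  have "(\<delta> / 2 / 2)\<^sup>2 \<le> (sin (\<delta> / 2))\<^sup>2"
    using assms by (intro power_mono sin_ge_half) auto
  then have "\<delta>\<^sup>2 / 8 \<le> 1 - cos \<delta>"
    using cos_double_sin[of "\<delta> / 2"] by (simp add: power_divide)
  moreover have "cos \<bar>\<theta>\<bar> \<le> cos \<delta>" using assms by (intro cos_monotone_0_pi_le) auto
  ultimately show ?thesis by simp
qed

lemma one_minus_cos_le: "1 - cos (\<epsilon>::real) \<le> \<epsilon>\<^sup>2 / 2"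
proof -
  have "(sin (\<epsilon> / 2))\<^sup>2 \<le> (\<epsilon> / 2)\<^sup>2" using abs_sin_x_le_abs_x[of "\<epsilon> / 2"] unfolding abs_le_square_iff .
  then show ?thesis using cos_double_sin[of "\<epsilon> / 2"] by (simp add: power_divide)
qed

text \<open>As \<open>1 - cos c = 2 (sin (c / 2))^2\<close> measures the squared distance of
  \<open>c\<close> from the multiples of \<open>2 pi\<close>, this is a triangle inequality,
  squared.\<close>

lemma one_minus_cos_add: "1 - cos (a + b) \<le> 2 * ((1 - cos a) + (1 - cos (b::real)))"
proof -
  define s where "s = \<bar>sin (a/2)\<bar>"
  define t where "t = \<bar>sin (b/2)\<bar>"
  have "\<bar>sin (a/2 + b/2)\<bar> \<le> s * \<bar>cos (b/2)\<bar> + \<bar>cos (a/2)\<bar> * t"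
    unfolding s_def t_def sin_add abs_mult[symmetric] by (rule abs_triangle_ineq)
  also have "\<dots> \<le> s * 1 + 1 * t"
    by (intro add_mono mult_mono abs_cos_le_one) (auto simp: s_def t_def)
  finally have "\<bar>sin (a/2 + b/2)\<bar>\<^sup>2 \<le> (s + t)\<^sup>2" by (intro power_mono) auto
  also have "\<dots> \<le> 2 * (s\<^sup>2 + t\<^sup>2)"
    using sum_squares_bound[of s t] by (simp add: power2_sum)
  finally have "(sin (a/2 + b/2))\<^sup>2 \<le> 2 * ((sin (a/2))\<^sup>2 + (sin (b/2))\<^sup>2)" by (simp add: s_def t_def)
  moreover have "1 - cos c = 2 * (sin (c / 2))\<^sup>2" for c :: real
    using cos_double_sin[of "c / 2"] by simp
  ultimately show ?thesis by (simp add: add_divide_distrib)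
qed

section \<open>Bounds on the integrand near angle 0 and away from it\<close>

context cluster_weights
begin

context
  fixes x :: real and s :: complex
  assumes large: "saddle_large x" and s: "norm s \<le> x"
begin

lemmas large_facts = large_x[OF large] large_W[OF large] large_sigma[OF large] large_V_pos[OF large]

lemma s_le_sigma: "norm s \<le> sqrt (block_var x) / x" "norm s / sqrt (block_var x) \<le> 1 / x ^ 16"
proof -
  have x: "5000 \<le> x" by (rule large_x[OF large])
  have "norm s * x ^ 16 \<le> x * x ^ 16" using s x by (intro mult_right_mono) auto
  also have "\<dots> = x ^ 17" by (simp flip: power_Suc)
  also have "\<dots> \<le> sqrt (block_var x)" by (rule large_facts)
  finally have *: "norm s * x ^ 16 \<le> sqrt (block_var x)" .
  then show "norm s / sqrt (block_var x) \<le> 1 / x ^ 16"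
    using large_facts x by (simp add: field_simps)
  have "norm s * x ^ 1 \<le> norm s * x ^ 16" using x by (intro mult_left_mono power_increasing) auto
  with * show "norm s \<le> sqrt (block_var x) / x" using x by (simp add: field_simps)
qed

lemma moment_0_le_moment_2: "block_moment r 0 x \<le> block_moment r 2 x"
  using moment_0_le_moment_1[OF large] moment_1_le_moment_2[OF large] by simp

text \<open>The cube of \<open>sqrt (block_var x)\<close> is at least \<open>W / x^5\<close> times
  \<open>x^17\<close>, by the lower bounds for the residual variance and its root.\<close>

lemma saddle_s_error:
  "x ^ 4 * block_moment r 0 x * (norm s / sqrt (block_var x)) ^ 3 \<le> norm s ^ 3 / x ^ 8"
proof -
  let ?W = "block_moment r 0 x" and ?\<sigma> = "sqrt (block_var x)"
  have x: "5000 \<le> x" and W: "0 < ?W" using large_facts by auto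
  have "?W * x ^ 12 = ?W / x ^ 5 * x ^ 17" using x by (simp add: field_simps flip: power_add)
  also have "\<dots> \<le> block_var x * ?\<sigma>"
    using large_block_var[OF large] large_facts x by (intro mult_mono) auto
  also have "\<dots> = ?\<sigma> ^ 3" using large_facts by (simp add: power3_eq_cube)
  finally have le: "?W * x ^ 12 \<le> ?\<sigma> ^ 3" .
  have "x ^ 4 * ?W * (norm s / ?\<sigma>) ^ 3 = x ^ 4 * ?W * norm s ^ 3 / ?\<sigma> ^ 3" by (simp add: power_divide)
  also have "\<dots> \<le> x ^ 4 * ?W * norm s ^ 3 / (?W * x ^ 12)"
    using le W x large_facts by (intro divide_left_mono) auto
  also have "\<dots> = norm s ^ 3 / x ^ 8" using W x by (simp add: power_diff field_simps flip: power_add)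
  finally show ?thesis .
qed

lemma saddle_phase_pointwise:
  "norm (saddle_phase x s (t / sqrt (block_moment r 2 x)) - (s\<^sup>2 - of_real (t\<^sup>2)) / 2) \<le> (norm s ^ 3 + \<bar>t\<bar> ^ 3) / x ^ 8"
proof -
  let ?W = "block_moment r 0 x" and ?B = "block_moment r 2 x"
  let ?\<theta> = "t / sqrt ?B"
  have x: "5000 \<le> x" and W: "0 < ?W" using large_facts by auto
  have B: "?W \<le> ?B" by (rule moment_0_le_moment_2)
  have "?\<theta>\<^sup>2 * ?B = t\<^sup>2" using B W by (simp add: power_divide)
  then have "norm (saddle_phase x s ?\<theta> - (s\<^sup>2 - of_real (t\<^sup>2)) / 2) \<le>
    x ^ 4 * ?W * ((norm s / sqrt (block_var x)) ^ 3 + \<bar>?\<theta>\<bar> ^ 3)"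
    using saddle_phase_taylor[OF large s_le_sigma(1), of ?\<theta>] by simp
  also have "\<dots> = x ^ 4 * ?W * (norm s / sqrt (block_var x)) ^ 3 + x ^ 4 * ?W * \<bar>?\<theta>\<bar> ^ 3" by (simp add: distrib_left)
  also have "x ^ 4 * ?W * \<bar>?\<theta>\<bar> ^ 3 \<le> \<bar>t\<bar> ^ 3 / x ^ 8"
  proof -
    have "(x ^ 20)\<^sup>2 \<le> ?B" using large_facts B by (simp flip: power_mult)
    then have "x ^ 20 \<le> sqrt ?B" by (rule real_le_rsqrt)
    moreover have "x ^ 12 \<le> x ^ 20" using x by (intro power_increasing) auto
    ultimately have "x ^ 12 \<le> sqrt ?B" by (rule order_trans[rotated])
    then have "?W * x ^ 12 \<le> ?B * sqrt ?B" using B W x by (intro mult_mono) auto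
    also have "\<dots> = sqrt ?B ^ 3" using B W by (simp add: power3_eq_cube)
    finally have le: "?W * x ^ 12 \<le> sqrt ?B ^ 3" .
    have "x ^ 4 * ?W * \<bar>?\<theta>\<bar> ^ 3 = x ^ 4 * ?W * \<bar>t\<bar> ^ 3 / sqrt ?B ^ 3"
      using B W by (simp add: power_divide abs_divide)
    also have "\<dots> \<le> x ^ 4 * ?W * \<bar>t\<bar> ^ 3 / (?W * x ^ 12)"
      using le W x B by (intro divide_left_mono) auto
    also have "\<dots> = \<bar>t\<bar> ^ 3 / x ^ 8" using W x by (simp add: power_diff field_simps flip: power_add)
    finally show ?thesis .
  qed
  also note saddle_s_error
  finally show ?thesis by (simp add: add_divide_distrib)
qed

lemma Re_sq_le: "Re ((s\<^sup>2 - of_real b) / 2) \<le> norm s ^ 2 / 2 - b / 2"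
  using complex_Re_le_cmod[of "s\<^sup>2"] by (simp add: norm_power)

lemma s_cube_le: "norm s ^ 3 / x ^ 8 \<le> norm s ^ 3"
proof -
  have "1 \<le> x ^ 8" using large_facts by (intro one_le_power) auto
  then have "norm s ^ 3 / x ^ 8 \<le> norm s ^ 3 / 1" by (intro divide_left_mono) auto
  then show ?thesis by simp
qed

text \<open>The radius \<open>1 / x^5\<close> makes the cubic error
  \<open>x^4 W |\<theta>|^3\<close> at most \<open>\<theta>^2 W / x\<close>, so that half of the
  quadratic decay survives.\<close>

lemma Re_saddle_phase_near:
  assumes \<theta>: "\<bar>\<theta>\<bar> \<le> 1 / x ^ 5"
  shows "Re (saddle_phase x s \<theta>) \<le> norm s ^ 2 / 2 + norm s ^ 3 - \<theta>\<^sup>2 * block_moment r 2 x / 4"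
proof -
  let ?W = "block_moment r 0 x" and ?B = "block_moment r 2 x"
  have x: "5000 \<le> x" and W: "0 < ?W" using large_facts by auto
  have "Re (saddle_phase x s \<theta>) - Re ((s\<^sup>2 - of_real (\<theta>\<^sup>2 * ?B)) / 2) \<le>
      norm (saddle_phase x s \<theta> - (s\<^sup>2 - of_real (\<theta>\<^sup>2 * ?B)) / 2)"
    using complex_Re_le_cmod by (metis minus_complex.sel(1))
  also have "\<dots> \<le> x ^ 4 * ?W * ((norm s / sqrt (block_var x)) ^ 3 + \<bar>\<theta>\<bar> ^ 3)"
    by (rule saddle_phase_taylor[OF large s_le_sigma(1)])
  also have "\<dots> = x ^ 4 * ?W * (norm s / sqrt (block_var x)) ^ 3 + x ^ 4 * ?W * \<bar>\<theta>\<bar> ^ 3" by (simp add: distrib_left)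
  also have "x ^ 4 * ?W * \<bar>\<theta>\<bar> ^ 3 \<le> \<theta>\<^sup>2 * ?B / 4"
  proof -
    have "x ^ 4 * ?W * \<bar>\<theta>\<bar> ^ 3 = (x ^ 4 * \<bar>\<theta>\<bar>) * (?W * \<theta>\<^sup>2)"
      by (simp add: power3_eq_cube power2_eq_square)
    also have "\<dots> \<le> (x ^ 4 * (1 / x ^ 5)) * (?B * \<theta>\<^sup>2)"
      using \<theta> x W moment_0_le_moment_2 by (intro mult_mono) auto
    also have "x ^ 4 * (1 / x ^ 5) = 1 / x" using x by (simp add: field_simps eval_nat_numeral)
    also have "1 / x * (?B * \<theta>\<^sup>2) \<le> 1 / 4 * (?B * \<theta>\<^sup>2)"
      using x W moment_0_le_moment_2 by (intro mult_right_mono) (auto simp: field_simps)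
    finally show ?thesis by (simp add: mult.commute)
  qed
  also have "x ^ 4 * ?W * (norm s / sqrt (block_var x)) ^ 3 \<le> norm s ^ 3"
    using saddle_s_error s_cube_le by simp
  finally show ?thesis using Re_sq_le[of "\<theta>\<^sup>2 * ?B"] by linarith
qed

text \<open>Comparison with angle 0 and the real part of \<open>s\<close> cancels the terms free of
  phases and leaves a series of nonnegative terms, from which any finite set of sizes can be singled
  out.\<close>

lemma sums_Re_saddle_phase:
  "(\<lambda>k. block_weight r x k * (exp (Re s * block_score x k) * (1 - cos (Im s * block_score x k + \<theta> * real k)))) sums
    (Re (saddle_phase x (of_real (Re s)) 0) - Re (saddle_phase x s \<theta>))"
  using sums_diff[OF sums_Re[OF sums_saddle_phase[OF large, of "of_real (Re s)" 0]]
      sums_Re[OF sums_saddle_phase[OF large, of s \<theta>]]]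
  by (simp add: saddle_arg_def Re_exp algebra_simps)


text \<open>Away from \<open>\<theta> = 0\<close> the phases of two consecutive block sizes cannot both be close to multiples of \<open>2 \<pi>\<close>;
  applied to the mode and its successor this makes the integrand negligible.\<close>

lemma outer_cos_ge:
  assumes \<theta>: "1 / x ^ 5 \<le> \<bar>\<theta>\<bar>" "\<bar>\<theta>\<bar> \<le> pi"
  shows "1 / x ^ 10 / 64 \<le> (1 - cos (Im s * block_score x k + \<theta> * real k)) +
    (1 - cos (Im s * block_score x (Suc k) + \<theta> * real (Suc k)))"
proof -
  define \<alpha> where "\<alpha> = Im s * block_score x k + \<theta> * real k"
  define \<gamma> where "\<gamma> = Im s * block_score x (Suc k) + \<theta> * real (Suc k)"
  define b where "b = block_moment r 1 x / block_moment r 2 x"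
  define \<epsilon> where "\<epsilon> = Im s * (b / sqrt (block_var x))"
  define q where "q = 1 / x ^ 10"
  have x: "5000 \<le> x" and x0: "0 < x" using large_facts by auto
  have b: "0 \<le> b" "b \<le> 1"
    using block_moment_pos[OF x0, of 1] block_moment_pos[OF x0, of 2] moment_1_le_moment_2[OF large]
    by (auto simp: b_def)
  have "block_score x (Suc k) - block_score x k = - (b / sqrt (block_var x))"
    unfolding block_score_def b_def[symmetric] diff_divide_distrib[symmetric] by (simp add: algebra_simps)
  moreover have "\<gamma> - \<alpha> = \<theta> + Im s * (block_score x (Suc k) - block_score x k)"
    by (simp add: \<alpha>_def \<gamma>_def algebra_simps)
  \<comment> \<open>The phases of consecutive sizes differ by \<open>\<theta>\<close> except for the
    regression term \<open>\<epsilon>\<close>, which is at most \<open>1 / x ^ 16\<close> and thus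
    much smaller than \<open>1 / x ^ 5\<close>.\<close>
  ultimately have \<theta>_eq: "\<theta> = (\<gamma> - \<alpha>) + \<epsilon>" by (simp add: \<epsilon>_def)
  have "\<bar>\<epsilon>\<bar> = \<bar>Im s\<bar> * (b / sqrt (block_var x))"
    using b large_facts by (simp add: \<epsilon>_def abs_mult)
  also have "\<dots> \<le> norm s * (1 / sqrt (block_var x))"
    using b large_facts by (intro mult_mono abs_Im_le_cmod divide_right_mono) auto
  also have "\<dots> \<le> 1 / x ^ 16" using s_le_sigma(2) by simp
  also have "\<dots> \<le> 1 / (4 * x ^ 5)"
  proof -
    have "4 * x ^ 5 \<le> x * x ^ 5" using x by (intro mult_right_mono) auto
    also have "\<dots> \<le> x ^ 16" using x power_increasing[of 6 16 x] by (simp flip: power_Suc)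
    finally show ?thesis using x by (intro divide_left_mono) auto
  qed
  finally have "\<bar>\<epsilon>\<bar> ^ 2 \<le> (1 / (4 * x ^ 5)) ^ 2" by (intro power_mono) auto
  also have "\<dots> = 1 / x ^ 10 / 16" by (simp add: power_divide power_mult_distrib flip: power_mult)
  finally have \<epsilon>: "1 - cos \<epsilon> \<le> q / 32" using one_minus_cos_le[of \<epsilon>] by (simp add: q_def)
  have "(1 / x ^ 5)\<^sup>2 / 8 \<le> 1 - cos \<theta>"
  proof (rule one_minus_cos_ge)
    have "1 \<le> x ^ 5" using x by (intro one_le_power) auto
    then show "1 / x ^ 5 \<le> 1" using x by (simp add: divide_le_eq)
  qed (use \<theta> x in auto)
  then have "q / 8 \<le> 1 - cos \<theta>" by (simp add: q_def power_divide flip: power_mult)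
  also have "\<dots> \<le> 2 * ((1 - cos (\<gamma> - \<alpha>)) + (1 - cos \<epsilon>))" by (subst \<theta>_eq) (rule one_minus_cos_add)
  finally have *: "q / 8 \<le> 2 * ((1 - cos (\<gamma> - \<alpha>)) + (1 - cos \<epsilon>))" .
  have "q / 32 \<le> u" if "q / 8 \<le> 2 * (u + v)" "v \<le> q / 32" for u v using that by simp
  from this[OF * \<epsilon>] have "q / 32 \<le> 1 - cos (\<gamma> - \<alpha>)" .
  also have "\<dots> \<le> 2 * ((1 - cos \<gamma>) + (1 - cos \<alpha>))"
    using one_minus_cos_add[of \<gamma> "- \<alpha>"] by simp
  finally show ?thesis unfolding \<alpha>_def[symmetric] \<gamma>_def[symmetric] q_def[symmetric] by (simp add: add.commute)
qed

lemma exp_block_score_ge: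
  assumes "1 \<le> k" "real k \<le> x + 1"
  shows "1 / 9 \<le> exp (Re s * block_score x k)"
proof -
  have x: "5000 \<le> x" by (rule large_facts)
  have "\<bar>Re s * block_score x k\<bar> \<le> norm s * (real k / sqrt (block_var x))"
    unfolding abs_mult by (intro mult_mono abs_Re_le_cmod abs_block_score_le[OF large assms(1)]) auto
  also have "\<dots> = norm s / sqrt (block_var x) * real k" by simp
  also have "\<dots> \<le> 1 / x * (x + 1)"
    using s_le_sigma(1) x assms large_facts by (intro mult_mono) (auto simp: field_simps)
  also have "\<dots> \<le> 2" using x by (simp add: field_simps)
  finally have "exp (- 2) \<le> exp (Re s * block_score x k)" by simp
  moreover have "exp (2::real) \<le> 9"
    using power_mono[OF exp_le, of 2] by (simp add: exp_of_nat_mult[symmetric])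
  then have "1 / 9 \<le> exp (- 2 :: real)" by (simp add: exp_minus field_simps)
  ultimately show ?thesis by linarith
qed

text \<open>Only the mode and its successor are kept. Weight \<open>W / x^2\<close>, tilt 1/9 and
  phase \<open>1 / (64 x^10)\<close> multiply to \<open>W / (576 x^12)\<close>, and 576 is below
  \<open>x\<close>.\<close>

lemma Re_saddle_phase_outer_diff:
  assumes \<theta>: "1 / x ^ 5 \<le> \<bar>\<theta>\<bar>" "\<bar>\<theta>\<bar> \<le> pi"
  shows "block_moment r 0 x / x ^ 13 \<le> Re (saddle_phase x (of_real (Re s)) 0) - Re (saddle_phase x s \<theta>)"
proof -
  let ?W = "block_moment r 0 x" and ?k = "block_mode x"
  let ?c = "\<lambda>k. 1 - cos (Im s * block_score x k + \<theta> * real k)"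
  let ?f = "\<lambda>k. block_weight r x k * (exp (Re s * block_score x k) * ?c k)"
  have x: "5000 \<le> x" and W: "0 < ?W" using large_facts by auto
  have c: "0 \<le> ?c k" for k by simp
  have mode: "1 \<le> ?k" "real ?k \<le> x" using block_mode(1,2)[OF large_r[OF large]] by auto
  have weighted: "?W / x\<^sup>2 * (1 / 9 * ?c k) \<le> ?f k" if "k = ?k \<or> k = Suc ?k" for k
  proof (intro mult_mono)
    show "?W / x\<^sup>2 \<le> block_weight r x k" using large_mode[OF large] that by auto
    show "1 / 9 \<le> exp (Re s * block_score x k)" using mode that by (intro exp_block_score_ge) auto
  qed (use x W block_weight_nonneg[of x] in auto)
  have "?W / x ^ 13 \<le> ?W / x\<^sup>2 * (1 / 9 * (1 / x ^ 10 / 64))"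
  proof -
    have "?W / x\<^sup>2 * (1 / 9 * (1 / x ^ 10 / 64)) = ?W / (576 * x ^ 12)"
      using x by (simp add: field_simps flip: power_add)
    moreover have "576 * x ^ 12 \<le> x * x ^ 12" using x by (intro mult_right_mono) auto
    then have "?W / x ^ 13 \<le> ?W / (576 * x ^ 12)"
      using x W by (intro divide_left_mono) (auto simp flip: power_Suc)
    ultimately show ?thesis by (simp only:)
  qed
  also have "\<dots> \<le> ?W / x\<^sup>2 * (1 / 9 * (?c ?k + ?c (Suc ?k)))"
    using x W outer_cos_ge[OF \<theta>, of ?k] by (intro mult_left_mono) auto
  also have "\<dots> = ?W / x\<^sup>2 * (1 / 9 * ?c ?k) + ?W / x\<^sup>2 * (1 / 9 * ?c (Suc ?k))"
    by (simp only: distrib_left)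
  also have "\<dots> \<le> (\<Sum>k\<in>{?k, Suc ?k}. ?f k)"
    using weighted[of ?k] weighted[of "Suc ?k"] by simp
  also have "\<dots> \<le> suminf ?f"
    using x by (intro sum_le_suminf sums_summable[OF sums_Re_saddle_phase])
      (auto intro!: mult_nonneg_nonneg block_weight_nonneg)
  also have "\<dots> = Re (saddle_phase x (of_real (Re s)) 0) - Re (saddle_phase x s \<theta>)"
    using sums_Re_saddle_phase by (rule sums_unique[symmetric])
  finally show ?thesis .
qed

end

lemma Re_saddle_phase_real:
  assumes large: "saddle_large x" and s: "norm s \<le> x"
  shows "Re (saddle_phase x (of_real (Re s)) 0) \<le> norm s ^ 2 / 2 + norm s ^ 3"
proof -
  have "norm (complex_of_real (Re s)) \<le> x" using abs_Re_le_cmod[of s] s by simp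
  then have "Re (saddle_phase x (of_real (Re s)) 0) \<le> \<bar>Re s\<bar> ^ 2 / 2 + \<bar>Re s\<bar> ^ 3"
    using Re_saddle_phase_near[OF large, of "of_real (Re s)" 0] large_x[OF large] by simp
  also have "\<dots> \<le> norm s ^ 2 / 2 + norm s ^ 3"
    by (intro add_mono divide_right_mono power_mono abs_Re_le_cmod) auto
  finally show ?thesis .
qed

text \<open>This is the integrable majorant, uniform in \<open>x\<close>. Near 0 a Gaussian remains;
  elsewhere \<open>1 + t^2\<close> is at most \<open>2 x^4 W\<close>, whereas
  \<open>exp (- W / x^13)\<close> is at most \<open>2 x^26 / W^2\<close>, and
  \<open>W \<ge> x^40\<close> beats the resulting \<open>x^30\<close>.\<close>

lemma norm_exp_saddle_phase_le:
  assumes large: "saddle_large x" and s: "norm s \<le> x" and t: "\<bar>t\<bar> \<le> pi * sqrt (block_moment r 2 x)"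
  shows "norm (exp (saddle_phase x s (t / sqrt (block_moment r 2 x)))) \<le> 4 * exp (norm s ^ 2 / 2 + norm s ^ 3) / (1 + t\<^sup>2)"
proof -
  let ?W = "block_moment r 0 x" and ?B = "block_moment r 2 x"
  let ?C = "norm s ^ 2 / 2 + norm s ^ 3"
  define \<theta> where "\<theta> = t / sqrt ?B"
  have x: "5000 \<le> x" "0 < x" and W: "0 < ?W" "1 \<le> ?W" and W40: "x ^ 40 \<le> ?W"
    using large_x[OF large] large_W[OF large] by auto
  have B: "?W \<le> ?B" by (rule moment_0_le_moment_2[OF large s])
  have t2: "t\<^sup>2 = \<theta>\<^sup>2 * ?B" using B W by (simp add: \<theta>_def power_divide)
  have pos: "0 < 1 + t\<^sup>2" by (simp add: add_pos_nonneg)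
  have "exp (Re (saddle_phase x s \<theta>)) * (1 + t\<^sup>2) \<le> 4 * exp ?C"
  proof (cases "\<bar>\<theta>\<bar> \<le> 1 / x ^ 5")
    case True
    have "Re (saddle_phase x s \<theta>) \<le> ?C - t\<^sup>2 / 4"
      using Re_saddle_phase_near[OF large s True] t2 by simp
    then have "exp (Re (saddle_phase x s \<theta>)) \<le> exp ?C * exp (- (t\<^sup>2 / 4))" by (simp flip: exp_add)
    moreover have "1 + t\<^sup>2 \<le> 4 * exp (t\<^sup>2 / 4)" using exp_ge_add_one_self[of "t\<^sup>2 / 4"] by linarith
    ultimately have "exp (Re (saddle_phase x s \<theta>)) * (1 + t\<^sup>2) \<le> (exp ?C * exp (- (t\<^sup>2 / 4))) * (4 * exp (t\<^sup>2 / 4))"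
      using pos by (intro mult_mono) auto
    also have "\<dots> = 4 * exp ?C" by (simp add: exp_minus)
    finally show ?thesis .
  next
    case False
    have "\<bar>\<theta>\<bar> \<le> pi" using t B W by (simp add: \<theta>_def abs_divide divide_le_eq)
    then have "?W / x ^ 13 \<le> Re (saddle_phase x (of_real (Re s)) 0) - Re (saddle_phase x s \<theta>)"
      using False by (intro Re_saddle_phase_outer_diff[OF large s]) auto
    moreover have "Re (saddle_phase x (of_real (Re s)) 0) \<le> ?C"
      by (rule Re_saddle_phase_real[OF large s])
    ultimately have "exp (Re (saddle_phase x s \<theta>)) \<le> exp ?C * exp (- (?W / x ^ 13))" by (simp flip: exp_add)
    moreover have "exp (- (?W / x ^ 13)) \<le> 2 * x ^ 26 / ?W\<^sup>2"
    proof -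
      have "(?W / x ^ 13)\<^sup>2 \<le> fact 2 * exp (?W / x ^ 13)" using W x by (intro power_le_fact_exp) auto
      then have "?W\<^sup>2 \<le> 2 * x ^ 26 * exp (?W / x ^ 13)"
        using x by (simp add: power_divide divide_le_eq mult_ac flip: power_mult)
      then show ?thesis using W by (simp add: exp_minus field_simps)
    qed
    moreover have "1 + t\<^sup>2 \<le> 2 * x ^ 4 * ?W"
    proof -
      have "t\<^sup>2 \<le> pi\<^sup>2 * ?B"
        using power_mono[OF t, of 2] B W by (simp add: power_mult_distrib)
      also have "\<dots> \<le> 4\<^sup>2 * (324 * x\<^sup>2 * ?W)"
        using large_moment_2[OF large] pi_less_4 B W by (intro mult_mono power_mono) auto
      also have "\<dots> = 5184 * (x\<^sup>2 * ?W)" by simp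
      also have "\<dots> \<le> (x * x) * (x\<^sup>2 * ?W)"
        using x W mult_mono[of 5000 x 5000 x] by (intro mult_right_mono) auto
      also have "\<dots> = x ^ 4 * ?W" by (simp add: eval_nat_numeral)
      finally have "t\<^sup>2 \<le> x ^ 4 * ?W" .
      moreover have "1 * 1 \<le> x ^ 4 * ?W" using x W by (intro mult_mono one_le_power) auto
      ultimately show ?thesis by simp
    qed
    ultimately have "exp (Re (saddle_phase x s \<theta>)) \<le> exp ?C * (2 * x ^ 26 / ?W\<^sup>2)" "1 + t\<^sup>2 \<le> 2 * x ^ 4 * ?W"
      by (meson exp_ge_zero mult_left_mono order_trans)+
    then have "exp (Re (saddle_phase x s \<theta>)) * (1 + t\<^sup>2) \<le> (exp ?C * (2 * x ^ 26 / ?W\<^sup>2)) * (2 * x ^ 4 * ?W)"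
      using pos x W by (intro mult_mono) auto
    also have "\<dots> = 4 * exp ?C * (x ^ 30 / ?W)"
      using W by (simp add: power2_eq_square flip: power_add)
    also have "\<dots> \<le> 4 * exp ?C * 1"
      using order_trans[OF power_increasing[of 30 40 x] W40] W x
      by (intro mult_left_mono) (auto simp: divide_le_eq)
    finally show ?thesis by simp
  qed
  then show ?thesis using pos by (simp add: \<theta>_def[symmetric] pos_le_divide_eq)
qed

end

section \<open>Dominated convergence of the rescaled integral\<close>

lemma integrable_inverse_one_plus_sq: "integrable lborel (\<lambda>t::real. 1 / (1 + t\<^sup>2))"
  using integrable_inverse_1_plus_square
  by (simp add: set_integrable_def einterval_def inverse_eq_divide)

context cluster_weights
begin

text \<open>Rescaling by \<open>sqrt (block_moment r 2 x)\<close> turns the quadratic term in the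
  angle into \<open>- t^2 / 2\<close>; the indicator puts all integrals on the whole real
  line.\<close>

definition saddle_integral :: "real \<Rightarrow> complex \<Rightarrow> complex" where
  "saddle_integral x s = (LINT t|lborel. indicator {-(pi * sqrt (block_moment r 2 x))..pi * sqrt (block_moment r 2 x)} t *\<^sub>R
     exp (saddle_phase x s (t / sqrt (block_moment r 2 x))))"

lemma saddle_integrand_measurable:
  "(\<lambda>t. indicator {-(pi * sqrt (block_moment r 2 x))..pi * sqrt (block_moment r 2 x)} t *\<^sub>R
     exp (saddle_phase x s (t / sqrt (block_moment r 2 x)))) \<in> borel_measurable lborel"
  unfolding saddle_phase_def saddle_arg_def by measurable

lemma saddle_integrand_bound:
  assumes "saddle_large x" "norm s \<le> x"
  shows "norm (indicator {-(pi * sqrt (block_moment r 2 x))..pi * sqrt (block_moment r 2 x)} t *\<^sub>R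
     exp (saddle_phase x s (t / sqrt (block_moment r 2 x)))) \<le> 4 * exp (norm s ^ 2 / 2 + norm s ^ 3) * (1 / (1 + t\<^sup>2))"
proof (cases "t \<in> {-(pi * sqrt (block_moment r 2 x))..pi * sqrt (block_moment r 2 x)}")
  case True
  then have "\<bar>t\<bar> \<le> pi * sqrt (block_moment r 2 x)" by auto
  then show ?thesis using norm_exp_saddle_phase_le[OF assms] True by simp
next
  case False
  then show ?thesis by (simp add: add_nonneg_nonneg)
qed

lemma saddle_integral_eq:
  assumes large: "saddle_large x" and s: "norm s \<le> x"
    and I: "((\<lambda>\<theta>. exp (saddle_phase x s \<theta>)) has_integral I) {-pi..pi}"
  shows "saddle_integral x s = of_real (sqrt (block_moment r 2 x)) * I"
proof -
  let ?b = "sqrt (block_moment r 2 x)"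
  let ?S = "{-(pi * ?b)..pi * ?b}"
  have b: "0 < ?b" using block_moment_pos[of x 2] large_x[OF large] by simp
  have "((\<lambda>t. exp (saddle_phase x s (inverse ?b *\<^sub>R t + 0))) has_integral (I /\<^sub>R inverse ?b ^ DIM(real)))
           (cbox ((- pi - 0) /\<^sub>R inverse ?b) ((pi - 0) /\<^sub>R inverse ?b))"
    by (rule has_integral_affinity') (use I b in auto)
  then have "((\<lambda>t. exp (saddle_phase x s (t / ?b))) has_integral (of_real ?b * I)) ?S"
    using b by (simp add: divide_inverse mult.commute scaleR_conv_of_real)
  then have 1: "((\<lambda>t. if t \<in> ?S then exp (saddle_phase x s (t / ?b)) else 0) has_integral (of_real ?b * I)) UNIV"
    by (simp only: has_integral_restrict_UNIV)
  have "integrable lborel (\<lambda>t. indicator ?S t *\<^sub>R exp (saddle_phase x s (t / ?b)))"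
    by (rule Bochner_Integration.integrable_bound[OF integrable_mult_right[OF integrable_inverse_one_plus_sq,
          of "4 * exp (norm s ^ 2 / 2 + norm s ^ 3)"] saddle_integrand_measurable])
      (use saddle_integrand_bound[OF large s] in \<open>force intro: order_trans\<close>)
  from has_integral_integral_lborel[OF this]
  have 2: "((\<lambda>t. if t \<in> ?S then exp (saddle_phase x s (t / ?b)) else 0) has_integral saddle_integral x s) UNIV"
    unfolding saddle_integral_def by (rule has_integral_eq[rotated]) auto
  show ?thesis by (rule has_integral_unique[OF 2 1])
qed

text \<open>The limit of the phase splits into \<open>s^2 / 2\<close> and \<open>- t^2 / 2\<close>
  without a mixed term, so the Gaussian integral gives the same factor \<open>sqrt (2 pi)\<close>
  for all \<open>s\<close>.\<close>

lemma saddle_integral_tendsto: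
  "((\<lambda>x. saddle_integral x s) \<longlongrightarrow> of_real (sqrt (2 * pi)) * exp (s\<^sup>2 / 2)) at_top"
proof -
  let ?B = "\<lambda>x. sqrt (block_moment r 2 x)"
  let ?f = "\<lambda>x t. indicator {-(pi * ?B x)..pi * ?B x} t *\<^sub>R exp (saddle_phase x s (t / ?B x))"
  let ?g = "\<lambda>t. exp ((s\<^sup>2 - of_real (t\<^sup>2)) / 2)"
  have ev: "\<forall>\<^sub>F x in at_top. saddle_large x \<and> norm s \<le> x"
    by (intro eventually_conj eventually_saddle_large eventually_ge_at_top)
  have "((\<lambda>x. LINT t|lborel. ?f x t) \<longlongrightarrow> (LINT t|lborel. ?g t)) at_top"
  proof (rule integral_dominated_convergence_at_top)
    show "integrable lborel (\<lambda>t::real. 4 * exp (norm s ^ 2 / 2 + norm s ^ 3) * (1 / (1 + t\<^sup>2)))"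
      by (intro integrable_mult_right integrable_inverse_one_plus_sq)
    show "\<forall>\<^sub>F x in at_top. AE t in lborel. norm (?f x t) \<le> 4 * exp (norm s ^ 2 / 2 + norm s ^ 3) * (1 / (1 + t\<^sup>2))"
      using ev by eventually_elim (use saddle_integrand_bound in auto)
    show "AE t in lborel. ((\<lambda>x. ?f x t) \<longlongrightarrow> ?g t) at_top"
    proof (rule AE_I2)
      fix t :: real
      have "((\<lambda>x. (norm s ^ 3 + \<bar>t\<bar> ^ 3) / x ^ 8) \<longlongrightarrow> 0) at_top" by real_asymp
      then have "((\<lambda>x. saddle_phase x s (t / ?B x) - (s\<^sup>2 - of_real (t\<^sup>2)) / 2) \<longlongrightarrow> 0) at_top"
        by (rule Lim_null_comparison[rotated]) (use ev in eventually_elim, use saddle_phase_pointwise in auto)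
      then have "((\<lambda>x. saddle_phase x s (t / ?B x)) \<longlongrightarrow> (s\<^sup>2 - of_real (t\<^sup>2)) / 2) at_top"
        by (simp add: LIM_zero_iff)
      then have lim: "((\<lambda>x. exp (saddle_phase x s (t / ?B x))) \<longlongrightarrow> ?g t) at_top" by (rule tendsto_exp)
      have "\<forall>\<^sub>F x in at_top. exp (saddle_phase x s (t / ?B x)) = ?f x t"
        using eventually_saddle_large eventually_ge_at_top[of "\<bar>t\<bar>"]
      proof eventually_elim
        case (elim x)
        have x: "5000 \<le> x" using large_x[OF elim(1)] .
        have "x\<^sup>2 \<le> x ^ 40" using x by (intro power_increasing) auto
        also have "\<dots> \<le> block_moment r 2 x"
          using large_W[OF elim(1)] moment_0_le_moment_1[OF elim(1)] moment_1_le_moment_2[OF elim(1)] by simp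
        finally have "x \<le> ?B x" by (rule real_le_rsqrt)
        moreover have "0 \<le> ?B x" using \<open>x \<le> ?B x\<close> x by linarith
        then have "?B x \<le> pi * ?B x" using pi_gt3 mult_right_mono[of 1 pi "?B x"] by simp
        ultimately have "\<bar>t\<bar> \<le> pi * ?B x" using elim by simp
        then show ?case by (auto simp: abs_le_iff)
      qed
      from Lim_transform_eventually[OF lim this] show "((\<lambda>x. ?f x t) \<longlongrightarrow> ?g t) at_top" .
    qed
    show "?g \<in> borel_measurable lborel"
    proof -
      have "continuous_on UNIV ?g" by (auto intro!: continuous_intros)
      then show ?thesis using borel_measurable_continuous_onI by simp
    qed
  qed (rule saddle_integrand_measurable)
  also have "(LINT t|lborel. ?g t) = (LINT t|lborel. (of_real (sqrt (2 * pi)) * exp (s\<^sup>2 / 2)) * of_real (std_normal_density t))"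
  proof (intro Bochner_Integration.integral_cong refl)
    fix t :: real
    have "?g t = exp (s\<^sup>2 / 2 + of_real (- t\<^sup>2 / 2))" by (simp add: diff_divide_distrib)
    also have "\<dots> = exp (s\<^sup>2 / 2) * of_real (exp (- t\<^sup>2 / 2))" by (simp only: exp_add exp_of_real)
    also have "exp (- t\<^sup>2 / 2) = sqrt (2 * pi) * std_normal_density t"
      unfolding std_normal_density_def by simp
    finally show "?g t = (of_real (sqrt (2 * pi)) * exp (s\<^sup>2 / 2)) * of_real (std_normal_density t)"
      by (simp only: of_real_mult mult_ac)
  qed
  also have "\<dots> = of_real (sqrt (2 * pi)) * exp (s\<^sup>2 / 2)"
    using integral_std_normal_moment_even[of 0] by simp
  finally show ?thesis unfolding saddle_integral_def .
qed


section \<open>The saddle point as a function of \<open>n\<close>\<close>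

lemma continuous_block_moment: "isCont (block_moment r j) x"
proof -
  have eq: "block_moment r j = (\<lambda>y. \<Sum>k. (real k ^ j * block_weight r 1 k) * y ^ k)"
    unfolding block_moment_def by (subst block_weight_one) (simp add: mult.assoc)
  have "summable (\<lambda>k. (real k ^ j * block_weight r 1 k) * y ^ k)" for y
  proof (rule summable_norm_cancel)
    have "norm ((real k ^ j * block_weight r 1 k) * y ^ k) = real k ^ j * block_weight r \<bar>y\<bar> k" for k
      using block_weight_nonneg[of 1 k] block_weight_one[of r "\<bar>y\<bar>" k]
      by (simp add: abs_mult power_abs)
    then show "summable (\<lambda>k. norm ((real k ^ j * block_weight r 1 k) * y ^ k))"
      using summable_block_moment[of "\<bar>y\<bar>" j] by simp
  qed
  then show ?thesis unfolding eq by (rule isCont_powser_converges_everywhere)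
qed

lemma block_moment_mono: "0 \<le> x \<Longrightarrow> x \<le> y \<Longrightarrow> block_moment r j x \<le> block_moment r j y"
  by (rule sums_le[OF _ sums_block_moment sums_block_moment])
    (auto intro!: mult_left_mono block_weight_mono)

text \<open>The term \<open>k = 1\<close> gives \<open>block_moment r 1 x \<ge> x\<close>, and the
  moment vanishes at 0; so the intermediate value theorem applies between 0 and
  \<open>n + 1\<close>.\<close>

lemma ex_saddle: "\<exists>x>0. block_moment r 1 x = real (Suc n)"
proof -
  have "real (Suc n) = (\<Sum>k\<in>{1}. real k ^ 1 * block_weight r (real (Suc n)) k)"
    by (simp add: block_weight_def numeral_2_eq_2)
  also have "\<dots> \<le> block_moment r 1 (real (Suc n))"
    unfolding block_moment_def
    by (intro sum_le_suminf summable_block_moment) (auto intro!: mult_nonneg_nonneg block_weight_nonneg)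
  finally have 1: "real (Suc n) \<le> block_moment r 1 (real (Suc n))" .
  have "block_weight r 0 = (\<lambda>k. 0)" by (auto simp: block_weight_def)
  then have 0: "block_moment r 1 0 = 0" by (simp add: block_moment_def)
  have "\<exists>x. 0 \<le> x \<and> x \<le> real (Suc n) \<and> block_moment r 1 x = real (Suc n)"
    using 0 1 continuous_block_moment by (intro IVT) auto
  then show ?thesis using 0 by (metis less_eq_real_def of_nat_0 of_nat_eq_iff old.nat.distinct(2))
qed

text \<open>For \<open>n = 0\<close> there is no positive solution and the value is unspecified,
  which limits as \<open>n\<close> grows do not notice.\<close>

definition saddle :: "nat \<Rightarrow> real" where
  "saddle n = (SOME x. 0 < x \<and> block_moment r 1 x = real n)"

lemma saddle: "0 < n \<Longrightarrow> 0 < saddle n" "0 < n \<Longrightarrow> block_moment r 1 (saddle n) = real n"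
  using someI_ex[of "\<lambda>x. 0 < x \<and> block_moment r 1 x = real n"] ex_saddle[of "n - 1"]
  unfolding saddle_def by auto

text \<open>Wherever \<open>saddle n\<close> is below \<open>M\<close>, monotonicity bounds
  \<open>n\<close> by \<open>block_moment r 1 M\<close>.\<close>

lemma filterlim_saddle: "filterlim saddle at_top sequentially"
proof (subst filterlim_at_top_gt[where c = 0], intro allI impI)
  fix M :: real assume M: "0 < M"
  obtain N :: nat where N: "block_moment r 1 M < real N" using reals_Archimedean2 by blast
  show "\<forall>\<^sub>F n in sequentially. M \<le> saddle n"
    using eventually_ge_at_top[of "Suc N"]
  proof eventually_elim
    case (elim n)
    show ?case
    proof (rule ccontr)
      assume "\<not> M \<le> saddle n"
      then have "block_moment r 1 (saddle n) \<le> block_moment r 1 M"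
        using saddle[of n] elim by (intro block_moment_mono) auto
      then show False using N saddle[of n] elim by auto
    qed
  qed
qed

text \<open>The integrals at \<open>s\<close> and at 0 carry the same constant \<open>?K\<close>,
  which cancels in their quotient.\<close>

lemma cluster_poly_mgf_tendsto:
  "(\<lambda>n. exp (- (s * of_real (block_moment r 0 (saddle n) / sqrt (block_var (saddle n))))) *
      cluster_poly r n (exp (s / of_real (sqrt (block_var (saddle n))))) / cluster_poly r n 1)
    \<longlonglongrightarrow> exp (s\<^sup>2 / 2)"
proof -
  have lim: "(\<lambda>n. saddle_integral (saddle n) s' ) \<longlonglongrightarrow> of_real (sqrt (2 * pi)) * exp (s'\<^sup>2 / 2)" for s'
    by (rule filterlim_compose[OF saddle_integral_tendsto filterlim_saddle])
  have "(\<lambda>n. saddle_integral (saddle n) s / saddle_integral (saddle n) 0) \<longlonglongrightarrow>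
     (of_real (sqrt (2 * pi)) * exp (s\<^sup>2 / 2)) / (of_real (sqrt (2 * pi)) * exp (0\<^sup>2 / 2))"
    by (intro tendsto_divide lim) simp
  also have "(of_real (sqrt (2 * pi)) * exp (s\<^sup>2 / 2)) / (of_real (sqrt (2 * pi)) * exp (0\<^sup>2 / 2)) = exp (s\<^sup>2 / 2)"
    by simp
  finally have lim2: "(\<lambda>n. saddle_integral (saddle n) s / saddle_integral (saddle n) 0) \<longlonglongrightarrow> exp (s\<^sup>2 / 2)" .
  have "\<forall>\<^sub>F n in sequentially. saddle_large (saddle n) \<and> norm s \<le> saddle n \<and> 0 < n"
    using filterlim_saddle eventually_saddle_large
    by (intro eventually_conj eventually_gt_at_top)
      (auto simp: filterlim_at_top eventually_filtermap filterlim_iff)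
  then have "\<forall>\<^sub>F n in sequentially. saddle_integral (saddle n) s / saddle_integral (saddle n) 0 =
    exp (- (s * of_real (block_moment r 0 (saddle n) / sqrt (block_var (saddle n))))) *
      cluster_poly r n (exp (s / of_real (sqrt (block_var (saddle n))))) / cluster_poly r n 1"
  proof eventually_elim
    case (elim n)
    let ?x = "saddle n"
    have x: "0 < ?x" and n: "block_moment r 1 ?x = real n" using saddle elim by auto
    have V: "0 < block_var ?x" using large_V_pos elim by auto
    let ?K = "complex_of_real (sqrt (block_moment r 2 ?x)) * of_real (2 * pi / fact n * ?x ^ n * exp (- block_moment r 0 ?x))"
    have K: "?K \<noteq> 0" using x block_moment_pos[OF x, of 2] by simp
    have eq: "saddle_integral ?x s' = ?K * (exp (- (s' * of_real (block_moment r 0 ?x / sqrt (block_var ?x)))) *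
        cluster_poly r n (exp (s' / of_real (sqrt (block_var ?x)))))" if "norm s' \<le> ?x" for s'
      using saddle_integral_eq[OF _ that exp_saddle_phase_has_integral[OF x V n]] elim
      by (simp only: mult.assoc)
    have "saddle_integral ?x 0 = ?K * cluster_poly r n 1" using eq[of 0] x by simp
    moreover have "saddle_integral ?x s = ?K * (exp (- (s * of_real (block_moment r 0 ?x / sqrt (block_var ?x)))) *
        cluster_poly r n (exp (s / of_real (sqrt (block_var ?x)))))"
      using elim by (intro eq) simp
    ultimately show ?case by (simp only: mult_divide_mult_cancel_left[OF K])
  qed
  from Lim_transform_eventually[OF lim2 this] show ?thesis .
qed

end

section \<open>From moment generating functions to the limit law\<close>

text \<open>Extracting the coefficient of \<open>s^k\<close> from \<open>exp (s x)\<close> by an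
  integral over the unit circle is what recovers moments from moment generating functions.\<close>

lemma exp_power_fourier:
  "((\<lambda>t. exp (cis t * of_real x) * cis (- (real k * t))) has_integral (2 * pi / fact k * of_real (x ^ k))) {-pi..pi}"
proof -
  have "(deriv ^^ k) (\<lambda>z. exp (of_real x * z)) 0 = of_real x ^ k * (deriv ^^ k) exp (complex_of_real x * 0)"
    by (rule higher_deriv_compose_linear[of _ UNIV UNIV]) (auto intro: holomorphic_intros)
  moreover have "(deriv ^^ k) exp = (exp :: complex \<Rightarrow> complex)"
    by (induction k) (auto intro!: ext DERIV_imp_deriv DERIV_exp)
  ultimately have "(deriv ^^ k) (\<lambda>z. exp (complex_of_real x * z)) 0 = of_real (x ^ k)" by simp
  then show ?thesis
    using fourier_coefficient[of "\<lambda>z. exp (of_real x * z)" k]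
    by (simp add: holomorphic_intros mult.commute)
qed

lemma deriv_gaussian:
  "deriv (\<lambda>s::complex. exp (s\<^sup>2 / 2)) = (\<lambda>s. s * exp (s\<^sup>2 / 2))"
  by (rule ext, rule DERIV_imp_deriv) (auto intro!: derivative_eq_intros)

lemma deriv_gaussian2: "deriv (\<lambda>s::complex. s * exp (s\<^sup>2 / 2)) 0 = 1"
  by (rule DERIV_imp_deriv) (auto intro!: derivative_eq_intros)

lemma norm_iexp_diff_le: "norm (exp (\<i> * of_real a) - exp (\<i> * of_real b)) \<le> \<bar>a - b\<bar>"
proof -
  have "exp (\<i> * of_real a) - exp (\<i> * of_real b) = exp (\<i> * of_real b) * (exp (\<i> * of_real (a - b)) - 1)"
    by (simp add: algebra_simps flip: exp_add)
  then have "norm (exp (\<i> * of_real a) - exp (\<i> * of_real b)) = 2 * \<bar>sin ((a - b) / 2)\<bar>"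
    using dist_exp_i_1[of "a - b"] by (simp add: norm_mult)
  also have "\<dots> \<le> \<bar>a - b\<bar>" using abs_sin_x_le_abs_x[of "(a - b) / 2"] by simp
  finally show ?thesis .
qed

context
  fixes M :: "nat \<Rightarrow> 'a pmf" and X :: "nat \<Rightarrow> 'a \<Rightarrow> real"
  assumes fin: "\<And>n. finite (set_pmf (M n))"
    and mgf: "\<And>s::complex. (\<lambda>n. measure_pmf.expectation (M n) (\<lambda>\<omega>. exp (s * of_real (X n \<omega>)))) \<longlonglongrightarrow> exp (s\<^sup>2 / 2)"
begin

lemma int_fin: "integrable (measure_pmf (M n)) (f :: _ \<Rightarrow> 'b::{banach, second_countable_topology})"
  by (rule integrable_measure_pmf_finite[OF fin])

lemma moment_fourier:
  "((\<lambda>t. measure_pmf.expectation (M n) (\<lambda>\<omega>. exp (cis t * of_real (X n \<omega>))) * cis (- (real k * t))) has_integral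
    (2 * pi / fact k * complex_of_real (measure_pmf.expectation (M n) (\<lambda>\<omega>. X n \<omega> ^ k)))) {-pi..pi}"
proof -
  have E: "measure_pmf.expectation (M n) f = (\<Sum>\<omega>\<in>set_pmf (M n). pmf (M n) \<omega> *\<^sub>R f \<omega>)"
    for f :: "_ \<Rightarrow> 'b::{banach, second_countable_topology}"
    by (rule integral_measure_pmf[OF fin]) auto
  have "((\<lambda>t. \<Sum>\<omega>\<in>set_pmf (M n). of_real (pmf (M n) \<omega>) * (exp (cis t * of_real (X n \<omega>)) * cis (- (real k * t)))) has_integral
    (\<Sum>\<omega>\<in>set_pmf (M n). of_real (pmf (M n) \<omega>) * (2 * pi / fact k * complex_of_real (X n \<omega> ^ k)))) {-pi..pi}"
    by (intro has_integral_sum fin has_integral_mult_right) (use exp_power_fourier in simp)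
  then show ?thesis
    unfolding E by (simp add: scaleR_conv_of_real sum_distrib_left sum_distrib_right mult_ac)
qed

text \<open>On the unit circle the generating functions are dominated by the expectation of
  \<open>exp X + exp (- X)\<close>, the sum of their values at 1 and -1, which converges and is
  therefore bounded. So the Cauchy integrals for the \<open>k\<close>-th derivative at 0
  converge.\<close>

lemma moment_tendsto:
  "(\<lambda>n. of_real (measure_pmf.expectation (M n) (\<lambda>\<omega>. X n \<omega> ^ k))) \<longlonglongrightarrow> (deriv ^^ k) (\<lambda>s. exp (s\<^sup>2 / 2)) (0::complex)"
proof -
  let ?\<phi> = "\<lambda>n s. measure_pmf.expectation (M n) (\<lambda>\<omega>. exp (s * complex_of_real (X n \<omega>)))"
  obtain K where K: "norm (?\<phi> n 1 + ?\<phi> n (-1)) \<le> K" for n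
  proof -
    have "convergent (\<lambda>n. ?\<phi> n 1 + ?\<phi> n (-1))"
      using tendsto_add[OF mgf[of 1] mgf[of "-1"]] by (rule convergentI)
    then have "Bseq (\<lambda>n. ?\<phi> n 1 + ?\<phi> n (-1))" by (rule convergent_imp_Bseq)
    then show ?thesis using that by (meson BseqE)
  qed
  have bound: "norm (?\<phi> n (cis t)) \<le> K" for n t
  proof -
    have "norm (?\<phi> n (cis t)) \<le> measure_pmf.expectation (M n) (\<lambda>\<omega>. norm (exp (cis t * complex_of_real (X n \<omega>))))"
      by (rule integral_norm_bound)
    also have "\<dots> \<le> measure_pmf.expectation (M n) (\<lambda>\<omega>. exp (X n \<omega>) + exp (- X n \<omega>))"
    proof (intro integral_mono int_fin)
      fix \<omega>
      have "\<bar>cos t * X n \<omega>\<bar> \<le> 1 * \<bar>X n \<omega>\<bar>" unfolding abs_mult by (intro mult_right_mono abs_cos_le_one) auto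
      then have "cos t * X n \<omega> \<le> \<bar>X n \<omega>\<bar>" by simp
      then have "exp (cos t * X n \<omega>) \<le> exp \<bar>X n \<omega>\<bar>" by simp
      also have "\<dots> \<le> exp (X n \<omega>) + exp (- X n \<omega>)" by (cases "0 \<le> X n \<omega>") (auto simp: add_increasing add_increasing2)
      finally show "norm (exp (cis t * complex_of_real (X n \<omega>))) \<le> exp (X n \<omega>) + exp (- X n \<omega>)" by simp
    qed
    also have "complex_of_real \<dots> = ?\<phi> n 1 + ?\<phi> n (-1)"
      unfolding integral_complex_of_real[symmetric]
      by (subst Bochner_Integration.integral_add[symmetric]) (auto intro!: int_fin simp: exp_of_real exp_minus_of_real)
    then have "measure_pmf.expectation (M n) (\<lambda>\<omega>. exp (X n \<omega>) + exp (- X n \<omega>)) \<le> norm (?\<phi> n 1 + ?\<phi> n (-1))"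
      by (metis abs_ge_self norm_of_real)
    also note K
    finally show ?thesis .
  qed
  let ?f = "\<lambda>n t. ?\<phi> n (cis t) * cis (- (real k * t))"
  let ?g = "\<lambda>t. exp ((cis t)\<^sup>2 / 2) * cis (- (real k * t))"
  have "(\<lambda>n. integral {-pi..pi} (?f n)) \<longlonglongrightarrow> integral {-pi..pi} ?g"
  proof (rule dominated_convergence(2))
    show "?f n integrable_on {-pi..pi}" for n using moment_fourier by (rule has_integral_integrable)
    show "(\<lambda>_. K) integrable_on {-pi..pi}" by (rule integrable_const_ivl)
    show "norm (?f n t) \<le> K" for n t using bound[of n t] by (simp add: norm_mult)
    show "(\<lambda>n. ?f n t) \<longlonglongrightarrow> ?g t" for t by (intro tendsto_mult mgf tendsto_const)
  qed
  moreover have "integral {-pi..pi} (?f n) = 2 * pi / fact k * complex_of_real (measure_pmf.expectation (M n) (\<lambda>\<omega>. X n \<omega> ^ k))" for n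
    by (rule integral_unique[OF moment_fourier])
  moreover have "integral {-pi..pi} ?g = 2 * pi / fact k * (deriv ^^ k) (\<lambda>s. exp (s\<^sup>2 / 2)) (0::complex)"
    by (rule integral_unique[OF fourier_coefficient]) (auto intro!: holomorphic_intros)
  ultimately have "(\<lambda>n. (2 * pi / fact k) * complex_of_real (measure_pmf.expectation (M n) (\<lambda>\<omega>. X n \<omega> ^ k)))
    \<longlonglongrightarrow> 2 * pi / fact k * (deriv ^^ k) (\<lambda>s. exp (s\<^sup>2 / 2)) (0::complex)" by simp
  then show ?thesis
    by (subst (asm) tendsto_mult_left_iff) auto
qed

lemma mean_tendsto: "(\<lambda>n. measure_pmf.expectation (M n) (X n)) \<longlonglongrightarrow> 0"
proof -
  have "(\<lambda>n. complex_of_real (measure_pmf.expectation (M n) (X n))) \<longlonglongrightarrow> of_real 0"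
    using moment_tendsto[of 1] by (simp add: deriv_gaussian)
  then show ?thesis by (simp only: tendsto_of_real_iff)
qed

lemma second_moment_tendsto: "(\<lambda>n. measure_pmf.expectation (M n) (\<lambda>\<omega>. X n \<omega> ^ 2)) \<longlonglongrightarrow> 1"
proof -
  have "(\<lambda>n. complex_of_real (measure_pmf.expectation (M n) (\<lambda>\<omega>. X n \<omega> ^ 2))) \<longlonglongrightarrow> of_real 1"
  proof -
    have D: "(deriv ^^ Suc (Suc 0)) (\<lambda>s::complex. exp (s\<^sup>2 / 2)) 0 = of_real 1"
      by (simp add: deriv_gaussian deriv_gaussian2)
    show ?thesis using moment_tendsto[of "Suc (Suc 0)"] unfolding D unfolding numeral_2_eq_2 .
  qed
  then show ?thesis by (simp only: tendsto_of_real_iff)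
qed

lemma variance_tendsto: "(\<lambda>n. measure_pmf.variance (M n) (X n)) \<longlonglongrightarrow> 1"
proof -
  have "measure_pmf.variance (M n) (X n) = measure_pmf.expectation (M n) (\<lambda>\<omega>. X n \<omega> ^ 2) - (measure_pmf.expectation (M n) (X n))\<^sup>2" for n
    by (rule measure_pmf.variance_eq) (rule int_fin)+
  then show ?thesis using tendsto_diff[OF second_moment_tendsto tendsto_power[OF mean_tendsto, of 2]] by simp
qed

text \<open>\<open>X n\<close> is only asymptotically standard. Standardising it replaces the
  argument \<open>t\<close> of the characteristic function by \<open>t / v\<close> with
  \<open>v\<close> tending to 1; the second moments are bounded, which makes the characteristic
  functions equicontinuous and the replacement harmless.\<close>

lemma weak_conv_standardised:
  "weak_conv_m (\<lambda>n. distr (measure_pmf (M n)) borel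
      (\<lambda>\<omega>. (X n \<omega> - measure_pmf.expectation (M n) (X n)) / sqrt (measure_pmf.variance (M n) (X n))))
    std_normal_distribution"
proof (rule levy_continuity)
  let ?m = "\<lambda>n. measure_pmf.expectation (M n) (X n)"
  let ?v = "\<lambda>n. sqrt (measure_pmf.variance (M n) (X n))"
  let ?Y = "\<lambda>n \<omega>. (X n \<omega> - ?m n) / ?v n"
  let ?\<phi> = "\<lambda>n s. measure_pmf.expectation (M n) (\<lambda>\<omega>. exp (s * complex_of_real (X n \<omega>)))"
  show "real_distribution (distr (measure_pmf (M n)) borel (?Y n))" for n
    by (rule prob_space.real_distribution_distr[OF measure_pmf.prob_space_axioms]) auto
  show "real_distribution std_normal_distribution" by (rule real_dist_normal_dist)
  fix t :: real
  let ?t = "\<lambda>n. t / ?v n"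
  have v: "?v \<longlonglongrightarrow> 1" using tendsto_real_sqrt[OF variance_tendsto] by simp
  have t: "?t \<longlonglongrightarrow> t" using tendsto_divide[OF tendsto_const v, of t] by simp
  have char: "char (distr (measure_pmf (M n)) borel (?Y n)) t = exp (\<i> * of_real (- (?t n * ?m n))) * ?\<phi> n (\<i> * of_real (?t n))" for n
  proof -
    have "char (distr (measure_pmf (M n)) borel (?Y n)) t = measure_pmf.expectation (M n) (\<lambda>\<omega>. exp (\<i> * of_real (t * ?Y n \<omega>)))"
      unfolding char_def by (subst integral_distr) auto
    also have "(\<lambda>\<omega>. exp (\<i> * complex_of_real (t * ?Y n \<omega>))) =
      (\<lambda>\<omega>. exp (\<i> * of_real (- (?t n * ?m n))) * exp (\<i> * of_real (?t n) * of_real (X n \<omega>)))"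
      by (simp add: diff_divide_distrib algebra_simps flip: exp_add)
    finally show ?thesis by simp
  qed
  have diff: "(\<lambda>n. ?\<phi> n (\<i> * of_real (?t n)) - ?\<phi> n (\<i> * of_real t)) \<longlonglongrightarrow> 0"
  proof (rule Lim_null_comparison)
    have "(\<lambda>n. \<bar>?t n - t\<bar> * (1 + measure_pmf.expectation (M n) (\<lambda>\<omega>. X n \<omega> ^ 2))) \<longlonglongrightarrow> \<bar>t - t\<bar> * (1 + 1)"
      by (intro tendsto_intros t second_moment_tendsto)
    then show "(\<lambda>n. \<bar>?t n - t\<bar> * (1 + measure_pmf.expectation (M n) (\<lambda>\<omega>. X n \<omega> ^ 2))) \<longlonglongrightarrow> 0" by simp
    show "\<forall>\<^sub>F n in sequentially. norm (?\<phi> n (\<i> * of_real (?t n)) - ?\<phi> n (\<i> * of_real t)) \<le>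
        \<bar>?t n - t\<bar> * (1 + measure_pmf.expectation (M n) (\<lambda>\<omega>. X n \<omega> ^ 2))"
    proof (intro always_eventually allI)
      fix n
      have "?\<phi> n (\<i> * of_real (?t n)) - ?\<phi> n (\<i> * of_real t) =
        measure_pmf.expectation (M n) (\<lambda>\<omega>. exp (\<i> * of_real (?t n * X n \<omega>)) - exp (\<i> * of_real (t * X n \<omega>)))"
        by (subst Bochner_Integration.integral_diff) (auto intro!: int_fin simp: mult.assoc)
      also have "norm \<dots> \<le> measure_pmf.expectation (M n) (\<lambda>\<omega>. norm (exp (\<i> * of_real (?t n * X n \<omega>)) - exp (\<i> * of_real (t * X n \<omega>))))"
        by (rule integral_norm_bound)
      also have "\<dots> \<le> measure_pmf.expectation (M n) (\<lambda>\<omega>. \<bar>?t n - t\<bar> * (1 + X n \<omega> ^ 2))"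
      proof (intro integral_mono int_fin)
        fix \<omega>
        have "norm (exp (\<i> * of_real (?t n * X n \<omega>)) - exp (\<i> * of_real (t * X n \<omega>))) \<le> \<bar>?t n * X n \<omega> - t * X n \<omega>\<bar>"
          by (rule norm_iexp_diff_le)
        also have "\<dots> = \<bar>?t n - t\<bar> * \<bar>X n \<omega>\<bar>" by (simp only: left_diff_distrib[symmetric] abs_mult)
        also have "\<dots> \<le> \<bar>?t n - t\<bar> * (1 + X n \<omega> ^ 2)"
        proof (intro mult_left_mono)
          have "0 \<le> (\<bar>X n \<omega>\<bar> - 1 / 2)\<^sup>2" by simp
          also have "\<dots> = X n \<omega> ^ 2 - \<bar>X n \<omega>\<bar> + 1 / 4" by (simp add: power2_diff power_divide)
          finally show "\<bar>X n \<omega>\<bar> \<le> 1 + X n \<omega> ^ 2" by linarith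
        qed simp
        finally show "norm (exp (\<i> * of_real (?t n * X n \<omega>)) - exp (\<i> * of_real (t * X n \<omega>))) \<le> \<bar>?t n - t\<bar> * (1 + X n \<omega> ^ 2)" .
      qed
      also have "\<dots> = \<bar>?t n - t\<bar> * (1 + measure_pmf.expectation (M n) (\<lambda>\<omega>. X n \<omega> ^ 2))"
        by (simp add: int_fin)
      finally show "norm (?\<phi> n (\<i> * of_real (?t n)) - ?\<phi> n (\<i> * of_real t)) \<le>
        \<bar>?t n - t\<bar> * (1 + measure_pmf.expectation (M n) (\<lambda>\<omega>. X n \<omega> ^ 2))" .
    qed
  qed
  have "(\<lambda>n. exp (\<i> * of_real (- (?t n * ?m n))) * ((?\<phi> n (\<i> * of_real (?t n)) - ?\<phi> n (\<i> * of_real t)) + ?\<phi> n (\<i> * of_real t)))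
    \<longlonglongrightarrow> exp (\<i> * of_real (- (t * 0))) * (0 + exp ((\<i> * of_real t)\<^sup>2 / 2))"
    by (intro tendsto_intros diff mgf t mean_tendsto)
  then show "(\<lambda>n. char (distr (measure_pmf (M n)) borel (?Y n)) t) \<longlonglongrightarrow> char std_normal_distribution t"
    unfolding char char_std_normal_distribution by (simp add: power_mult_distrib flip: exp_of_real)
qed

end

section \<open>Application to the number of clusters\<close>

lemma (in cluster_weights) partition_sum_cluster_poly:
  assumes "finite A"
  shows "partition_sum (\<lambda>k. y * of_real (r ^ (k choose 2))) A = cluster_poly r (card A) y"
  by (rule partition_sum_card[OF cluster_poly_0 cluster_poly_Suc assms])

lemma (in cluster_weights) sum_partitions_power:
  "(\<Sum>P | partition_on {1..n} P. y ^ card P * of_real (\<Prod>B\<in>P. r ^ (card B choose 2))) = cluster_poly r n y"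
proof -
  have "cluster_poly r n y = partition_sum (\<lambda>k. y * of_real (r ^ (k choose 2))) {1..n}"
    by (subst partition_sum_cluster_poly) auto
  then show ?thesis by (simp add: partition_sum_def prod.distrib)
qed

lemma (in cluster_weights) mgf_clusters:
  assumes p: "0 < p" "p < 1" and rp: "r = p / (1 - p)"
  shows "measure_pmf.expectation (random_cluster_graph n p) (\<lambda>E. exp (s * of_real (num_clusters n E))) =
    cluster_poly r n (exp s) / cluster_poly r n 1"
proof -
  have "of_real (partition_sum (\<lambda>k. r ^ (k choose 2)) {1..n}) = cluster_poly r n 1"
    by (subst sum_partitions_power[symmetric]) (simp add: partition_sum_def)
  moreover have "(\<Sum>P | partition_on {1..n} P. (\<Prod>B\<in>P. r ^ (card B choose 2)) *\<^sub>R exp (s * of_real (real (card P)))) = cluster_poly r n (exp s)"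
    by (subst sum_partitions_power[symmetric])
      (simp add: scaleR_conv_of_real mult.commute flip: exp_of_nat_mult)
  ultimately show ?thesis
    using expectation_random_cluster_graph[OF p, of n "\<lambda>c. exp (s * of_real c)"]
    unfolding rp[symmetric] by (simp add: scaleR_conv_of_real divide_inverse mult.commute)
qed

context cluster_weights
begin

context
  fixes p :: real
  assumes p: "0 < p" "p < 1" and rp: "r = p / (1 - p)"
begin

text \<open>Scaled by the mean and residual variance of the Poisson model; the mean and variance of
  the clusters themselves become accessible only through the limit.\<close>

definition clusters_scaled :: "nat \<Rightarrow> nat set set \<Rightarrow> real" where
  "clusters_scaled n E = (num_clusters n E - block_moment r 0 (saddle n)) / sqrt (block_var (saddle n))"

lemma finite_set_random_cluster_graph: "finite (set_pmf (random_cluster_graph n p))"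
  using set_random_cluster_graph[OF p] finite_cluster_graphs by (rule finite_subset)

lemma clusters_scaled_mgf:
  "(\<lambda>n. measure_pmf.expectation (random_cluster_graph n p) (\<lambda>E. exp (s * of_real (clusters_scaled n E))))
    \<longlonglongrightarrow> exp (s\<^sup>2 / 2)"
  for s :: complex
proof -
  have "measure_pmf.expectation (random_cluster_graph n p) (\<lambda>E. exp (s * of_real (clusters_scaled n E))) =
    exp (- (s * of_real (block_moment r 0 (saddle n) / sqrt (block_var (saddle n))))) *
      cluster_poly r n (exp (s / of_real (sqrt (block_var (saddle n))))) / cluster_poly r n 1" for n
  proof -
    let ?\<sigma> = "sqrt (block_var (saddle n))" and ?W = "block_moment r 0 (saddle n)"
    have "exp (s * of_real (clusters_scaled n E)) =
        exp (- (s * of_real (?W / ?\<sigma>))) * exp (s / of_real ?\<sigma> * of_real (num_clusters n E))" for E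
      unfolding exp_add[symmetric] clusters_scaled_def by (simp add: diff_divide_distrib algebra_simps)
    then show ?thesis by (simp only: integral_mult_right_zero mgf_clusters[OF p rp] times_divide_eq_right)
  qed
  then show ?thesis using cluster_poly_mgf_tendsto by simp
qed

lemma eventually_saddle_large_n: "\<forall>\<^sub>F n in sequentially. saddle_large (saddle n)"
  using filterlim_saddle eventually_saddle_large by (auto simp: filterlim_iff)

lemma scaled_mean:
  "measure_pmf.expectation (random_cluster_graph n p) (clusters_scaled n) =
    (mean_clusters n p - block_moment r 0 (saddle n)) / sqrt (block_var (saddle n))"
proof -
  have "integrable (measure_pmf (random_cluster_graph n p)) (num_clusters n)"
    by (rule integrable_measure_pmf_finite[OF finite_set_random_cluster_graph])
  then show ?thesis unfolding clusters_scaled_def mean_clusters_def by simp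
qed

lemma scaled_variance:
  "measure_pmf.variance (random_cluster_graph n p) (clusters_scaled n) =
    var_clusters n p / (sqrt (block_var (saddle n)))\<^sup>2"
proof -
  have "(clusters_scaled n E - measure_pmf.expectation (random_cluster_graph n p) (clusters_scaled n))\<^sup>2 =
     (num_clusters n E - mean_clusters n p)\<^sup>2 / (sqrt (block_var (saddle n)))\<^sup>2" for E
    unfolding scaled_mean unfolding clusters_scaled_def
    by (simp add: diff_divide_distrib[symmetric] power_divide)
  then show ?thesis unfolding var_clusters_def mean_clusters_def by simp
qed

lemma var_clusters_asymp: "(\<lambda>n. var_clusters n p) \<sim>[at_top] (\<lambda>n. block_var (saddle n))"
proof (rule asymp_equivI')
  have "(\<lambda>n. var_clusters n p / (sqrt (block_var (saddle n)))\<^sup>2) \<longlonglongrightarrow> 1"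
    using variance_tendsto[OF finite_set_random_cluster_graph clusters_scaled_mgf] unfolding scaled_variance .
  moreover have "\<forall>\<^sub>F n in sequentially. var_clusters n p / (sqrt (block_var (saddle n)))\<^sup>2 = var_clusters n p / block_var (saddle n)"
    using eventually_saddle_large_n by eventually_elim (use large_V_pos in \<open>simp add: less_imp_le\<close>)
  ultimately show "(\<lambda>n. var_clusters n p / block_var (saddle n)) \<longlonglongrightarrow> 1"
    by (rule Lim_transform_eventually)
qed

text \<open>The mean differs from \<open>W\<close> by \<open>o(sqrt block_var)\<close>, and
  \<open>block_var \<le> W \<le> W^2\<close>.\<close>

lemma mean_clusters_asymp: "(\<lambda>n. mean_clusters n p) \<sim>[at_top] (\<lambda>n. block_moment r 0 (saddle n))"
proof (rule asymp_equivI')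
  let ?W = "\<lambda>n. block_moment r 0 (saddle n)" and ?\<sigma> = "\<lambda>n. sqrt (block_var (saddle n))"
  let ?m = "\<lambda>n. (mean_clusters n p - ?W n) / ?\<sigma> n"
  have m: "?m \<longlonglongrightarrow> 0"
    using mean_tendsto[OF finite_set_random_cluster_graph clusters_scaled_mgf] unfolding scaled_mean .
  have ev: "\<forall>\<^sub>F n in sequentially. 0 < ?\<sigma> n \<and> ?\<sigma> n \<le> ?W n \<and> 0 < ?W n"
    using eventually_saddle_large_n
  proof eventually_elim
    case (elim n)
    have W: "1 \<le> ?W n" by (rule large_W[OF elim])
    have "0 \<le> (block_moment r 1 (saddle n))\<^sup>2 / block_moment r 2 (saddle n)"
      using block_moment_pos[of "saddle n" 2] large_x[OF elim] by (intro divide_nonneg_nonneg) auto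
    then have "block_var (saddle n) \<le> ?W n" by (simp add: block_var_def)
    also have "\<dots> \<le> (?W n)\<^sup>2" using W by (simp add: power2_eq_square)
    finally have "?\<sigma> n \<le> ?W n" using W by (intro real_le_lsqrt) auto
    then show ?case using W large_V_pos[OF elim] by auto
  qed
  have "(\<lambda>n. ?m n * (?\<sigma> n / ?W n)) \<longlonglongrightarrow> 0"
  proof (rule Lim_null_comparison)
    show "(\<lambda>n. \<bar>?m n\<bar>) \<longlonglongrightarrow> 0" using m by (rule tendsto_rabs_zero)
    show "\<forall>\<^sub>F n in sequentially. norm (?m n * (?\<sigma> n / ?W n)) \<le> \<bar>?m n\<bar>"
      using ev
    proof eventually_elim
      case (elim n)
      then have "\<bar>?m n\<bar> * (?\<sigma> n / ?W n) \<le> \<bar>?m n\<bar> * 1" by (intro mult_left_mono) auto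
      then show ?case using elim by (simp add: abs_mult)
    qed
  qed
  from tendsto_add[OF this tendsto_const[of 1]]
  have "(\<lambda>n. ?m n * (?\<sigma> n / ?W n) + 1) \<longlonglongrightarrow> 1" by simp
  moreover have "\<forall>\<^sub>F n in sequentially. ?m n * (?\<sigma> n / ?W n) + 1 = mean_clusters n p / ?W n"
    using ev by eventually_elim (simp add: field_simps)
  ultimately show "(\<lambda>n. mean_clusters n p / ?W n) \<longlonglongrightarrow> 1" by (rule Lim_transform_eventually)
qed

text \<open>Standardising undoes the affine map in \<open>clusters_scaled\<close> as soon as its
  scale is positive, hence for large \<open>n\<close>.\<close>

lemma standardised_clusters_weak_conv:
  "weak_conv_m (\<lambda>n. standardised_clusters n p) std_normal_distribution"
proof -
  let ?M = "\<lambda>n. random_cluster_graph n p" and ?X = "clusters_scaled"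
  let ?D = "\<lambda>n. distr (measure_pmf (?M n)) borel
      (\<lambda>\<omega>. (?X n \<omega> - measure_pmf.expectation (?M n) (?X n)) / sqrt (measure_pmf.variance (?M n) (?X n)))"
  have conv: "weak_conv_m ?D std_normal_distribution"
    by (rule weak_conv_standardised[OF finite_set_random_cluster_graph clusters_scaled_mgf])
  have "\<forall>\<^sub>F n in sequentially. ?D n = standardised_clusters n p"
    using eventually_saddle_large_n
  proof eventually_elim
    case (elim n)
    let ?\<sigma> = "sqrt (block_var (saddle n))"
    have \<sigma>: "0 < ?\<sigma>" using large_V_pos[OF elim] by simp
    have "(?X n E - measure_pmf.expectation (?M n) (?X n)) / sqrt (measure_pmf.variance (?M n) (?X n)) =
      (num_clusters n E - mean_clusters n p) / sqrt (var_clusters n p)" for E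
    proof -
      have "?X n E - measure_pmf.expectation (?M n) (?X n) = (num_clusters n E - mean_clusters n p) / ?\<sigma>"
        unfolding scaled_mean unfolding clusters_scaled_def by (simp add: diff_divide_distrib)
      moreover have "sqrt (measure_pmf.variance (?M n) (?X n)) = sqrt (var_clusters n p) / ?\<sigma>"
        unfolding scaled_variance using \<sigma> by (simp add: real_sqrt_divide)
      ultimately show ?thesis using \<sigma> by simp
    qed
    then show ?case by (simp add: standardised_clusters_def)
  qed
  then have "\<forall>\<^sub>F n in sequentially. cdf (?D n) y = cdf (standardised_clusters n p) y" for y
    by (rule eventually_mono) simp
  note eq = this
  show ?thesis unfolding weak_conv_m_def weak_conv_def
  proof (intro allI impI)
    fix y assume "isCont (cdf std_normal_distribution) y"
    then have "(\<lambda>n. cdf (?D n) y) \<longlonglongrightarrow> cdf std_normal_distribution y"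
      using conv by (simp add: weak_conv_m_def weak_conv_def)
    from Lim_transform_eventually[OF this eq]
    show "(\<lambda>n. cdf (standardised_clusters n p) y) \<longlonglongrightarrow> cdf std_normal_distribution y" .
  qed
qed

end
end

section \<open>The case \<open>r > 1\<close>\<close>

lemma cluster_graph_complete:
  assumes "0 < n"
  shows "cluster_graph n (complete_graph_edges n)" "num_clusters n (complete_graph_edges n) = 1"
    "card (complete_graph_edges n) = n choose 2"
proof -
  have P: "partition_on {1..n} {{1..n}}" using assms by (intro partition_on_space) auto
  have eq: "complete_graph_edges n = cliques {{1..n}}" by (auto simp: complete_graph_edges_def cliques_def)
  show "cluster_graph n (complete_graph_edges n)" unfolding eq by (rule cluster_graph_cliques[OF P])
  show "num_clusters n (complete_graph_edges n) = 1"
    unfolding eq num_clusters_def graph_components_cliques[OF P] by simp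
  show "card (complete_graph_edges n) = n choose 2"
    unfolding complete_graph_edges_def by (subst n_subsets) auto
qed

lemma choose_two_add: "(a + b) choose 2 = (a choose 2) + (b choose 2) + a * b"
  by (induction b) (simp_all add: numeral_2_eq_2)

lemma binomial_le_power: "n choose k \<le> n ^ min k (n - k)"
proof (cases "k \<le> n")
  case True
  then show ?thesis using binomial_le_pow[of k n] binomial_le_pow[of "n - k" n] binomial_symmetric[OF True]
    by (auto simp: min_def)
qed (simp add: binomial_eq_0)

text \<open>The normalising sum as a function of the number of vertices, as
  \<open>partition_sum_cluster_total\<close> shows. It is defined by recursion and not through
  \<open>W\<close>, whose series diverges at every nonzero point when \<open>r > 1\<close>.\<close>

fun cluster_total :: "real \<Rightarrow> nat \<Rightarrow> real" where
  "cluster_total r 0 = 1"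
| "cluster_total r (Suc n) = (\<Sum>k\<le>n. real (n choose k) * (r ^ (Suc k choose 2) * cluster_total r (n - k)))"

lemma partition_sum_cluster_total:
  "finite A \<Longrightarrow> partition_sum (\<lambda>k. r ^ (k choose 2)) A = cluster_total r (card A)"
  by (rule partition_sum_card) auto

context
  fixes r :: real
  assumes r: "1 < r"
begin

text \<open>For \<open>n > 0\<close> the reciprocal of the probability of the complete
  graph.\<close>

definition rel_total :: "nat \<Rightarrow> real" where
  "rel_total n = cluster_total r n / r ^ (n choose 2)"

text \<open>The exponent arises from \<open>(n + 1 choose 2) - (k + 1 choose 2) - (n - k choose 2) = (k + 1) (n - k)\<close>.\<close>

definition rel_error :: "nat \<Rightarrow> real" where
  "rel_error n = (\<Sum>k<n. real (n choose k) / r ^ (Suc k * (n - k)))"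

lemma rel_total_Suc:
  "rel_total (Suc n) = 1 + (\<Sum>k<n. real (n choose k) / r ^ (Suc k * (n - k)) * rel_total (n - k))"
proof -
  have "rel_total (Suc n) = (\<Sum>k\<le>n. real (n choose k) * (r ^ (Suc k choose 2) * cluster_total r (n - k)) / r ^ (Suc n choose 2))"
    by (simp add: rel_total_def sum_divide_distrib)
  also have "\<dots> = (\<Sum>k\<le>n. real (n choose k) / r ^ (Suc k * (n - k)) * rel_total (n - k))"
  proof (intro sum.cong refl)
    fix k assume "k \<in> {..n}"
    then have "Suc n choose 2 = (Suc k choose 2) + ((n - k) choose 2) + Suc k * (n - k)"
      using choose_two_add[of "Suc k" "n - k"] by simp
    then show "real (n choose k) * (r ^ (Suc k choose 2) * cluster_total r (n - k)) / r ^ (Suc n choose 2) =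
      real (n choose k) / r ^ (Suc k * (n - k)) * rel_total (n - k)"
      using r by (simp only: rel_total_def power_add) (simp add: field_simps)
  qed
  \<comment> \<open>The term \<open>k = n\<close>, where the block of the chosen element is
    everything, equals 1.\<close>
  also have "\<dots> = (\<Sum>k<n. real (n choose k) / r ^ (Suc k * (n - k)) * rel_total (n - k)) + 1"
    by (simp add: rel_total_def numeral_2_eq_2 flip: lessThan_Suc_atMost)
  finally show ?thesis by simp
qed

lemma rel_total_ge_1: "0 \<le> rel_total n" "0 < n \<Longrightarrow> 1 \<le> rel_total n"
proof -
  have nonneg: "0 \<le> rel_total n" for n
  proof (induction n rule: less_induct)
    case (less n)
    show ?case
    proof (cases n)
      case 0
      then show ?thesis by (simp add: rel_total_def numeral_2_eq_2)
    next
      case (Suc m)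
      then show ?thesis unfolding Suc rel_total_Suc
        using less.IH[unfolded Suc] r
        by (intro add_nonneg_nonneg sum_nonneg mult_nonneg_nonneg) (auto simp: less_Suc_eq_le)
    qed
  qed
  then show "0 \<le> rel_total n" .
  show "1 \<le> rel_total n" if n: "0 < n"
  proof -
    obtain m where "n = Suc m" using n by (cases n) auto
    then show ?thesis using rel_total_Suc[of m] nonneg r
      by (auto intro!: sum_nonneg mult_nonneg_nonneg)
  qed
qed

text \<open>With \<open>b\<close> the smaller and \<open>m\<close> the larger of
  \<open>k + 1\<close> and \<open>n - k\<close>, the binomial is at most \<open>n ^ b\<close> and
  the exponent is \<open>m * b\<close> with \<open>n \<le> 2 * m\<close>. So each term is at most
  the \<open>b\<close>-th power of \<open>n * r powr (- n / 2)\<close>, and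
  \<open>b \<ge> 1\<close>.\<close>

lemma rel_error_tendsto: "rel_error \<longlonglongrightarrow> 0"
proof (rule Lim_null_comparison)
  let ?d = "\<lambda>n::nat. real n * r powr (- (real n / 2))"
  have d: "?d \<longlonglongrightarrow> 0" using r by real_asymp
  show "(\<lambda>n. real n * ?d n) \<longlonglongrightarrow> 0" using r by real_asymp
  have "\<forall>\<^sub>F n in sequentially. ?d n < 1" using d by (rule order_tendstoD) simp
  then show "\<forall>\<^sub>F n in sequentially. norm (rel_error n) \<le> real n * ?d n"
    using eventually_gt_at_top[of 0]
  proof eventually_elim
    case (elim n)
    have le: "real (n choose k) / r ^ (Suc k * (n - k)) \<le> ?d n" if k: "k < n" for k
    proof -
      define b where "b = min (Suc k) (n - k)"
      define m where "m = max (Suc k) (n - k)"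
      have b: "1 \<le> b" and bm: "Suc k * (n - k) = m * b"
        using k by (auto simp: b_def m_def min_def max_def mult.commute)
      have "real (n choose k) \<le> real n ^ min k (n - k)"
        using binomial_le_power[of n k] by (simp flip: of_nat_power)
      also have "\<dots> \<le> real n ^ b"
        using elim by (intro power_increasing) (auto simp: b_def)
      finally have num: "real (n choose k) \<le> real n ^ b" .
      have "n \<le> 2 * m" by (auto simp: m_def max_def)
      then have "real n / 2 \<le> real m" by linarith
      then have "r powr (real n / 2) \<le> r ^ m"
        using r by (simp flip: powr_realpow)
      then have "(r powr (real n / 2)) ^ b \<le> (r ^ m) ^ b" using r by (intro power_mono) auto
      then have den: "(r powr (real n / 2)) ^ b \<le> r ^ (Suc k * (n - k))"
        unfolding bm by (simp only: power_mult)
      have "real (n choose k) / r ^ (Suc k * (n - k)) \<le> real n ^ b / (r powr (real n / 2)) ^ b"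
        using num den r by (intro frac_le) auto
      also have "\<dots> = ?d n ^ b"
        unfolding powr_minus_divide by (simp add: power_divide)
      also have "\<dots> \<le> ?d n ^ 1" using b elim by (intro power_decreasing) auto
      finally show ?thesis by simp
    qed
    have "rel_error n \<le> (\<Sum>k<n. ?d n)" unfolding rel_error_def by (rule sum_mono) (use le in auto)
    moreover have "0 \<le> rel_error n" unfolding rel_error_def using r by (intro sum_nonneg) auto
    ultimately show ?case by simp
  qed
qed

lemma rel_total_Suc_le:
  assumes "\<And>m. m \<le> n \<Longrightarrow> rel_total m \<le> M"
  shows "rel_total (Suc n) \<le> 1 + rel_error n * M"
  unfolding rel_total_Suc rel_error_def sum_distrib_right
  using assms r by (intro add_left_mono sum_mono mult_left_mono) auto

text \<open>Once \<open>rel_error\<close> is below 1/2, any bound \<open>M \<ge> 2\<close> for the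
  earlier values reproduces itself, as \<open>1 + M / 2 \<le> M\<close>.\<close>

lemma rel_total_bounded: obtains M where "\<And>n. rel_total n \<le> M"
proof -
  have "\<forall>\<^sub>F n in sequentially. rel_error n < 1 / 2" using rel_error_tendsto by (rule order_tendstoD) simp
  then obtain N where N: "rel_error n < 1 / 2" if "N \<le> n" for n
    unfolding eventually_sequentially by blast
  define M where "M = 2 + (\<Sum>i\<le>N. rel_total i)"
  have M: "2 \<le> M" unfolding M_def using rel_total_ge_1(1) by (auto intro!: sum_nonneg)
  have "rel_total n \<le> M" for n
  proof (induction n rule: less_induct)
    case (less n)
    show ?case
    proof (cases "n \<le> N")
      case True
      then have "rel_total n \<le> (\<Sum>i\<le>N. rel_total i)"
        using rel_total_ge_1(1) by (intro member_le_sum) auto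
      then show ?thesis by (simp add: M_def)
    next
      case False
      then obtain m where m: "n = Suc m" "N \<le> m" by (cases n) auto
      have "rel_total (Suc m) \<le> 1 + rel_error m * M"
        using less.IH m by (intro rel_total_Suc_le) auto
      also have "rel_error m * M \<le> 1 / 2 * M" using N[OF m(2)] M by (intro mult_right_mono) auto
      finally show ?thesis using M m by simp
    qed
  qed
  then show ?thesis using that by blast
qed

lemma rel_total_tendsto: "rel_total \<longlonglongrightarrow> 1"
proof -
  obtain M where M: "\<And>n. rel_total n \<le> M" using rel_total_bounded by blast
  have "(\<lambda>n. rel_total (Suc n)) \<longlonglongrightarrow> 1"
  proof (rule tendsto_sandwich)
    show "\<forall>\<^sub>F n in sequentially. 1 \<le> rel_total (Suc n)" using rel_total_ge_1(2) by auto
    show "\<forall>\<^sub>F n in sequentially. rel_total (Suc n) \<le> 1 + rel_error n * M" using rel_total_Suc_le M by auto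
    show "(\<lambda>n. 1 + rel_error n * M) \<longlonglongrightarrow> 1"
      using tendsto_add[OF tendsto_const tendsto_mult[OF rel_error_tendsto tendsto_const[of M]], of 1] by simp
  qed simp
  then show ?thesis by (simp only: filterlim_sequentially_Suc)
qed

end

lemma prob_complete_tendsto:
  assumes p: "1 / 2 < p" "p < 1"
  shows "(\<lambda>n. measure_pmf.prob (random_cluster_graph n p) {complete_graph_edges n}) \<longlonglongrightarrow> 1"
    "(\<lambda>n. measure_pmf.prob (random_cluster_graph n p) {E. num_clusters n E = 1}) \<longlonglongrightarrow> 1"
proof -
  let ?r = "p / (1 - p)"
  have r: "1 < ?r" using p by (simp add: field_simps)
  have p': "0 < p" using p by simp
  have eq: "measure_pmf.prob (random_cluster_graph n p) {complete_graph_edges n} = inverse (rel_total ?r n)"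
    if "0 < n" for n
  proof -
    have "measure_pmf.prob (random_cluster_graph n p) {complete_graph_edges n} = pmf (random_cluster_graph n p) (complete_graph_edges n)"
      by (simp add: measure_pmf_single)
    also have "\<dots> = ?r ^ (n choose 2) / cluster_total ?r n"
      using prob_cluster_graph(2)[OF p' p(2) cluster_graph_complete(1)[OF that]]
      by (simp add: cluster_graph_complete(3)[OF that] partition_sum_cluster_total)
    finally show ?thesis unfolding rel_total_def[OF r] by (simp add: inverse_divide)
  qed
  have "(\<lambda>n. inverse (rel_total ?r n)) \<longlonglongrightarrow> inverse 1"
    by (intro tendsto_inverse rel_total_tendsto[OF r]) simp
  moreover have "\<forall>\<^sub>F n in sequentially. inverse (rel_total ?r n) = measure_pmf.prob (random_cluster_graph n p) {complete_graph_edges n}"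
    using eventually_gt_at_top[of 0] by eventually_elim (simp only: eq)
  ultimately show 1: "(\<lambda>n. measure_pmf.prob (random_cluster_graph n p) {complete_graph_edges n}) \<longlonglongrightarrow> 1"
    using Lim_transform_eventually by fastforce
  show "(\<lambda>n. measure_pmf.prob (random_cluster_graph n p) {E. num_clusters n E = 1}) \<longlonglongrightarrow> 1"
  proof (rule tendsto_sandwich[OF _ _ 1 tendsto_const])
    show "\<forall>\<^sub>F n in sequentially. measure_pmf.prob (random_cluster_graph n p) {complete_graph_edges n} \<le>
        measure_pmf.prob (random_cluster_graph n p) {E. num_clusters n E = 1}"
      using eventually_gt_at_top[of 0]
      by eventually_elim (auto intro!: measure_pmf.finite_measure_mono simp: cluster_graph_complete)
    show "\<forall>\<^sub>F n in sequentially. measure_pmf.prob (random_cluster_graph n p) {E. num_clusters n E = 1} \<le> 1"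
      by simp
  qed
qed

section \<open>The case \<open>r = 1\<close>\<close>

text \<open>Each moment arises from the previous one by \<open>x d/dx\<close>; in the series this is
  an index shift, as \<open>k / k! = 1 / (k - 1)!\<close>.\<close>

lemma block_moment_exp:
  "block_moment 1 0 x = exp x - 1" "block_moment 1 1 x = x * exp x" "block_moment 1 2 x = (x\<^sup>2 + x) * exp x"
proof -
  have e: "(\<lambda>k. x ^ k / fact k) sums exp x" using exp_converges[of x] by (simp add: divide_inverse mult.commute)
  have "(\<lambda>k. block_weight 1 x (Suc k)) sums (exp x - 1)"
    using sums_Suc_iff[of "\<lambda>k. x ^ k / fact k" "exp x - 1"] e by (simp add: block_weight_def)
  then have "block_weight 1 x sums (exp x - 1)"
    using sums_Suc_iff[of "block_weight 1 x" "exp x - 1"] by (simp add: block_weight_def)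
  then show "block_moment 1 0 x = exp x - 1" by (simp add: block_moment_def sums_iff)
  have 1: "(\<lambda>k. real k * (x ^ k / fact k)) sums (x * exp x)"
  proof -
    have "(\<lambda>k. real (Suc k) * (x ^ Suc k / fact (Suc k))) sums (x * exp x)"
      using sums_mult[OF e, of x] by (simp add: field_simps del: of_nat_Suc)
    then show ?thesis by (subst (asm) sums_Suc_iff) simp
  qed
  have w: "real k ^ Suc j * block_weight 1 x k = real k ^ j * (real k * (x ^ k / fact k))" for k j
    by (simp add: block_weight_def)
  show "block_moment 1 1 x = x * exp x"
    using 1 w[of _ 0] by (simp add: block_moment_def sums_iff)
  have 2: "(\<lambda>k. real k * (real k * (x ^ k / fact k))) sums (x * (x * exp x + exp x))"
  proof -
    have "(\<lambda>k. real (Suc k) * (real (Suc k) * (x ^ Suc k / fact (Suc k)))) sums (x * (x * exp x + exp x))"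
    proof -
      have "real (Suc k) * (x ^ Suc k / fact (Suc k)) = x * (x ^ k / fact k)" for k
        by (simp add: field_simps del: of_nat_Suc)
      then have "real (Suc k) * (real (Suc k) * (x ^ Suc k / fact (Suc k))) = x * (real k * (x ^ k / fact k) + x ^ k / fact k)" for k
        by (simp only:) (simp add: algebra_simps add_divide_distrib)
      then show ?thesis using sums_mult[OF sums_add[OF 1 e], of x] by (simp only:)
    qed
    then show ?thesis by (subst (asm) sums_Suc_iff) simp
  qed
  then show "block_moment 1 2 x = (x\<^sup>2 + x) * exp x"
    using w[of _ 1] by (simp add: block_moment_def sums_iff numeral_2_eq_2 power2_eq_square algebra_simps)
qed

interpretation unit: cluster_weights 1 by unfold_locales auto

text \<open>With \<open>n = x exp x\<close> everything becomes a limit in \<open>x\<close>. In the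
  residual variance the leading terms cancel: it equals \<open>exp x / (x + 1) - 1\<close>, so it is
  of order \<open>W / x\<close>.\<close>

lemma saddle_unit_asymp:
  "(\<lambda>n. block_moment 1 0 (unit.saddle n)) \<sim>[at_top] (\<lambda>n. real n / ln (real n))"
  "(\<lambda>n. unit.block_var (unit.saddle n)) \<sim>[at_top] (\<lambda>n. real n / (ln (real n))\<^sup>2)"
proof -
  have n: "\<forall>\<^sub>F n in sequentially. unit.saddle n * exp (unit.saddle n) = real n"
    using eventually_gt_at_top[of 0] by eventually_elim (rule unit.saddle(2)[unfolded block_moment_exp(2)])
  have "((\<lambda>x::real. (exp x - 1) / (x * exp x / ln (x * exp x))) \<longlongrightarrow> 1) at_top" by real_asymp
  from filterlim_compose[OF this unit.filterlim_saddle]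
  show "(\<lambda>n. block_moment 1 0 (unit.saddle n)) \<sim>[at_top] (\<lambda>n. real n / ln (real n))"
    by (intro asymp_equivI', elim Lim_transform_eventually, use n in eventually_elim) (simp add: block_moment_exp)
  have "((\<lambda>x::real. (exp x - 1 - (x * exp x)\<^sup>2 / ((x\<^sup>2 + x) * exp x)) / (x * exp x / (ln (x * exp x))\<^sup>2)) \<longlongrightarrow> 1) at_top"
    by real_asymp
  from filterlim_compose[OF this unit.filterlim_saddle]
  show "(\<lambda>n. unit.block_var (unit.saddle n)) \<sim>[at_top] (\<lambda>n. real n / (ln (real n))\<^sup>2)"
    by (intro asymp_equivI', elim Lim_transform_eventually, use n in eventually_elim)
      (simp add: block_moment_exp unit.block_var_def del: One_nat_def)
qed

section \<open>The case \<open>r < 1\<close>\<close>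

lemma summable_power_choose_two:
  fixes r :: real
  assumes r: "0 < r" "r < 1"
  shows "summable (\<lambda>i. real i ^ m * r ^ (i choose 2))"
proof -
  have "(\<lambda>n. 2 ^ m * r ^ n) \<longlonglongrightarrow> 2 ^ m * 0" using r by (intro tendsto_mult tendsto_const LIMSEQ_power_zero) auto
  then have "\<forall>\<^sub>F n in sequentially. 2 ^ m * r ^ n < 1 / 2" by (rule order_tendstoD) simp
  then have "\<forall>\<^sub>F n in sequentially. 2 ^ m * r ^ n < 1 / 2 \<and> 1 \<le> n"
    by (intro eventually_conj eventually_ge_at_top)
  then obtain N where N: "2 ^ m * r ^ n < 1 / 2 \<and> 1 \<le> n" if "N \<le> n" for n
    unfolding eventually_sequentially by blast
  show ?thesis
  proof (rule summable_ratio_test[where c = "1/2" and N = N])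
    fix n assume n: "N \<le> n"
    have "real (Suc n) ^ m \<le> (2 * real n) ^ m" using N[OF n] by (intro power_mono) auto
    then have "real (Suc n) ^ m * r ^ n \<le> (2 * real n) ^ m * r ^ n" using r by (intro mult_right_mono) auto
    also have "\<dots> = (2 ^ m * r ^ n) * real n ^ m" by (simp add: power_mult_distrib)
    also have "\<dots> \<le> 1 / 2 * real n ^ m" using N[OF n] by (intro mult_right_mono) auto
    finally have "(real (Suc n) ^ m * r ^ n) * r ^ (n choose 2) \<le> (1 / 2 * real n ^ m) * r ^ (n choose 2)"
      using r by (intro mult_right_mono) auto
    then show "norm (real (Suc n) ^ m * r ^ (Suc n choose 2)) \<le> 1 / 2 * norm (real n ^ m * r ^ (n choose 2))"
      using r by (simp add: numeral_2_eq_2 power_add abs_mult mult_ac)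
  qed simp
qed

locale small_cluster_weights = cluster_weights +
  assumes r_less_1: "r < 1"
begin

text \<open>Sum of the decay bounds on both sides of the mode, whence the factor 2; it bounds the
  \<open>m\<close>-th absolute moment about the mode in units of the modal weight, uniformly in
  \<open>x\<close>.\<close>

definition mode_const :: "nat \<Rightarrow> real" where
  "mode_const m = 2 * (\<Sum>i. real i ^ m * r ^ (i choose 2))"

lemma mode_const_pos: "0 < mode_const m"
  unfolding mode_const_def using r r_less_1
  by (intro mult_pos_pos suminf_pos2[where i = 1] summable_power_choose_two) (auto simp: numeral_2_eq_2)

context
  fixes x :: real
  assumes x: "2 < r * x"
begin

text \<open>For \<open>r < 1\<close> the factors \<open>r ^ (j choose 2)\<close> on either side of
  the mode decay like a Gaussian and do not depend on \<open>x\<close>, so the spread of the block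
  sizes about the mode stays bounded.\<close>

lemma mode_concentration:
  "summable (\<lambda>j. \<bar>real j - real (block_mode x)\<bar> ^ m * block_weight r x j)"
  "(\<Sum>j. \<bar>real j - real (block_mode x)\<bar> ^ m * block_weight r x j) \<le> mode_const m * block_weight r x (block_mode x)"
proof -
  let ?k = "block_mode x" and ?p = "block_weight r x"
  let ?f = "\<lambda>j. \<bar>real j - real ?k\<bar> ^ m * ?p j"
  let ?g = "\<lambda>i. real i ^ m * r ^ (i choose 2)"
  have x0: "0 \<le> x" using mode_x_pos[OF x] by simp
  have sg: "summable ?g" using r r_less_1 by (intro summable_power_choose_two)
  have g0: "0 \<le> ?g i" for i using r by simp
  have up: "?f (i + ?k) \<le> ?g i * ?p ?k" for i
    using mult_left_mono[OF block_weight_mode_add[OF x, of i], of "real i ^ m"] by (simp add: add.commute mult.assoc)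
  have f0: "0 \<le> ?f j" for j using x0 by (intro mult_nonneg_nonneg block_weight_nonneg) auto
  have "norm (?f (i + ?k)) \<le> ?g i * ?p ?k" for i
    using up[of i] f0[of "i + ?k"] by (simp only: real_norm_def abs_of_nonneg)
  then have s1: "summable (\<lambda>i. ?f (i + ?k))"
    by (rule summable_comparison_test'[OF summable_mult2[OF sg, of "?p ?k"], of 0])
  then show s: "summable ?f" by (subst (asm) summable_iff_shift)
  have "suminf ?f = (\<Sum>i. ?f (i + ?k)) + (\<Sum>j<?k. ?f j)" by (rule suminf_split_initial_segment[OF s])
  also have "(\<Sum>i. ?f (i + ?k)) \<le> (\<Sum>i. ?g i * ?p ?k)"
    by (intro suminf_le up s1 summable_mult2 sg)
  also have "\<dots> = suminf ?g * ?p ?k" by (rule suminf_mult2[OF sg, symmetric])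
  also have "(\<Sum>j<?k. ?f j) \<le> suminf ?g * ?p ?k"
  proof -
    have "(\<Sum>j<?k. ?f j) = (\<Sum>i<?k. ?f (?k - Suc i))" by (rule sum.nat_diff_reindex[symmetric])
    also have "\<dots> \<le> (\<Sum>i<?k. ?g (Suc i) * ?p ?k)"
    proof (rule sum_mono)
      fix i assume i: "i \<in> {..<?k}"
      have a: "\<bar>real (?k - Suc i) - real ?k\<bar> = real (Suc i)" using i by (auto simp: of_nat_diff)
      have "?p (?k - Suc i) \<le> r ^ (Suc i choose 2) * ?p ?k"
      \<comment> \<open>In this case the size is 0, where the weight vanishes;
        \<open>block_weight_mode_diff\<close> covers only positive sizes.\<close>
      proof (cases "Suc i = ?k")
        case True
        then show ?thesis using r x0 block_weight_nonneg[of x ?k] by (simp add: block_weight_def)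
      next
        case False
        then show ?thesis using i by (intro block_weight_mode_diff[OF x]) auto
      qed
      then show "?f (?k - Suc i) \<le> ?g (Suc i) * ?p ?k"
        unfolding a mult.assoc by (intro mult_left_mono) auto
    qed
    also have "\<dots> = (\<Sum>i\<in>Suc ` {..<?k}. ?g i) * ?p ?k"
      by (simp add: sum.reindex sum_distrib_right)
    also have "\<dots> \<le> suminf ?g * ?p ?k"
      using x0 g0 by (intro mult_right_mono sum_le_suminf sg block_weight_nonneg) auto
    finally show ?thesis .
  qed
  finally show "suminf ?f \<le> mode_const m * ?p ?k" by (simp add: mode_const_def algebra_simps)
qed

lemma block_moment_0_le_mode_const: "block_moment r 0 x \<le> mode_const 0 * block_weight r x (block_mode x)"
  using mode_concentration(2)[of 0] by (simp add: block_moment_def)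

end

context
  fixes x :: real
  assumes large: "saddle_large x"
begin

text \<open>This and \<open>block_size_var\<close> are the mean and variance of a block size drawn
  with probability \<open>block_weight r x k / block_moment r 0 x\<close>.\<close>

definition block_mean :: real where "block_mean = block_moment r 1 x / block_moment r 0 x"
definition block_size_var :: real where
  "block_size_var = block_moment r 2 x / block_moment r 0 x - block_mean\<^sup>2"

text \<open>The second moment about the mode is the variance plus the squared distance from mean to
  mode, so \<open>mode_concentration\<close> bounds both. The lower bound holds because the mode and
  its successor each carry a fixed share of the total weight.\<close>

lemma size_facts:
  "\<bar>block_mean - real (block_mode x)\<bar> \<le> sqrt (mode_const 2)"
  "block_size_var \<le> mode_const 2"
  "r / (8 * (mode_const 0 + 1)) \<le> block_size_var"
  "block_var x = block_moment r 0 x * block_size_var / (block_size_var + block_mean\<^sup>2)"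
proof -
  let ?W = "block_moment r 0 x" and ?k = "block_mode x" and ?p = "block_weight r x (block_mode x)"
  have W: "0 < ?W" and x: "0 < x" using large_W[OF large] large_x[OF large] by auto
  note lr = large_r[OF large]
  have p: "0 \<le> ?p" "?p \<le> ?W" using x by (auto intro: block_weight_nonneg block_weight_le_moment_0)
  have "block_moment r 2 x - 2 * real ?k * block_moment r 1 x + (real ?k)\<^sup>2 * ?W \<le> mode_const 2 * ?p"
    using mode_concentration(2)[OF lr, of 2] block_moment_var[OF x, of "real ?k"] by (simp add: sums_iff)
  also have "\<dots> \<le> mode_const 2 * ?W" using p mode_const_pos[of 2] by (intro mult_left_mono) auto
  also have "block_moment r 2 x - 2 * real ?k * block_moment r 1 x + (real ?k)\<^sup>2 * ?W =
      (block_size_var + (block_mean - real ?k)\<^sup>2) * ?W"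
    using W by (simp add: block_size_var_def block_mean_def power2_eq_square field_simps)
  finally have Q: "block_size_var + (block_mean - real ?k)\<^sup>2 \<le> mode_const 2" using W by simp
  define c where "c = r / (4 * (mode_const 0 + 1)) * ?W"
  have m0: "0 < mode_const 0" by (rule mode_const_pos)
  have cp: "c \<le> r / 4 * ?p"
  proof -
    have "?W \<le> mode_const 0 * ?p" by (rule block_moment_0_le_mode_const[OF lr])
    also have "\<dots> \<le> (mode_const 0 + 1) * ?p" using p by (intro mult_right_mono) auto
    finally have "r / 4 * ?W \<le> r / 4 * ((mode_const 0 + 1) * ?p)" using r by (intro mult_left_mono) auto
    then show ?thesis using m0 by (simp add: c_def field_simps)
  qed
  have "c / 2 \<le> block_moment r 2 x - (block_moment r 1 x)\<^sup>2 / ?W"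
  proof (rule variance_ge[OF large])
    have "r / 4 * ?p \<le> 1 * ?p" using r p by (intro mult_right_mono) auto
    then show "c \<le> ?p" using cp by simp
    have "r / 4 * ?p \<le> r / 2 * ?p" using r p by (intro mult_right_mono) auto
    then show "c \<le> block_weight r x (Suc ?k)" using cp block_weight_Suc_mode[OF lr] by linarith
    show "0 \<le> c" using W r m0 by (simp add: c_def)
  qed
  also have "\<dots> = block_size_var * ?W"
    using W by (simp add: block_size_var_def block_mean_def power2_eq_square field_simps)
  finally have "r / (8 * (mode_const 0 + 1)) * ?W \<le> block_size_var * ?W" by (simp add: c_def)
  then show lower: "r / (8 * (mode_const 0 + 1)) \<le> block_size_var" by (rule mult_right_le_imp_le) (rule W)
  have "0 \<le> block_size_var" using lower r m0 by (intro order_trans[OF _ lower]) auto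
  then have "(block_mean - real ?k)\<^sup>2 \<le> mode_const 2" using Q by simp
  then show "\<bar>block_mean - real ?k\<bar> \<le> sqrt (mode_const 2)" using real_sqrt_le_mono by fastforce
  show "block_size_var \<le> mode_const 2" using Q zero_le_power2[of "block_mean - real ?k"] by linarith
  have B: "block_size_var + block_mean\<^sup>2 = block_moment r 2 x / ?W" by (simp add: block_size_var_def)
  show "block_var x = ?W * block_size_var / (block_size_var + block_mean\<^sup>2)"
    unfolding B block_size_var_def block_mean_def block_var_def
    using W block_moment_pos[OF x, of 2] by (simp add: power2_eq_square field_simps)
qed

text \<open>At the saddle point this brackets \<open>ln n\<close> by functions of the mode
  \<open>k\<close>. The logarithm of the modal weight is
  \<open>- L k (k - 1) / 2 + k ln x - ln k!\<close>, and the definition of the mode pins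
  \<open>ln x\<close> to \<open>L k\<close> up to \<open>O(ln k)\<close>, so the leading term is
  \<open>L k^2 / 2\<close>.\<close>

lemma ln_bounds:
  fixes k :: real
  defines "k \<equiv> real (block_mode x)" and "L \<equiv> - ln r" 
  shows "L * k * (k - 1) / 2 - k * ln k \<le> ln (block_moment r 1 x)"
    "ln (block_moment r 1 x) \<le> ln 8 + L * k + ln (k + 1) + L * k\<^sup>2 / 2 + L * k / 2 + k * ln (k + 1) + ln (k + sqrt (mode_const 2))"
proof -
  let ?W = "block_moment r 0 x" and ?p = "block_weight r x (block_mode x)"
  note lr = large_r[OF large]
  have W: "0 < ?W" and x: "0 < x" using large_W[OF large] large_x[OF large] by auto
  have k: "2 \<le> k" using block_mode(1)[OF lr] by (simp add: k_def)
  have L: "0 < L" using r r_less_1 by (simp add: L_def)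
  have p: "0 < ?p" using x k by (intro block_weight_pos) (auto simp: k_def)
  obtain i where i: "block_mode x = Suc i" "1 \<le> i" using block_mode(1)[OF lr] by (cases "block_mode x") auto
  have choose: "real (block_mode x choose 2) = k * (k - 1) / 2"
    by (simp add: k_def choose_two real_of_nat_div i algebra_simps)
  have lnp: "ln ?p = - L * (k * (k - 1) / 2) + k * ln x - ln (fact (block_mode x))"
    using r x i unfolding block_weight_def choose[symmetric]
    by (simp add: ln_div ln_mult ln_realpow L_def k_def i algebra_simps del: fact_Suc)
  have fact: "0 \<le> ln (fact (block_mode x) :: real)" "ln (fact (block_mode x) :: real) \<le> k * ln k"
  proof -
    show "0 \<le> ln (fact (block_mode x) :: real)" by (intro ln_ge_zero) simp
    have "fact (block_mode x) \<le> real (block_mode x ^ block_mode x)"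
      by (rule fact_le_power)
    then have "ln (fact (block_mode x) :: real) \<le> ln (k ^ block_mode x)"
      using k by (subst ln_le_cancel_iff) (auto simp: k_def)
    also have "\<dots> = k * ln k" using k by (simp add: ln_realpow k_def)
    finally show "ln (fact (block_mode x) :: real) \<le> k * ln k" .
  qed
  have x_up: "ln x \<le> L * k + ln (k + 1)"
  proof -
    have "ln (r ^ block_mode x * x) \<le> ln (k + 1)"
      using block_mode(3)[OF lr] r x by (subst ln_le_cancel_iff) (auto simp: k_def)
    then show ?thesis using r x by (simp add: ln_mult ln_realpow L_def k_def mult.commute)
  qed
  have x_low: "L * (k - 1) \<le> ln x"
  proof -
    have "1 \<le> r ^ i * x" using block_mode(4)[OF lr, of i] i by auto
    then have "ln 1 \<le> ln (r ^ i * x)" using r x by (subst ln_le_cancel_iff) auto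
    then show ?thesis using r x by (simp add: ln_mult ln_realpow L_def k_def i mult.commute)
  qed
  have "L * k * (k - 1) / 2 - k * ln k = - L * (k * (k - 1) / 2) + k * (L * (k - 1)) - k * ln k"
    by (simp add: field_simps)
  also have "\<dots> \<le> ln ?p"
    unfolding lnp using fact mult_left_mono[OF x_low, of k] k by linarith
  also have "\<dots> \<le> ln (block_moment r 1 x)"
  proof (subst ln_le_cancel_iff)
    have "?p \<le> ?W" using x by (intro block_weight_le_moment_0) simp
    then show le: "?p \<le> block_moment r 1 x" using moment_0_le_moment_1[OF large] by simp
    show "0 < block_moment r 1 x" using p le by simp
  qed (rule p)
  finally show "L * k * (k - 1) / 2 - k * ln k \<le> ln (block_moment r 1 x)" .
  have m: "0 < k + sqrt (mode_const 2)" using k mode_const_pos[of 2] by (simp add: add_pos_pos)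
  have "block_moment r 1 x = block_mean * ?W" using W by (simp add: block_mean_def)
  also have "\<dots> \<le> (k + sqrt (mode_const 2)) * ?W"
    using size_facts(1) W unfolding k_def by (intro mult_right_mono) auto
  also have "\<dots> \<le> (k + sqrt (mode_const 2)) * (8 * x * ?p)"
    using m large_W[OF large] by (intro mult_left_mono block_moment_0_le_mode lr) auto
  finally have "ln (block_moment r 1 x) \<le> ln ((k + sqrt (mode_const 2)) * (8 * x * ?p))"
    using m x p moment_0_le_moment_1[OF large] W by (subst ln_le_cancel_iff) auto
  also have "\<dots> = ln (k + sqrt (mode_const 2)) + (ln 8 + ln x + ln ?p)"
    using m x p by (simp add: ln_mult)
  also have "\<dots> \<le> ln (k + sqrt (mode_const 2)) + (ln 8 + (L * k + ln (k + 1)) + (- L * (k * (k - 1) / 2) + k * (L * k + ln (k + 1)) - 0))"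
    unfolding lnp using fact x_up mult_left_mono[OF x_up, of k] k by linarith
  also have "\<dots> = ln 8 + L * k + ln (k + 1) + L * k\<^sup>2 / 2 + L * k / 2 + k * ln (k + 1) + ln (k + sqrt (mode_const 2))"
    by (simp add: power2_eq_square field_simps)
  finally show "ln (block_moment r 1 x) \<le> ln 8 + L * k + ln (k + 1) + L * k\<^sup>2 / 2 + L * k / 2 + k * ln (k + 1) + ln (k + sqrt (mode_const 2))" .
qed

end

lemma filterlim_block_mode: "filterlim (\<lambda>x. real (block_mode x)) at_top at_top"
proof (rule filterlim_compose[OF filterlim_real_sequentially], subst filterlim_at_top, intro allI)
  fix K :: nat
  show "\<forall>\<^sub>F x in at_top. K \<le> block_mode x"
    using eventually_saddle_large eventually_gt_at_top[of "(real K + 1) / r ^ K"]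
  proof eventually_elim
    case (elim x)
    show ?case
    proof (rule ccontr)
      assume "\<not> K \<le> block_mode x"
      then have j: "block_mode x \<le> K" by simp
      have "r ^ K * x \<le> r ^ block_mode x * x"
        using j r large_x[OF elim(1)] by (intro mult_right_mono power_decreasing) auto
      also have "\<dots> \<le> real (block_mode x) + 1" by (rule block_mode(3)[OF large_r[OF elim(1)]])
      also have "\<dots> \<le> real K + 1" using j by simp
      finally show False using elim(2) r by (simp add: divide_less_eq mult.commute)
    qed
  qed
qed

text \<open>Both sides of \<open>ln_bounds\<close> have the leading term \<open>L k^2 / 2\<close>
  with \<open>L = - ln r\<close>. The mode is therefore asymptotic to
  \<open>sqrt (2 ln n / L)\<close>, the source of all powers of \<open>ln n\<close>.\<close>

lemma ln_saddle_tendsto: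
  "(\<lambda>n. ln (real n) / (real (block_mode (saddle n)))\<^sup>2) \<longlonglongrightarrow> - ln r / 2"
proof -
  let ?k = "\<lambda>n. real (block_mode (saddle n))"
  define L where "L = - ln r"
  define c where "c = sqrt (mode_const 2)"
  have L: "0 < L" and c: "0 < c" using r r_less_1 mode_const_pos[of 2] by (auto simp: L_def c_def)
  have k: "filterlim ?k at_top sequentially"
    by (rule filterlim_compose[OF filterlim_block_mode filterlim_saddle])
  have lo: "((\<lambda>k. (L * k * (k - 1) / 2 - k * ln k) / k\<^sup>2) \<longlongrightarrow> L / 2) at_top"
    using L by real_asymp
  have up: "((\<lambda>k. (ln 8 + L * k + ln (k + 1) + L * k\<^sup>2 / 2 + L * k / 2 + k * ln (k + 1) + ln (k + c)) / k\<^sup>2) \<longlongrightarrow> L / 2) at_top"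
    using L c by real_asymp
  have ev: "\<forall>\<^sub>F n in sequentially. saddle_large (saddle n) \<and> 0 < n"
    using filterlim_saddle eventually_saddle_large by (intro eventually_conj eventually_gt_at_top) (auto simp: filterlim_iff)
  have "(\<lambda>n. ln (real n) / (?k n)\<^sup>2) \<longlonglongrightarrow> L / 2"
  proof (rule tendsto_sandwich[OF _ _ filterlim_compose[OF lo k] filterlim_compose[OF up k]])
    show "\<forall>\<^sub>F n in sequentially. (L * ?k n * (?k n - 1) / 2 - ?k n * ln (?k n)) / (?k n)\<^sup>2 \<le> ln (real n) / (?k n)\<^sup>2"
      using ev
    proof eventually_elim
      case (elim n)
      then show ?case using ln_bounds(1)[of "saddle n"] saddle(2)[of n]
        by (intro divide_right_mono) (auto simp: L_def)
    qed
    show "\<forall>\<^sub>F n in sequentially. ln (real n) / (?k n)\<^sup>2 \<le>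
      (ln 8 + L * ?k n + ln (?k n + 1) + L * (?k n)\<^sup>2 / 2 + L * ?k n / 2 + ?k n * ln (?k n + 1) + ln (?k n + c)) / (?k n)\<^sup>2"
      using ev
    proof eventually_elim
      case (elim n)
      then show ?case using ln_bounds(2)[of "saddle n"] saddle(2)[of n]
        by (intro divide_right_mono) (auto simp: L_def c_def)
    qed
  qed
  then show ?thesis by (simp add: L_def)
qed

text \<open>Let \<open>u\<close> and \<open>v\<close> be the mean and variance of a block size. Then
  \<open>W = n / u\<close> and \<open>block_var = W v / (v + u^2)\<close>, with \<open>u\<close>
  asymptotic to the mode and \<open>v\<close> between two positive constants; so the residual
  variance is of order \<open>n / u^3\<close>. No limit of \<open>v\<close> is established, hence
  only \<open>\<Theta>\<close>.\<close>

lemma saddle_small_asymp: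
  "(\<lambda>n. block_moment r 0 (saddle n)) \<sim>[at_top] (\<lambda>n. sqrt (- ln r / 2) * (real n / sqrt (ln (real n))))"
  "(\<lambda>n. block_var (saddle n)) \<in> \<Theta>(\<lambda>n. real n / ln (real n) powr (3/2))"
proof -
  let ?k = "\<lambda>n. real (block_mode (saddle n))"
  let ?u = "\<lambda>n. block_mean (saddle n)" and ?v = "\<lambda>n. block_size_var (saddle n)"
  let ?W = "\<lambda>n. block_moment r 0 (saddle n)" and ?l = "\<lambda>n. ln (real n)"
  define H where "H = (- ln r / 2) powr (3/2)"
  have L: "0 < - ln r / 2" using r r_less_1 by simp
  have H: "0 < H" using L by (simp add: H_def)
  have k: "filterlim ?k at_top sequentially"
    by (rule filterlim_compose[OF filterlim_block_mode filterlim_saddle])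
  have ev: "\<forall>\<^sub>F n in sequentially. saddle_large (saddle n) \<and> 1 < n"
    using filterlim_saddle eventually_saddle_large by (intro eventually_conj eventually_gt_at_top) (auto simp: filterlim_iff)
  have facts: "\<forall>\<^sub>F n in sequentially. 0 < ?k n \<and> 0 < ?W n \<and> real n = ?u n * ?W n \<and> 0 < ?u n \<and> 0 < ?l n"
    using ev
  proof eventually_elim
    case (elim n)
    have "0 < ?W n" using large_W[of "saddle n"] elim by simp
    moreover have "real n = ?u n * ?W n" using calculation saddle(2)[of n] elim by (simp add: block_mean_def)
    moreover have "0 < ?k n" using block_mode(1)[OF large_r, of "saddle n"] elim by simp
    moreover have "0 < ?u n" using calculation(1,2) elim by (metis of_nat_0_less_iff less_trans zero_less_mult_pos2 zero_less_one)
    ultimately show ?case using elim by simp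
  qed
  have uk: "(\<lambda>n. ?u n / ?k n) \<longlonglongrightarrow> 1"
  proof -
    have "(\<lambda>n. ?u n / ?k n - 1) \<longlonglongrightarrow> 0"
    proof (rule Lim_null_comparison)
      show "(\<lambda>n. sqrt (mode_const 2) / ?k n) \<longlonglongrightarrow> 0"
        by (rule tendsto_divide_0[OF tendsto_const filterlim_at_top_imp_at_infinity[OF k]])
      show "\<forall>\<^sub>F n in sequentially. norm (?u n / ?k n - 1) \<le> sqrt (mode_const 2) / ?k n"
        using ev facts
      proof eventually_elim
        case (elim n)
        then have "?u n / ?k n - 1 = (?u n - ?k n) / ?k n" by (simp add: diff_divide_distrib)
        then show ?case using size_facts(1)[of "saddle n"] elim by (simp add: abs_divide divide_right_mono)
      qed
    qed
    then show ?thesis by (simp only: LIM_zero_iff)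
  qed
  have vk: "(\<lambda>n. ?v n / (?k n)\<^sup>2) \<longlonglongrightarrow> 0"
  proof (rule Lim_null_comparison)
    have "filterlim (\<lambda>n. (?k n)\<^sup>2) at_top sequentially" by (rule filterlim_pow_at_top[OF _ k]) simp
    then show "(\<lambda>n. mode_const 2 / (?k n)\<^sup>2) \<longlonglongrightarrow> 0"
      by (intro tendsto_divide_0[OF tendsto_const] filterlim_at_top_imp_at_infinity)
    show "\<forall>\<^sub>F n in sequentially. norm (?v n / (?k n)\<^sup>2) \<le> mode_const 2 / (?k n)\<^sup>2"
      using ev
    proof eventually_elim
      case (elim n)
      have "0 \<le> r / (8 * (mode_const 0 + 1))" using r mode_const_pos[of 0] by simp
      also have "\<dots> \<le> ?v n" using size_facts(3)[of "saddle n"] elim by simp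
      finally show ?case using size_facts(2)[of "saddle n"] elim by (simp add: divide_right_mono)
    qed
  qed
  show "?W \<sim>[at_top] (\<lambda>n. sqrt (- ln r / 2) * (real n / sqrt (?l n)))"
  proof (rule asymp_equivI')
    have "(\<lambda>n. sqrt (?l n / (?k n)\<^sup>2) / sqrt (- ln r / 2) / (?u n / ?k n)) \<longlonglongrightarrow> sqrt (- ln r / 2) / sqrt (- ln r / 2) / 1"
      using L by (intro tendsto_intros ln_saddle_tendsto uk) auto
    then have "(\<lambda>n. sqrt (?l n / (?k n)\<^sup>2) / sqrt (- ln r / 2) / (?u n / ?k n)) \<longlonglongrightarrow> 1" using L by simp
    moreover have "\<forall>\<^sub>F n in sequentially. sqrt (?l n / (?k n)\<^sup>2) / sqrt (- ln r / 2) / (?u n / ?k n) =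
       ?W n / (sqrt (- ln r / 2) * (real n / sqrt (?l n)))"
      using facts
    proof eventually_elim
      case (elim n)
      then have n: "real n = ?u n * ?W n" by simp
      show ?case unfolding n using elim L
        by (simp add: real_sqrt_divide field_simps)
    qed
    ultimately show "(\<lambda>n. ?W n / (sqrt (- ln r / 2) * (real n / sqrt (?l n)))) \<longlonglongrightarrow> 1"
      by (rule Lim_transform_eventually)
  qed
  \<comment> \<open>\<open>?h\<close> is \<open>block_var\<close> divided by \<open>v\<close> and by
    \<open>n / (ln n) powr (3/2)\<close>, written in quotients whose limits are known.\<close>
  let ?h = "\<lambda>n. 1 / ((?u n / ?k n) * (?v n / (?k n)\<^sup>2 + (?u n / ?k n)\<^sup>2)) * (?l n / (?k n)\<^sup>2) powr (3/2)"
  have "?h \<longlonglongrightarrow> 1 / (1 * (0 + 1\<^sup>2)) * (- ln r / 2) powr (3/2)"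
    using L by (intro tendsto_intros ln_saddle_tendsto uk vk) auto
  then have h: "?h \<longlonglongrightarrow> H" by (simp add: H_def)
  have h_low: "\<forall>\<^sub>F n in sequentially. H / 2 < ?h n" using h H by (intro order_tendstoD) auto
  have h_up: "\<forall>\<^sub>F n in sequentially. ?h n < 2 * H" using h H by (intro order_tendstoD) auto
  let ?g = "\<lambda>n. real n / ?l n powr (3/2)"
  let ?a = "r / (8 * (mode_const 0 + 1))"
  have a: "0 < ?a" using r mode_const_pos[of 0] by simp
  have main: "\<forall>\<^sub>F n in sequentially. ?a * (H / 2) * norm (?g n) \<le> norm (block_var (saddle n)) \<and>
     norm (block_var (saddle n)) \<le> mode_const 2 * (2 * H) * norm (?g n)"
    using ev facts h_low h_up
  proof eventually_elim
    case (elim n)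
    define u v w l k where defs: "u = ?u n" "v = ?v n" "w = ?W n" "l = ?l n" "k = ?k n"
    have pos: "0 < k" "0 < w" "0 < u" "0 < l" and n: "real n = u * w" using elim by (auto simp: defs)
    have v: "?a \<le> v" "v \<le> mode_const 2" using size_facts(2,3)[of "saddle n"] elim by (auto simp: defs)
    have v0: "0 < v" using v(1) a by linarith
    define h where "h = ?h n"
    have hb: "H / 2 < h" "h < 2 * H" using elim by (auto simp: h_def)
    have h_eq: "h = 1 / ((u / k) * (v / k\<^sup>2 + (u / k)\<^sup>2)) * (l / k\<^sup>2) powr (3/2)" by (simp add: h_def defs)
    have g: "0 < ?g n" unfolding defs(4)[symmetric] unfolding n using pos by simp
    have k3: "(k\<^sup>2) powr (3/2) = k ^ 3"
    proof -
      have "(k\<^sup>2) powr (3/2) = (k powr 2) powr (3/2)" using pos by (simp add: powr_numeral)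
      also have "\<dots> = k powr 3" by (simp add: powr_powr)
      finally show ?thesis using pos by (simp add: powr_numeral)
    qed
    have "v * h * ?g n = v * (1 / ((u / k) * (v / k\<^sup>2 + (u / k)\<^sup>2)) / k ^ 3) * (u * w)"
      unfolding h_eq defs(4)[symmetric] unfolding n using pos by (simp add: powr_divide k3)
    also have "1 / ((u / k) * (v / k\<^sup>2 + (u / k)\<^sup>2)) / k ^ 3 = 1 / (u * (v + u\<^sup>2))"
    proof -
      have "(u / k) * (v / k\<^sup>2 + (u / k)\<^sup>2) * k ^ 3 = u * (v + u\<^sup>2)"
        using pos by (simp add: power_divide field_simps eval_nat_numeral)
      then show ?thesis by (simp only: divide_divide_eq_left)
    qed
    also have "v * (1 / (u * (v + u\<^sup>2))) * (u * w) = w * v / (v + u\<^sup>2)" using pos by simp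
    also have "\<dots> = block_var (saddle n)" using size_facts(4)[of "saddle n"] elim by (simp add: defs)
    finally have V: "block_var (saddle n) = v * h * ?g n" by simp
    have "?a * (H / 2) * ?g n \<le> v * h * ?g n"
      using v hb a H g v0 by (intro mult_right_mono mult_mono) auto
    moreover have "v * h * ?g n \<le> mode_const 2 * (2 * H) * ?g n"
      using v hb H g v0 by (intro mult_right_mono mult_mono) auto
    moreover have "norm (v * h * ?g n) = v * h * ?g n"
      unfolding real_norm_def using v0 hb H g by (intro abs_of_nonneg mult_nonneg_nonneg) auto
    moreover have "norm (?g n) = ?g n" unfolding real_norm_def using g by (intro abs_of_pos)
    ultimately show ?case unfolding V by (simp only: simp_thms)
  qed
  show "(\<lambda>n. block_var (saddle n)) \<in> \<Theta>(\<lambda>n. real n / ?l n powr (3/2))"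
  proof (rule bigthetaI'[OF _ _ main])
    show "0 < ?a * (H / 2)" "0 < mode_const 2 * (2 * H)"
      using a H mode_const_pos[of 2] by (intro mult_pos_pos; simp)+
  qed
qed

end

theorem theorem1p1:
  fixes p :: real
  assumes "0 < p" and "p < 1"
  shows
    "(p > 1/2 \<longrightarrow>
        (\<lambda>n. measure_pmf.prob (random_cluster_graph n p) {E. num_clusters n E = 1})
          \<longlonglongrightarrow> 1 \<and>
        (\<lambda>n. measure_pmf.prob (random_cluster_graph n p) {complete_graph_edges n})
          \<longlonglongrightarrow> 1) \<and>
     (p = 1/2 \<longrightarrow>
        weak_conv_m (\<lambda>n. standardised_clusters n p) std_normal_distribution \<and>
        (\<lambda>n. mean_clusters n p) \<sim>[at_top] (\<lambda>n. real n / ln (real n)) \<and>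
        (\<lambda>n. var_clusters n p) \<sim>[at_top] (\<lambda>n. real n / (ln (real n))\<^sup>2)) \<and>
     (p < 1/2 \<longrightarrow>
        weak_conv_m (\<lambda>n. standardised_clusters n p) std_normal_distribution \<and>
        (\<lambda>n. mean_clusters n p) \<sim>[at_top]
          (\<lambda>n. sqrt ((ln (1 - p) - ln p) / 2) * (real n / sqrt (ln (real n)))) \<and>
        (\<lambda>n. var_clusters n p) \<in> \<Theta>(\<lambda>n. real n / ln (real n) powr (3/2)))"
proof (intro conjI impI)
  assume p: "p > 1/2"
  show "(\<lambda>n. measure_pmf.prob (random_cluster_graph n p) {E. num_clusters n E = 1}) \<longlonglongrightarrow> 1"
    "(\<lambda>n. measure_pmf.prob (random_cluster_graph n p) {complete_graph_edges n}) \<longlonglongrightarrow> 1"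
    using prob_complete_tendsto[of p] p assms by auto
next
  assume p: "p = 1/2"
  have r: "1 = p / (1 - p)" using p by simp
  show "weak_conv_m (\<lambda>n. standardised_clusters n p) std_normal_distribution"
    by (rule unit.standardised_clusters_weak_conv[OF assms r])
  show "(\<lambda>n. mean_clusters n p) \<sim>[at_top] (\<lambda>n. real n / ln (real n))"
    using unit.mean_clusters_asymp[OF assms r] saddle_unit_asymp(1) by (rule asymp_equiv_trans)
  show "(\<lambda>n. var_clusters n p) \<sim>[at_top] (\<lambda>n. real n / (ln (real n))\<^sup>2)"
    using unit.var_clusters_asymp[OF assms r] saddle_unit_asymp(2) by (rule asymp_equiv_trans)
next
  assume p: "p < 1/2"
  interpret small_cluster_weights "p / (1 - p)"
    using assms p by unfold_locales (auto simp: field_simps)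
  have L: "- ln (p / (1 - p)) / 2 = (ln (1 - p) - ln p) / 2" using assms by (simp add: ln_div)
  show "weak_conv_m (\<lambda>n. standardised_clusters n p) std_normal_distribution"
    by (rule standardised_clusters_weak_conv[OF assms refl])
  show "(\<lambda>n. mean_clusters n p) \<sim>[at_top]
      (\<lambda>n. sqrt ((ln (1 - p) - ln p) / 2) * (real n / sqrt (ln (real n))))"
    using mean_clusters_asymp[OF assms refl] saddle_small_asymp(1) unfolding L by (rule asymp_equiv_trans)
  show "(\<lambda>n. var_clusters n p) \<in> \<Theta>(\<lambda>n. real n / ln (real n) powr (3/2))"
    using asymp_equiv_imp_bigtheta[OF var_clusters_asymp[OF assms refl]] saddle_small_asymp(2)
    by (rule landau_theta.trans)
qed

end
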